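(* For every integer $\ell\ge0$, as $n\to\infty$, $$\mathrm{ou}_{2\ell}(n)\sim\frac{1}{2^{13/4}3^{1/4}n^{3/4}}\,(-6n)^{\ell}\,E_{2\ell}\!\left(\tfrac12\right)e^{\pi\sqrt{2n/3}}.$$
   Context: An odd unimodal sequence of size $n$ is a sequence of odd positive integers $a_1\le\dots\le a_r\le\bar c\ge b_1\ge\dots\ge b_s$ ($r,s\ge0$) with a distinguished peak $\bar c$ and $n=\bar c+\sum_{j=1}^r a_j+\sum_{j=1}^s b_j$. Its rank is $r-s$. Let $\mathrm{ou}(m,n)$ be the number of odd unimodal sequences of size $n$ with rank $m$, and $\mathrm{ou}_{\ell}(n)=\sum_{m\in\mathbb Z}m^{\ell}\,\mathrm{ou}(m,n)$. $E_r(x)$ is the $r$-th Euler polynomial. *)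

theory Defs
  imports "HOL-Analysis.Analysis" "HOL-Library.Landau_Symbols"
    "HOL-Computational_Algebra.Formal_Power_Series"
begin

text \<open>
  A triple \<open>(as, c, bs)\<close> stands for \<open>a\<^sub>1 \<le> \<dots> \<le> a\<^sub>r \<le> c \<ge> b\<^sub>1 \<ge> \<dots> \<ge> b\<^sub>s\<close>. Keeping \<open>c\<close> apart makes the
  peak distinguished: the same underlying sequence with its maximum marked at two different
  positions gives two different triples. Positivity of the parts follows from oddness.
\<close>

type_synonym peaked_seq = "nat list \<times> nat \<times> nat list"

definition odd_unimodal :: "peaked_seq \<Rightarrow> bool" where
  "odd_unimodal = (\<lambda>(as, c, bs).
     sorted_wrt (\<le>) (as @ [c]) \<and> sorted_wrt (\<ge>) (c # bs) \<and> (\<forall>x \<in> set (as @ c # bs). odd x))"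

definition seq_size :: "peaked_seq \<Rightarrow> nat" where
  "seq_size = (\<lambda>(as, c, bs). c + sum_list as + sum_list bs)"

definition seq_rank :: "peaked_seq \<Rightarrow> int" where
  "seq_rank = (\<lambda>(as, c, bs). int (length as) - int (length bs))"

definition ou :: "int \<Rightarrow> nat \<Rightarrow> nat" where
  "ou m n = card {u. odd_unimodal u \<and> seq_size u = n \<and> seq_rank u = m}"

definition ou_moment :: "nat \<Rightarrow> nat \<Rightarrow> real" where
  "ou_moment l n = (\<Sum>\<^sub>\<infinity>m\<in>(UNIV :: int set). real_of_int m ^ l * real (ou m n))"

text \<open>
  The Euler polynomials, from \<open>2 e\<^bsup>xt\<^esup> / (e\<^bsup>t\<^esup> + 1) = (\<Sum>r. E\<^sub>r(x) t\<^sup>r / r!)\<close>.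
\<close>

definition euler_poly :: "nat \<Rightarrow> real \<Rightarrow> real" where
  "euler_poly r x = fact r * fps_nth (2 * fps_exp x / (fps_exp 1 + 1)) r"

text \<open>
  Finiteness: the cardinality and the infinite sum above are genuine ones.
\<close>

lemma finite_odd_unimodal: "finite {u. odd_unimodal u \<and> seq_size u = n}"
proof -
  let ?L = "{xs :: nat list. set xs \<subseteq> {..n} \<and> length xs \<le> n}"
  have len: "length xs \<le> sum_list xs" if "\<forall>x\<in>set xs. odd x" for xs :: "nat list"
    using that
  proof (induction xs)
    case (Cons x xs)
    then have "x \<ge> 1" by (auto intro: odd_pos Suc_leI)
    with Cons show ?case by auto
  qed simp
  have mem: "x \<le> sum_list xs" if "x \<in> set xs" for x and xs :: "nat list"
    using that by (induction xs) auto
  have "{u. odd_unimodal u \<and> seq_size u = n} \<subseteq> ?L \<times> {..n} \<times> ?L"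
  proof
    fix u assume "u \<in> {u. odd_unimodal u \<and> seq_size u = n}"
    moreover obtain as c bs where u: "u = (as, c, bs)" by (cases u) auto
    ultimately have o: "\<forall>x\<in>set as. odd x" "\<forall>x\<in>set bs. odd x" and
      s: "c + sum_list as + sum_list bs = n"
      by (auto simp: odd_unimodal_def seq_size_def)
    have "\<forall>x\<in>set as. x \<le> n" "\<forall>x\<in>set bs. x \<le> n"
      using s by (auto dest: mem)
    then show "u \<in> ?L \<times> {..n} \<times> ?L"
      using len[OF o(1)] len[OF o(2)] s by (auto simp: u)
  qed
  moreover have "finite ?L" by (rule finite_lists_length_le) simp
  ultimately show ?thesis by (meson finite_SigmaI finite_atMost finite_subset)
qed

lemma finite_ou_support: "finite {m. ou m n \<noteq> 0}"
proof (rule finite_subset)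
  show "{m. ou m n \<noteq> 0} \<subseteq> seq_rank ` {u. odd_unimodal u \<and> seq_size u = n}"
  proof
    fix m assume "m \<in> {m. ou m n \<noteq> 0}"
    then have "card {u. odd_unimodal u \<and> seq_size u = n \<and> seq_rank u = m} \<noteq> 0"
      unfolding ou_def by (rule CollectD)
    then have "{u. odd_unimodal u \<and> seq_size u = n \<and> seq_rank u = m} \<noteq> {}"
      by (rule contrapos_nn) (simp only: card.empty)
    then show "m \<in> seq_rank ` {u. odd_unimodal u \<and> seq_size u = n}" by blast
  qed
qed (intro finite_imageI finite_odd_unimodal)

end

theory Submission
  imports Defs "HOL-Complex_Analysis.Complex_Analysis" "HOL-Probability.Probability"
    "HOL-Real_Asymp.Real_Asymp"
begin

text \<open>
  Expanding a moment of the rank in the central factorials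
  \<open>c\<^sub>r(m) = m\<^sup>2 (m\<^sup>2 - 1) \<dots> (m\<^sup>2 - (r-1)\<^sup>2) / (2r)!\<close> makes the generating functions factor. Adding one more
  admissible odd part \<open>c\<close> to both sides of the peak acts on a weight \<open>\<phi>\<close> of the rank through its second
  central difference (\<open>pair_gf_second_difference\<close>), and \<open>c\<^bsub>r+1\<^esub>\<close> has second difference \<open>c\<^sub>r\<close>. Hence the
  \<open>c\<^sub>r\<close>-weighted generating function of pairs of partitions into the first \<open>K\<close> odd numbers is
  \<open>G\<^sub>K h\<^sub>r(f\<^sub>1, f\<^sub>3, \<dots>)\<close>, where \<open>G\<^sub>K\<close> counts the pairs, \<open>h\<^sub>r\<close> is the complete homogeneous symmetric
  polynomial and \<open>f\<^sub>c = q\<^sup>c / (1 - q\<^sup>c)\<^sup>2\<close> (\<open>pair_gf_central_fact\<close>). All coefficients are nonnegative, so every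
  further step can be done by comparison. As \<open>m\<^bsup>2l\<^esup>\<close> is \<open>(2l)! c\<^sub>l(m)\<close> plus lower central factorials, and each
  step in \<open>r\<close> gains a factor of order \<open>n\<close>, only \<open>r = l\<close> matters.

  For \<open>r = 0\<close>, two telescoping sums squeeze the number \<open>u(n)\<close> of odd unimodal sequences between \<open>p(n)/2\<close> and
  \<open>p(n) - p(n-2)/2\<close>, where \<open>p(n)\<close> is the number of pairs of partitions into odd parts
  (\<open>peaked_coeff_0_bounds\<close>); so \<open>u(n) \<sim> p(n)/2\<close>. By Euler's theorem \<open>p(n)\<close> is a
  coefficient of \<open>\<Prod>(1 + q\<^sup>m)\<^sup>2\<close>, which the saddle point method handles. Its input is the behaviour of
  \<open>\<Sum> ln (1 + e\<^bsup>-mt\<^esup>)\<close> for real \<open>t\<close> only (\<open>sum_softplus_asymptotic\<close>): it shows that the tilted and rescaled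
  generating functions converge to \<open>e\<^bsup>A z\<^sup>2\<^esup>\<close>, \<open>A = \<pi>\<^sup>2/6\<close>, on the real axis, Montel's theorem carries this over to the
  complex plane (\<open>positive_exponential_sum_limit\<close>), and dominated convergence on the imaginary axis gives
  the coefficient (\<open>tilted_coeff_limit\<close>).

  For general \<open>r\<close>, convolving \<open>u\<close> with the coefficients of \<open>h\<^sub>r\<close> multiplies it asymptotically by the value of \<open>h\<^sub>r\<close> at
  \<open>q = e\<^bsup>-t\<^esup>\<close>, \<open>t = \<pi>/\<surd>(6n)\<close>, because \<open>u(n-k)\<close> is close to \<open>u(n) e\<^bsup>-kt\<^esup>\<close>
  (\<open>growth_sequence_convolution\<close>). There \<open>t\<^sup>2 f\<^sub>c\<close> tends to \<open>1/c\<^sup>2\<close> from below, so the value is about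
  \<open>t\<^bsup>-2r\<^esup> h\<^sub>r(1, 1/9, 1/25, \<dots>)\<close>. The generating function of these numbers is
  \<open>\<Prod> (1 - w\<^sup>2/(2i+1)\<^sup>2)\<^bsup>-1\<^esup> = sec (\<pi>w/2)\<close>, which is the generating function of the \<open>E\<^bsub>2l\<^esub>(1/2)\<close> on the imaginary
  axis (\<open>euler_poly_eq_hom_limit\<close>).
\<close>

unbundle no vec_syntax and fps_syntax

section \<open>Pairs of partitions into odd parts\<close>

text \<open>
  The two sides of an odd unimodal sequence are both stored as increasing lists, the right one reversed, so
  that a single recursion on the largest admissible part serves both.
\<close>
definition odd_lists :: "nat \<Rightarrow> nat list set" where
  "odd_lists K = {xs. sorted xs \<and> (\<forall>x\<in>set xs. odd x \<and> x < 2 * K)}"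

definition list_pairs :: "nat \<Rightarrow> nat \<Rightarrow> nat \<Rightarrow> (nat list \<times> nat list) set" where
  "list_pairs K L n = {(as, bs). as \<in> odd_lists K \<and> bs \<in> odd_lists L \<and> sum_list as + sum_list bs = n}"

definition pair_gf :: "nat \<Rightarrow> nat \<Rightarrow> (int \<Rightarrow> real) \<Rightarrow> real fps" where
  "pair_gf K L \<phi> = Abs_fps (\<lambda>n. \<Sum>(as, bs)\<in>list_pairs K L n. \<phi> (int (length as) - int (length bs)))"

lemma odd_lists_0: "odd_lists 0 = {[]}"
  by (auto simp: odd_lists_def)

text \<open>
  The right-hand side mentions \<open>odd_lists (Suc K)\<close> again: a list that contains the new part ends with it,
  and removing one copy leaves an arbitrary list of the same kind.
\<close>
lemma odd_lists_Suc:
  "odd_lists (Suc K) = odd_lists K \<union> (\<lambda>xs. xs @ [2 * K + 1]) ` odd_lists (Suc K)"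
proof (intro equalityI subsetI)
  fix xs assume xs: "xs \<in> odd_lists (Suc K)"
  show "xs \<in> odd_lists K \<union> (\<lambda>xs. xs @ [2 * K + 1]) ` odd_lists (Suc K)"
  proof (cases "xs \<in> odd_lists K")
    case False
    have le: "x < 2 * K \<or> x = 2 * K + 1" if "x \<in> set xs" for x
    proof -
      have "odd x" "x < 2 * K + 2" using xs that by (auto simp: odd_lists_def)
      moreover from \<open>odd x\<close> have "x \<noteq> 2 * K" by auto
      ultimately show ?thesis by linarith
    qed
    with False xs obtain x where x: "x \<in> set xs" "x = 2 * K + 1"
      by (force simp: odd_lists_def)
    then have "xs \<noteq> []" by auto
    then obtain ys y where ys: "xs = ys @ [y]" by (metis rev_exhaust)
    have "y = 2 * K + 1"
    proof -
      have "x \<le> y" using x xs ys by (auto simp: odd_lists_def sorted_append)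
      moreover have "y \<in> set xs" using ys by simp
      ultimately show ?thesis using le[of y] x by auto
    qed
    moreover have "ys \<in> odd_lists (Suc K)"
      using xs ys by (auto simp: odd_lists_def sorted_append)
    ultimately show ?thesis using ys by auto
  qed auto
next
  fix xs assume "xs \<in> odd_lists K \<union> (\<lambda>xs. xs @ [2 * K + 1]) ` odd_lists (Suc K)"
  then show "xs \<in> odd_lists (Suc K)"
    by (fastforce simp: odd_lists_def sorted_append less_Suc_eq)
qed

lemma finite_list_pairs: "finite (list_pairs K L n)"
proof -
  have len: "length xs \<le> sum_list xs" if "\<forall>x\<in>set xs. odd x" for xs :: "nat list"
    using that
  proof (induction xs)
    case (Cons x xs)
    then have "x \<ge> 1" by (auto intro: odd_pos Suc_leI)
    with Cons show ?case by auto
  qed simp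
  let ?S = "\<lambda>K. {xs :: nat list. set xs \<subseteq> {..<2*K} \<and> length xs \<le> n}"
  have "list_pairs K L n \<subseteq> ?S K \<times> ?S L"
  proof
    fix p assume "p \<in> list_pairs K L n"
    then obtain as bs where p: "p = (as, bs)" "as \<in> odd_lists K" "bs \<in> odd_lists L"
      "sum_list as + sum_list bs = n" by (auto simp: list_pairs_def)
    then show "p \<in> ?S K \<times> ?S L"
      using len[of as] len[of bs] by (auto simp: odd_lists_def)
  qed
  moreover have "finite (?S K)" for K by (rule finite_lists_length_le) simp
  ultimately show ?thesis by (meson finite_SigmaI finite_subset)
qed

lemma pair_gf_add: "pair_gf K L (\<lambda>m. \<phi> m + \<psi> m) = pair_gf K L \<phi> + pair_gf K L \<psi>"
  by (rule fps_ext) (simp add: pair_gf_def sum.distrib case_prod_unfold)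

lemma pair_gf_cmult: "pair_gf K L (\<lambda>m. a * \<phi> m) = fps_const a * pair_gf K L \<phi>"
  by (rule fps_ext) (simp add: pair_gf_def sum_distrib_left case_prod_unfold)

lemma pair_gf_sum:
  assumes "finite S"
  shows "pair_gf K L (\<lambda>m. \<Sum>i\<in>S. a i * \<phi> i m) = (\<Sum>i\<in>S. fps_const (a i) * pair_gf K L (\<phi> i))"
  using assms
proof (induction S)
  case empty
  show ?case by (rule fps_ext) (simp add: pair_gf_def)
next
  case (insert i S)
  then show ?case by (simp add: pair_gf_add pair_gf_cmult)
qed

lemma pair_gf_0_0: "pair_gf 0 0 \<phi> = fps_const (\<phi> 0)"
proof (rule fps_ext)
  fix n
  have "list_pairs 0 0 n = (if n = 0 then {([], [])} else {})"
    by (auto simp: list_pairs_def odd_lists_0)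
  then show "pair_gf 0 0 \<phi> $ n = fps_const (\<phi> 0) $ n"
    by (simp add: pair_gf_def)
qed

lemma pair_gf_swap: "pair_gf K L \<phi> = pair_gf L K (\<lambda>m. \<phi> (- m))"
proof (rule fps_ext)
  fix n
  show "pair_gf K L \<phi> $ n = pair_gf L K (\<lambda>m. \<phi> (- m)) $ n"
    unfolding pair_gf_def fps_nth_Abs_fps
    by (rule sum.reindex_bij_witness[of _ prod.swap prod.swap])
       (auto simp: list_pairs_def)
qed

text \<open>
  Removing the largest part from the left list lowers the size by that part and the rank by one, which turns the
  recursion for the lists into a shift of the weight.
\<close>
lemma pair_gf_Suc_left:
  "pair_gf (Suc K) L \<phi> = pair_gf K L \<phi> + fps_X ^ (2*K+1) * pair_gf (Suc K) L (\<lambda>m. \<phi> (m + 1))"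
proof (rule fps_ext)
  fix n
  define c where "c = 2 * K + 1"
  define app where "app = (\<lambda>(as :: nat list, bs :: nat list). (as @ [c], bs))"
  define T where "T = (if n < c then {} else list_pairs (Suc K) L (n - c))"
  have split: "list_pairs (Suc K) L n = list_pairs K L n \<union> app ` T"
  proof (intro equalityI subsetI)
    fix p assume "p \<in> list_pairs (Suc K) L n"
    then obtain as bs where p: "p = (as, bs)" "as \<in> odd_lists (Suc K)" "bs \<in> odd_lists L"
      "sum_list as + sum_list bs = n" by (auto simp: list_pairs_def)
    from p(2) consider "as \<in> odd_lists K"
      | as' where "as = as' @ [c]" "as' \<in> odd_lists (Suc K)"
      unfolding c_def by (subst (asm) odd_lists_Suc) blast
    then show "p \<in> list_pairs K L n \<union> app ` T"
    proof cases
      case 1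
      then show ?thesis using p by (auto simp: list_pairs_def)
    next
      case 2
      then have "(as', bs) \<in> T" using p by (auto simp: T_def list_pairs_def)
      then have "app (as', bs) \<in> app ` T" by (rule imageI)
      then show ?thesis using p 2 by (auto simp: app_def)
    qed
  next
    fix p assume "p \<in> list_pairs K L n \<union> app ` T"
    then consider "p \<in> list_pairs K L n" | "p \<in> app ` T" by blast
    then show "p \<in> list_pairs (Suc K) L n"
    proof cases
      case 1
      moreover have "odd_lists K \<subseteq> odd_lists (Suc K)" by (auto simp: odd_lists_def)
      ultimately show ?thesis by (auto simp: list_pairs_def)
    next
      case 2
      then obtain as bs where ab: "(as, bs) \<in> T" "p = (as @ [c], bs)"
        by (auto simp: app_def)
      then have "as @ [c] \<in> odd_lists (Suc K)"
        by (subst odd_lists_Suc, unfold c_def, intro UnI2 imageI) (auto simp: T_def list_pairs_def split: if_splits)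
      then show ?thesis using ab by (auto simp: list_pairs_def T_def split: if_splits)
    qed
  qed
  have disj: "list_pairs K L n \<inter> app ` T = {}"
    by (auto simp: list_pairs_def odd_lists_def app_def c_def)
  have inj: "inj_on app T" by (auto simp: inj_on_def app_def)
  have fT: "finite T" by (simp add: T_def finite_list_pairs)
  let ?f = "\<lambda>(as :: nat list, bs :: nat list). \<phi> (int (length as) - int (length bs))"
  have "pair_gf (Suc K) L \<phi> $ n = sum ?f (list_pairs K L n) + sum ?f (app ` T)"
    unfolding pair_gf_def fps_nth_Abs_fps split
    by (rule sum.union_disjoint[OF finite_list_pairs finite_imageI[OF fT] disj])
  also have "sum ?f (app ` T) = (\<Sum>(as, bs)\<in>T. \<phi> (int (length as) - int (length bs) + 1))"
    by (subst sum.reindex[OF inj]) (auto simp: app_def algebra_simps intro!: sum.cong)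
  finally show "pair_gf (Suc K) L \<phi> $ n
      = (pair_gf K L \<phi> + fps_X ^ (2*K+1) * pair_gf (Suc K) L (\<lambda>m. \<phi> (m + 1))) $ n"
    unfolding c_def[symmetric] by (simp add: pair_gf_def fps_X_power_mult_nth T_def)
qed

lemma pair_gf_Suc_right:
  "pair_gf K (Suc L) \<phi> = pair_gf K L \<phi> + fps_X ^ (2*L+1) * pair_gf K (Suc L) (\<lambda>m. \<phi> (m - 1))"
proof -
  have "pair_gf K (Suc L) \<phi> = pair_gf (Suc L) K (\<lambda>m. \<phi> (- m))" by (rule pair_gf_swap)
  also have "\<dots> = pair_gf L K (\<lambda>m. \<phi> (- m))
      + fps_X ^ (2*L+1) * pair_gf (Suc L) K (\<lambda>m. \<phi> (- (m + 1)))"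
    by (rule pair_gf_Suc_left)
  also have "pair_gf L K (\<lambda>m. \<phi> (- m)) = pair_gf K L \<phi>" by (rule pair_gf_swap[symmetric])
  also have "pair_gf (Suc L) K (\<lambda>m. \<phi> (- (m + 1))) = pair_gf K (Suc L) (\<lambda>m. \<phi> (m - 1))"
    by (subst (2) pair_gf_swap) simp
  finally show ?thesis .
qed

text \<open>
  Admitting the part \<open>c\<close> on both sides divides by \<open>(1 - z q\<^sup>c)(1 - z\<^bsup>-1\<^esup> q\<^sup>c) = (1 - q\<^sup>c)\<^sup>2 - q\<^sup>c (z - 2 + z\<^bsup>-1\<^esup>)\<close>
  when \<open>z\<close> marks the rank. On the weights, \<open>z\<close> and \<open>z\<^bsup>-1\<^esup>\<close> are the two unit shifts, so \<open>z - 2 + z\<^bsup>-1\<^esup>\<close> is the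
  second central difference.
\<close>
lemma pair_gf_second_difference:
  fixes \<phi> :: "int \<Rightarrow> real"
  shows "(1 - fps_X ^ (2*K+1))\<^sup>2 * pair_gf (Suc K) (Suc K) \<phi>
    = pair_gf K K \<phi> + fps_X ^ (2*K+1) * pair_gf (Suc K) (Suc K) (\<lambda>m. \<phi> (m + 1) - 2 * \<phi> m + \<phi> (m - 1))"
proof -
  define c where "c = 2 * K + 1"
  let ?Z = "pair_gf (Suc K) (Suc K)"
  have l: "pair_gf K (Suc K) \<psi> = ?Z \<psi> - fps_X ^ c * ?Z (\<lambda>m. \<psi> (m + 1))" for \<psi>
    unfolding c_def using pair_gf_Suc_left[of K "Suc K" \<psi>] by simp
  have r: "pair_gf K K \<phi> = pair_gf K (Suc K) \<phi> - fps_X ^ c * pair_gf K (Suc K) (\<lambda>m. \<phi> (m - 1))"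
    unfolding c_def using pair_gf_Suc_right[of K K \<phi>] by simp
  have "?Z (\<lambda>m. \<phi> (m + 1) - 2 * \<phi> m + \<phi> (m - 1))
      = ?Z (\<lambda>m. \<phi> (m + 1)) + fps_const (- 2) * ?Z \<phi> + ?Z (\<lambda>m. \<phi> (m - 1))"
    using pair_gf_add[of "Suc K" "Suc K" "\<lambda>m. \<phi> (m + 1) + (- 2) * \<phi> m" "\<lambda>m. \<phi> (m - 1)"]
      pair_gf_add[of "Suc K" "Suc K" "\<lambda>m. \<phi> (m + 1)" "\<lambda>m. (- 2) * \<phi> m"]
      pair_gf_cmult[of "Suc K" "Suc K" "- 2" \<phi>] by simp
  also have "fps_const (- 2 :: real) = - 2" by (simp flip: fps_numeral_fps_const fps_const_neg)
  finally have d: "?Z (\<lambda>m. \<phi> (m + 1) - 2 * \<phi> m + \<phi> (m - 1))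
      = ?Z (\<lambda>m. \<phi> (m + 1)) - 2 * ?Z \<phi> + ?Z (\<lambda>m. \<phi> (m - 1))" by simp
  show ?thesis
    unfolding c_def[symmetric] d r l by (simp add: algebra_simps power2_eq_square)
qed

lemma ou_moment_eq_sum_rank:
  "ou_moment p n = (\<Sum>u | odd_unimodal u \<and> seq_size u = n. real_of_int (seq_rank u) ^ p)"
proof -
  let ?U = "{u. odd_unimodal u \<and> seq_size u = n}"
  have fin: "finite ?U" by (rule finite_odd_unimodal)
  have sub: "ou m n = 0" if "m \<notin> seq_rank ` ?U" for m
  proof -
    have "{u. odd_unimodal u \<and> seq_size u = n \<and> seq_rank u = m} = {}" using that by auto
    then show ?thesis unfolding ou_def by (simp only: card.empty)
  qed
  have "ou_moment p n = (\<Sum>\<^sub>\<infinity>m\<in>seq_rank ` ?U. real_of_int m ^ p * real (ou m n))"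
    unfolding ou_moment_def by (rule infsum_cong_neutral) (auto simp: sub)
  also have "\<dots> = (\<Sum>m\<in>seq_rank ` ?U. real_of_int m ^ p * real (ou m n))"
    using fin by (simp add: infsum_finite)
  also have "\<dots> = (\<Sum>m\<in>seq_rank ` ?U. \<Sum>u\<in>{u\<in>?U. seq_rank u = m}. real_of_int (seq_rank u) ^ p)"
  proof (rule sum.cong[OF refl])
    fix m
    have "ou m n = card {u\<in>?U. seq_rank u = m}"
      unfolding ou_def by (rule arg_cong[of _ _ card]) auto
    then show "real_of_int m ^ p * real (ou m n)
        = (\<Sum>u\<in>{u\<in>?U. seq_rank u = m}. real_of_int (seq_rank u) ^ p)"
      by simp
  qed
  also have "\<dots> = (\<Sum>u\<in>?U. real_of_int (seq_rank u) ^ p)"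
    by (rule sum.image_gen[OF fin, symmetric])
  finally show ?thesis .
qed

text \<open>
  A sequence is cut at its peak \<open>2k+1\<close>; a peak with \<open>k \<ge> n\<close> exceeds the size \<open>n\<close>, which makes the sum finite.
\<close>
lemma ou_moment_eq_coeff:
  "ou_moment p n
     = (\<Sum>k<n. fps_X ^ (2*k+1) * pair_gf (Suc k) (Suc k) (\<lambda>m. real_of_int m ^ p)) $ n"
proof -
  let ?U = "{u. odd_unimodal u \<and> seq_size u = n}"
  define B where "B = (\<lambda>k. if 2 * k + 1 \<le> n then list_pairs (Suc k) (Suc k) (n - (2*k+1)) else {})"
  have "ou_moment p n = (\<Sum>u\<in>?U. real_of_int (seq_rank u) ^ p)"
    by (rule ou_moment_eq_sum_rank)
  also have "\<dots> = (\<Sum>(k, as, bs)\<in>(SIGMA k:{..<n}. B k).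
      real_of_int (int (length as) - int (length bs)) ^ p)"
  proof (rule sum.reindex_bij_witness[of _ "\<lambda>(k, as, bs). (as, 2 * k + 1, rev bs)"
        "\<lambda>(as, c, bs). (c div 2, as, rev bs)"], goal_cases)
    case (1 u)
    then show ?case by (auto simp: odd_unimodal_def)
  next
    case (2 u)
    obtain as c bs where u: "u = (as, c, bs)" by (cases u) auto
    have o: "sorted as" "\<forall>x\<in>set as. x \<le> c" "sorted (rev bs)" "\<forall>x\<in>set bs. x \<le> c"
      "odd c" "\<forall>x\<in>set as. odd x" "\<forall>x\<in>set bs. odd x" "c + sum_list as + sum_list bs = n"
      using 2 by (auto simp: u odd_unimodal_def seq_size_def sorted_wrt_append sorted_wrt_rev)
    from \<open>odd c\<close> obtain k where c: "c = 2 * k + 1" by (elim oddE)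
    have "x < 2 * Suc k" if "x \<le> c" for x using that c by simp
    then have "(as, rev bs) \<in> B k"
      using o c by (auto simp: B_def list_pairs_def odd_lists_def sum_list_rev)
    moreover have "k < n" using o(8) c by linarith
    ultimately show ?case by (simp add: u c)
  next
    case (3 x)
    then show ?case by auto
  next
    case (4 x)
    then obtain k as bs where x: "x = (k, as, bs)" "2 * k + 1 \<le> n"
      "(as, bs) \<in> list_pairs (Suc k) (Suc k) (n - (2*k+1))"
      by (auto simp: B_def split: if_splits)
    have le: "y \<le> 2 * k + 1" if "y < 2 * Suc k" for y using that by simp
    have as: "sorted as" "\<forall>y\<in>set as. odd y \<and> y < 2 * Suc k" and
      bs: "sorted bs" "\<forall>y\<in>set bs. odd y \<and> y < 2 * Suc k" and
      s: "sum_list as + sum_list bs = n - (2*k+1)"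
      using x(3) by (auto simp: list_pairs_def odd_lists_def)
    have "sorted_wrt (\<le>) (as @ [2*k+1])"
      using as by (fastforce simp: sorted_wrt_append)
    moreover have "sorted_wrt (\<ge>) ((2*k+1) # rev bs)"
      using bs by (fastforce simp: sorted_wrt_rev)
    ultimately show ?case
      using as bs s x(2) by (auto simp: x(1) odd_unimodal_def seq_size_def sum_list_rev)
  next
    case (5 u)
    then show ?case by (simp add: seq_rank_def case_prod_unfold)
  qed
  also have "\<dots> = (\<Sum>k<n. \<Sum>(as, bs)\<in>B k. real_of_int (int (length as) - int (length bs)) ^ p)"
    by (subst sum.Sigma) (auto simp: B_def finite_list_pairs)
  also have "\<dots> = (\<Sum>k<n. (fps_X ^ (2*k+1) * pair_gf (Suc k) (Suc k) (\<lambda>m. real_of_int m ^ p)) $ n)"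
    by (intro sum.cong refl) (simp del: power_Suc add: fps_X_power_mult_nth B_def pair_gf_def)
  finally show ?thesis by (simp add: fps_sum_nth)
qed

section \<open>Central factorial moments of the rank\<close>

text \<open>
  The central factorial \<open>m\<^sup>2 (m\<^sup>2 - 1) \<dots> (m\<^sup>2 - (r-1)\<^sup>2) / (2r)!\<close>, written as a mean of two
  binomial coefficients: each of them has the required second difference by Pascal's rule, but only the mean
  is even in \<open>m\<close>, and evenness is what allows even powers to be expanded.
\<close>
definition central_fact :: "nat \<Rightarrow> int \<Rightarrow> real" where
  "central_fact r m = ((real_of_int m + real r gchoose (2 * r)) + (real_of_int m + real r - 1 gchoose (2 * r))) / 2"

lemma central_fact_0 [simp]: "central_fact 0 m = 1"
  by (simp add: central_fact_def)

lemma central_fact_Suc_at_0 [simp]: "central_fact (Suc r) 0 = 0"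
proof -
  have "(real (Suc r) gchoose (2 * Suc r)) = 0" "(real r gchoose (2 * Suc r)) = 0"
    by (simp_all add: binomial_eq_0 del: of_nat_Suc flip: binomial_gbinomial)
  moreover have "real_of_int 0 + real (Suc r) = real (Suc r)" "real_of_int 0 + real (Suc r) - 1 = real r"
    by simp_all
  ultimately show ?thesis unfolding central_fact_def by (simp only:) simp
qed

text \<open>
  Pascal's rule, applied twice to each of the two binomial coefficients.
\<close>
lemma central_fact_second_difference:
  "central_fact (Suc r) (m + 1) - 2 * central_fact (Suc r) m + central_fact (Suc r) (m - 1) = central_fact r m"
proof -
  have pascal: "(y + 1 gchoose (k + 2)) - 2 * (y gchoose (k + 2)) + (y - 1 gchoose (k + 2)) = (y - 1 gchoose k)"
    for y :: real and k
  proof -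
    have "(y + 1 gchoose (k + 2)) = (y gchoose (k + 1)) + (y gchoose (k + 2))"
      using gbinomial_Suc_Suc[of y "k + 1"] by simp
    moreover have "(y gchoose (k + 2)) = (y - 1 gchoose (k + 1)) + (y - 1 gchoose (k + 2))"
      using gbinomial_Suc_Suc[of "y - 1" "k + 1"] by simp
    moreover have "(y gchoose (k + 1)) = (y - 1 gchoose k) + (y - 1 gchoose (k + 1))"
      using gbinomial_Suc_Suc[of "y - 1" k] by simp
    ultimately show ?thesis by simp
  qed
  show ?thesis
    using pascal[of "real_of_int m + real r + 1" "2 * r"] pascal[of "real_of_int m + real r" "2 * r"]
    by (simp add: central_fact_def field_simps)
qed

text \<open>
  The recursion of the product formula for the central factorial. It is what multiplication by \<open>m\<^sup>2\<close> does to
  the basis of central factorials.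
\<close>
lemma central_fact_Suc:
  "((real_of_int m)\<^sup>2 - (real r)\<^sup>2) * central_fact r m
     = real ((2 * r + 1) * (2 * r + 2)) * central_fact (Suc r) m"
proof -
  define x where "x = real_of_int m + real r - 1"
  have up: "(y + 1 gchoose (k + 2)) * (real (k + 1) * real (k + 2)) = (y + 1) * (y - real k) * (y gchoose k)"
    for y :: real and k
  proof -
    have "(y + 1 gchoose (k + 2)) * real (k + 2) = (y gchoose (k + 1)) * (y + 1)"
      using gbinomial_rec[of y "k + 1"] by (simp add: field_simps)
    moreover have "(y gchoose (k + 1)) * real (k + 1) = (y - real k) * (y gchoose k)"
      using gbinomial_mult_1[of y k] by (simp add: algebra_simps)
    ultimately show ?thesis by (metis (no_types, lifting) mult.assoc mult.commute)
  qed
  let ?m = "real_of_int m" and ?r = "real r"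
  let ?C1 = "x + 1 gchoose (2 * r)" and ?C2 = "x gchoose (2 * r)"
  have rel: "(?m - ?r) * ?C1 = (?m + ?r) * ?C2"
  proof (cases r)
    case (Suc q)
    let ?P = "x gchoose (2 * q + 1)"
    have 1: "?C1 * (2 * ?r) = ?P * (?m + ?r)"
      using gbinomial_rec[of x "2 * q + 1"] by (simp add: Suc x_def field_simps)
    have 2: "?C2 * (2 * ?r) = (?m - ?r) * ?P"
      using gbinomial_mult_1[of x "2 * q + 1"] by (simp add: Suc x_def algebra_simps)
    have "(?m - ?r) * ?C1 * (2 * ?r) = (?m - ?r) * (?C1 * (2 * ?r))" by simp
    also have "\<dots> = (?m + ?r) * (?C2 * (2 * ?r))" unfolding 1 2 by simp
    finally have "(?m - ?r) * ?C1 * (2 * ?r) = (?m + ?r) * ?C2 * (2 * ?r)" by simp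
    then show ?thesis by (simp add: Suc)
  qed simp
  have "central_fact (Suc r) m = ((x + 1 + 1 gchoose (2 * r + 2)) + (x + 1 gchoose (2 * r + 2))) / 2"
    by (simp add: central_fact_def x_def algebra_simps)
  then have "real ((2 * r + 1) * (2 * r + 2)) * central_fact (Suc r) m
      = ((x + 1 + 1 gchoose (2 * r + 2)) * (real (2 * r + 1) * real (2 * r + 2))
         + (x + 1 gchoose (2 * r + 2)) * (real (2 * r + 1) * real (2 * r + 2))) / 2"
    by (simp only: of_nat_mult) (simp add: algebra_simps)
  also have "\<dots> = ((?m + ?r + 1) * ((?m - ?r) * ?C1) + (?m - ?r - 1) * ((?m + ?r) * ?C2)) / 2"
    unfolding up by (simp add: x_def algebra_simps)
  also have "(?m + ?r + 1) * ((?m - ?r) * ?C1) + (?m - ?r - 1) * ((?m + ?r) * ?C2)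
      = (?m + ?r) * ((?m - ?r) * ?C1) + (?m - ?r) * ((?m + ?r) * ?C2)"
    using rel by (simp add: algebra_simps)
  also have "\<dots> = (?m\<^sup>2 - ?r\<^sup>2) * (?C1 + ?C2)"
    by (simp add: algebra_simps power2_eq_square)
  finally have *: "real ((2 * r + 1) * (2 * r + 2)) * central_fact (Suc r) m = (?m\<^sup>2 - ?r\<^sup>2) * (?C1 + ?C2) / 2" .
  have "central_fact r m = (?C1 + ?C2) / 2" by (simp add: central_fact_def x_def)
  then show ?thesis by (simp only: *)
qed

lemma even_power_eq_sum_central_fact:
  "\<exists>T. T l = fact (2 * l) \<and> (\<forall>m. real_of_int m ^ (2 * l) = (\<Sum>k\<le>l. T k * central_fact k m))"
proof (induction l)
  case 0
  show ?case by (intro exI[of _ "\<lambda>_. 1"]) simp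
next
  case (Suc l)
  then obtain T where T: "T l = fact (2 * l)"
    "\<And>m. real_of_int m ^ (2 * l) = (\<Sum>k\<le>l. T k * central_fact k m)" by blast
  define D where "D = (\<lambda>k. real ((2 * k + 1) * (2 * k + 2)))"
  \<comment> \<open>multiplication by \<open>m\<^sup>2\<close> keeps \<open>c\<^sub>k\<close> with factor \<open>k\<^sup>2\<close> and passes \<open>(2k+1)(2k+2)\<close> on to \<open>c\<^bsub>k+1\<^esub>\<close>\<close>
  define S where "S = (\<lambda>k. (if k \<le> l then T k * (real k)\<^sup>2 else 0) + (case k of 0 \<Rightarrow> 0 | Suc j \<Rightarrow> T j * D j))"
  have "S (Suc l) = fact (2 * Suc l)"
    by (simp add: S_def T(1) D_def algebra_simps)
  moreover have "real_of_int m ^ (2 * Suc l) = (\<Sum>k\<le>Suc l. S k * central_fact k m)" for m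
  proof -
    have "real_of_int m ^ (2 * Suc l) = (real_of_int m)\<^sup>2 * (\<Sum>k\<le>l. T k * central_fact k m)"
      by (simp flip: T(2) add: power2_eq_square)
    also have "\<dots> = (\<Sum>k\<le>l. T k * (real k)\<^sup>2 * central_fact k m + T k * D k * central_fact (Suc k) m)"
      unfolding sum_distrib_left
    proof (rule sum.cong[OF refl])
      fix k
      have "(real_of_int m)\<^sup>2 * central_fact k m
          = (real k)\<^sup>2 * central_fact k m + D k * central_fact (Suc k) m"
        using central_fact_Suc[of m k] unfolding D_def by (simp only: algebra_simps)
      then have "T k * ((real_of_int m)\<^sup>2 * central_fact k m)
          = T k * ((real k)\<^sup>2 * central_fact k m + D k * central_fact (Suc k) m)" by simp
      then show "(real_of_int m)\<^sup>2 * (T k * central_fact k m)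
          = T k * (real k)\<^sup>2 * central_fact k m + T k * D k * central_fact (Suc k) m"
        by (simp only: algebra_simps)
    qed
    also have "\<dots> = (\<Sum>k\<le>l. T k * (real k)\<^sup>2 * central_fact k m) + (\<Sum>k\<le>l. T k * D k * central_fact (Suc k) m)"
      by (rule sum.distrib)
    also have "\<dots> = (\<Sum>k\<le>Suc l. (if k \<le> l then T k * (real k)\<^sup>2 else 0) * central_fact k m)
        + (\<Sum>k\<le>Suc l. (case k of 0 \<Rightarrow> 0 | Suc j \<Rightarrow> T j * D j) * central_fact k m)"
      by (subst (2) sum.atMost_Suc_shift) simp
    also have "\<dots> = (\<Sum>k\<le>Suc l. S k * central_fact k m)"
      unfolding sum.distrib[symmetric] by (rule sum.cong) (simp_all only: S_def algebra_simps)
    finally show ?thesis .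
  qed
  ultimately show ?case by blast
qed

text \<open>
  The geometric series \<open>1 / (1 - q\<^sup>c)\<close>, given by its coefficients because their nonnegativity is used throughout.
\<close>
definition geo_fps :: "nat \<Rightarrow> real fps" where
  "geo_fps c = Abs_fps (\<lambda>n. if c dvd n then 1 else 0)"

lemma geo_fps_mult:
  assumes "c > 0"
  shows "geo_fps c * (1 - fps_X ^ c) = 1"
proof -
  have "geo_fps c = 1 + fps_X ^ c * geo_fps c"
  proof (rule fps_ext)
    fix n
    have "c dvd n \<longleftrightarrow> n = 0 \<or> (c \<le> n \<and> c dvd (n - c))" using assms
      by (metis dvd_0_right dvd_diff_nat dvd_imp_le dvd_refl le_add_diff_inverse neq0_conv dvd_add)
    then show "geo_fps c $ n = (1 + fps_X ^ c * geo_fps c) $ n"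
      using assms by (auto simp: geo_fps_def fps_X_power_mult_nth)
  qed
  then show ?thesis by (simp add: algebra_simps)
qed

text \<open>
  \<open>\<Prod> (1 - q\<^sup>c)\<^bsup>-2\<^esup>\<close> over the first \<open>K\<close> odd numbers \<open>c\<close>: pairs of partitions into these parts.
\<close>
fun odd_pairs_gf :: "nat \<Rightarrow> real fps" where
  "odd_pairs_gf 0 = 1"
| "odd_pairs_gf (Suc K) = odd_pairs_gf K * (geo_fps (2*K+1))\<^sup>2"

text \<open>
  The complete homogeneous symmetric polynomial of degree \<open>r\<close> in \<open>q\<^sup>c / (1 - q\<^sup>c)\<^sup>2\<close>, where \<open>c\<close> runs over the
  first \<open>K\<close> odd numbers.
\<close>
fun hom_gf :: "nat \<Rightarrow> nat \<Rightarrow> real fps" where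
  "hom_gf K 0 = 1"
| "hom_gf 0 (Suc r) = 0"
| "hom_gf (Suc K) (Suc r) = hom_gf K (Suc r) + fps_X ^ (2*K+1) * (geo_fps (2*K+1))\<^sup>2 * hom_gf (Suc K) r"

lemma odd_pairs_gf_Suc_mult:
  "(1 - fps_X ^ (2*K+1))\<^sup>2 * odd_pairs_gf (Suc K) = odd_pairs_gf K"
proof -
  have "(1 - fps_X ^ (2*K+1))\<^sup>2 * odd_pairs_gf (Suc K)
      = odd_pairs_gf K * (geo_fps (2*K+1) * (1 - fps_X ^ (2*K+1)))\<^sup>2"
    by (simp only: odd_pairs_gf.simps power_mult_distrib mult_ac)
  then show ?thesis by (subst (asm) geo_fps_mult) simp_all
qed

text \<open>
  Both sides satisfy the same recursion: dividing \<open>pair_gf_second_difference\<close> for \<open>c\<^bsub>r+1\<^esub>\<close> by \<open>(1 - q\<^sup>c)\<^sup>2\<close> gives that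
  of the complete homogeneous polynomials.
\<close>
lemma pair_gf_central_fact:
  "pair_gf K K (central_fact r) = odd_pairs_gf K * hom_gf K r"
proof (induction K arbitrary: r)
  case 0
  show ?case by (cases r) (simp_all add: pair_gf_0_0)
next
  case (Suc K)
  define Y :: "real fps" where "Y = fps_X ^ (2*K+1)"
  define I where "I = geo_fps (2*K+1)"
  have I: "I * (1 - Y) = 1" unfolding I_def Y_def by (rule geo_fps_mult) simp
  have canc: "Z = I\<^sup>2 * W" if "(1 - Y)\<^sup>2 * Z = W" for Z W
  proof -
    have "Z = (I * (1 - Y))\<^sup>2 * Z" using I by simp
    also have "\<dots> = I\<^sup>2 * ((1 - Y)\<^sup>2 * Z)" by (simp only: power_mult_distrib mult_ac)
    finally show ?thesis using that by simp
  qed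
  have rec: "(1 - Y)\<^sup>2 * pair_gf (Suc K) (Suc K) \<phi>
     = pair_gf K K \<phi> + Y * pair_gf (Suc K) (Suc K) (\<lambda>m. \<phi> (m + 1) - 2 * \<phi> m + \<phi> (m - 1))" for \<phi>
    unfolding Y_def by (rule pair_gf_second_difference)
  show ?case
  proof (induction r)
    case 0
    have "pair_gf (Suc K) (Suc K) (\<lambda>m. 0 * (1 :: real)) = 0"
      using pair_gf_cmult[of "Suc K" "Suc K" 0 "\<lambda>_. 1"] by simp
    then have "(1 - Y)\<^sup>2 * pair_gf (Suc K) (Suc K) (central_fact 0) = odd_pairs_gf K"
      using rec[of "central_fact 0"] Suc.IH[of 0] by simp
    from canc[OF this] show ?case
      by (simp only: I_def hom_gf.simps odd_pairs_gf.simps mult_1_right mult_1_left mult_ac)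
  next
    case (Suc r)
    have "(1 - Y)\<^sup>2 * pair_gf (Suc K) (Suc K) (central_fact (Suc r))
        = odd_pairs_gf K * hom_gf K (Suc r) + Y * (odd_pairs_gf (Suc K) * hom_gf (Suc K) r)"
      using rec[of "central_fact (Suc r)"] Suc.IH \<open>\<And>r. pair_gf K K (central_fact r) = _ r\<close>
      by (simp add: central_fact_second_difference del: odd_pairs_gf.simps hom_gf.simps)
    from canc[OF this] show ?case by (simp add: I_def Y_def algebra_simps)
  qed
qed

definition fps_nonneg :: "real fps \<Rightarrow> bool" where
  "fps_nonneg f \<longleftrightarrow> (\<forall>n. 0 \<le> f $ n)"

lemma fps_nonneg_simps [intro, simp]:
  "fps_nonneg 0" "fps_nonneg 1" "fps_nonneg fps_X" "fps_nonneg (fps_X ^ k)" "fps_nonneg (geo_fps c)"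
  by (simp_all add: fps_nonneg_def geo_fps_def)

lemma fps_nonneg_add [intro]: "fps_nonneg f \<Longrightarrow> fps_nonneg g \<Longrightarrow> fps_nonneg (f + g)"
  by (simp add: fps_nonneg_def)

lemma fps_nonneg_mult [intro]: "fps_nonneg f \<Longrightarrow> fps_nonneg g \<Longrightarrow> fps_nonneg (f * g)"
  by (simp add: fps_nonneg_def fps_mult_nth sum_nonneg)

lemma fps_nonneg_power2 [intro]: "fps_nonneg f \<Longrightarrow> fps_nonneg (f\<^sup>2)"
  by (simp add: power2_eq_square fps_nonneg_mult)

lemma fps_nonneg_sum [intro]: "(\<And>i. i \<in> S \<Longrightarrow> fps_nonneg (f i)) \<Longrightarrow> fps_nonneg (sum f S)"
  by (simp add: fps_nonneg_def fps_sum_nth sum_nonneg)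

lemma fps_nonneg_odd_pairs_gf [intro, simp]: "fps_nonneg (odd_pairs_gf K)"
  by (induction K) auto

lemma fps_nonneg_hom_gf [intro, simp]: "fps_nonneg (hom_gf K r)"
  by (induction K r rule: hom_gf.induct)
     (auto intro!: fps_nonneg_add fps_nonneg_mult fps_nonneg_power2)

lemma coeff_sum_X_power_cutoff:
  fixes F :: "nat \<Rightarrow> real fps"
  assumes "n \<le> N" "s > 0"
  shows "(\<Sum>k<N. fps_X ^ (s*(2*k+1)) * F k) $ n = (\<Sum>k<n. fps_X ^ (s*(2*k+1)) * F k) $ n"
proof -
  have "n < s * (2*k+1)" if "n \<le> k" for k
  proof -
    have "n < 2*k+1" using that by simp
    also have "\<dots> \<le> s * (2*k+1)" using mult_le_mono1[of 1 s "2*k+1"] assms by simp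
    finally show ?thesis .
  qed
  then show ?thesis unfolding fps_sum_nth
    using assms by (intro sum.mono_neutral_right) (auto simp: fps_X_power_mult_nth not_less)
qed

text \<open>
  The number of odd unimodal sequences of size \<open>n\<close>, each weighted by the \<open>r\<close>-th central factorial of its rank.
\<close>
definition peaked_coeff :: "nat \<Rightarrow> nat \<Rightarrow> real" where
  "peaked_coeff r n = (\<Sum>k<n. fps_X ^ (2*k+1) * (odd_pairs_gf (Suc k) * hom_gf (Suc k) r)) $ n"

lemma ou_moment_eq_peaked_coeff:
  "\<exists>T. T l = fact (2 * l) \<and> (\<forall>n. ou_moment (2 * l) n = (\<Sum>r\<le>l. T r * peaked_coeff r n))"
proof -
  obtain T where T: "T l = fact (2 * l)"
    "\<And>m. real_of_int m ^ (2 * l) = (\<Sum>k\<le>l. T k * central_fact k m)"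
    using even_power_eq_sum_central_fact[of l] by blast
  have "ou_moment (2 * l) n = (\<Sum>r\<le>l. T r * peaked_coeff r n)" for n
  proof -
    have "(\<Sum>k<n. fps_X ^ (2*k+1) * pair_gf (Suc k) (Suc k) (\<lambda>m. real_of_int m ^ (2 * l)))
        = (\<Sum>k<n. \<Sum>r\<le>l. fps_const (T r) * (fps_X ^ (2*k+1) * (odd_pairs_gf (Suc k) * hom_gf (Suc k) r)))"
      unfolding T(2)
      by (subst pair_gf_sum)
         (simp_all only: finite_atMost sum_distrib_left pair_gf_central_fact mult_ac)
    also have "\<dots> = (\<Sum>r\<le>l. fps_const (T r) * (\<Sum>k<n. fps_X ^ (2*k+1) * (odd_pairs_gf (Suc k) * hom_gf (Suc k) r)))"
      by (subst sum.swap) (simp only: sum_distrib_left)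
    finally show ?thesis
      unfolding ou_moment_eq_coeff peaked_coeff_def
      by (simp del: power_Suc odd_pairs_gf.simps hom_gf.simps add: fps_sum_nth)
  qed
  with T(1) show ?thesis by blast
qed

section \<open>Odd unimodal sequences and pairs of partitions\<close>

text \<open>
  The number of pairs of partitions into odd parts of total size \<open>n\<close>; parts larger than \<open>n\<close> cannot occur.
\<close>
definition pair_coeff :: "nat \<Rightarrow> real" where
  "pair_coeff n = odd_pairs_gf n $ n"

text \<open>
  Let \<open>U\<close>, \<open>V\<close>, \<open>W\<close> be the sums of \<open>q\<^sup>c G\<close>, \<open>q\<^bsup>2c\<^esup> G\<close>, \<open>q\<^bsup>3c\<^esup> G\<close> over the peaks \<open>c\<close>, where \<open>G\<close> counts the pairs of
  partitions into odd parts up to \<open>c\<close>. Telescoping \<open>G\<close> gives \<open>p = 2u - v\<close> for the coefficients, and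
  telescoping \<open>q\<^sup>c G\<close> gives \<open>u(n) - u(n-2) = 2v(n) - w(n)\<close>. As \<open>(1 - q\<^sup>c) G\<close> still has nonnegative coefficients,
  \<open>w \<le> v\<close>, so \<open>0 \<le> v(n) \<le> u(n) - u(n-2)\<close>.
\<close>
lemma peaked_coeff_0_bounds:
  assumes "n \<ge> 2"
  shows "pair_coeff n \<le> 2 * peaked_coeff 0 n"
    and "peaked_coeff 0 n + peaked_coeff 0 (n - 2) \<le> pair_coeff n"
proof -
  let ?Y = "\<lambda>k. fps_X ^ (2*k+1) :: real fps"
  let ?G = "\<lambda>k. odd_pairs_gf (Suc k)"
  define U where "U = (\<Sum>k<n. ?Y k * ?G k)"
  define V where "V = (\<Sum>k<n. (?Y k)\<^sup>2 * ?G k)"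
  define W where "W = (\<Sum>k<n. (?Y k)^3 * ?G k)"
  have rec: "odd_pairs_gf k = (1 - ?Y k)\<^sup>2 * ?G k" for k
    by (rule odd_pairs_gf_Suc_mult[symmetric])
  have Un: "U $ n = peaked_coeff 0 n"
    by (simp add: U_def peaked_coeff_def)
  have Un2: "U $ (n - 2) = peaked_coeff 0 (n - 2)"
    using coeff_sum_X_power_cutoff[of "n - 2" n 1 ?G]
    by (simp add: U_def peaked_coeff_def del: odd_pairs_gf.simps power_Suc)
  have Vpos: "0 \<le> V $ n"
  proof -
    have "fps_nonneg V" unfolding V_def by (intro fps_nonneg_sum fps_nonneg_mult fps_nonneg_power2) auto
    then show ?thesis by (simp add: fps_nonneg_def)
  qed
  have gen: "y\<^sup>2 * (g * i\<^sup>2) - y^3 * (g * i\<^sup>2) = y\<^sup>2 * (g * i) * (i * (1 - y))" for y g i :: "real fps"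
    by (simp add: algebra_simps power2_eq_square power3_eq_cube)
  have two: "(2 * f) $ i = 2 * f $ i" for f :: "real fps" and i
    by (simp only: mult_2 fps_add_nth)
  have VW: "W $ n \<le> V $ n"
  proof -
    have "V - W = (\<Sum>k<n. (?Y k)\<^sup>2 * (odd_pairs_gf k * geo_fps (2*k+1)))"
      unfolding V_def W_def sum_subtractf[symmetric]
    proof (rule sum.cong[OF refl])
      fix k
      have "(?Y k)\<^sup>2 * ?G k - (?Y k)^3 * ?G k
          = (?Y k)\<^sup>2 * (odd_pairs_gf k * geo_fps (2*k+1)) * (geo_fps (2*k+1) * (1 - ?Y k))"
        unfolding odd_pairs_gf.simps by (rule gen)
      also have "geo_fps (2*k+1) * (1 - ?Y k) = 1" by (rule geo_fps_mult) simp
      finally show "(?Y k)\<^sup>2 * ?G k - (?Y k)^3 * ?G k = (?Y k)\<^sup>2 * (odd_pairs_gf k * geo_fps (2*k+1))"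
        by simp
    qed
    also have "fps_nonneg \<dots>" by (intro fps_nonneg_sum fps_nonneg_mult fps_nonneg_power2) auto
    finally show ?thesis by (simp add: fps_nonneg_def)
  qed
  have "odd_pairs_gf n - 1 = (\<Sum>k<n. ?G k - odd_pairs_gf k)"
    by (subst sum_lessThan_telescope) simp
  also have "\<dots> = (\<Sum>k<n. 2 * (?Y k * ?G k) - (?Y k)\<^sup>2 * ?G k)"
  proof (rule sum.cong[OF refl])
    fix k
    show "?G k - odd_pairs_gf k = 2 * (?Y k * ?G k) - (?Y k)\<^sup>2 * ?G k"
      by (subst (2) rec) (simp only: algebra_simps power2_eq_square, simp)
  qed
  also have "\<dots> = 2 * U - V"
    by (simp only: U_def V_def sum_subtractf sum_distrib_left)
  finally have "(odd_pairs_gf n - 1) $ n = (2 * U - V) $ n" by simp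
  then have 1: "pair_coeff n = 2 * peaked_coeff 0 n - V $ n"
    using assms Un by (simp add: pair_coeff_def two del: odd_pairs_gf.simps)
  then show "pair_coeff n \<le> 2 * peaked_coeff 0 n" using Vpos by simp
  have "fps_X ^ (2*n+1) * odd_pairs_gf n - fps_X
      = (\<Sum>k<n. fps_X ^ (2 * Suc k + 1) * ?G k - ?Y k * odd_pairs_gf k)"
    by (subst sum_lessThan_telescope) simp
  also have "\<dots> = (\<Sum>k<n. fps_X\<^sup>2 * (?Y k * ?G k) - ?Y k * ?G k + 2 * ((?Y k)\<^sup>2 * ?G k) - (?Y k)^3 * ?G k)"
  proof (rule sum.cong[OF refl])
    fix k
    have X: "fps_X ^ (2 * Suc k + 1) = fps_X\<^sup>2 * ?Y k"
      by (simp add: power2_eq_square)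
    show "fps_X ^ (2 * Suc k + 1) * ?G k - ?Y k * odd_pairs_gf k
       = fps_X\<^sup>2 * (?Y k * ?G k) - ?Y k * ?G k + 2 * ((?Y k)\<^sup>2 * ?G k) - (?Y k)^3 * ?G k"
      by (subst (2) rec, subst X) (simp only: algebra_simps power2_eq_square power3_eq_cube, simp)
  qed
  also have "\<dots> = fps_X\<^sup>2 * U - U + 2 * V - W"
    by (simp only: U_def V_def W_def sum_subtractf sum.distrib sum_distrib_left)
  finally have "(fps_X ^ (2*n+1) * odd_pairs_gf n - fps_X) $ n = (fps_X\<^sup>2 * U - U + 2 * V - W) $ n" by simp
  then have "0 = U $ (n - 2) - U $ n + 2 * V $ n - W $ n"
    using assms by (simp add: fps_X_power_mult_nth two del: odd_pairs_gf.simps power_Suc)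
  then show "peaked_coeff 0 n + peaked_coeff 0 (n - 2) \<le> pair_coeff n"
    using 1 VW Un Un2 by simp
qed

section \<open>The logarithm of the product on the real axis\<close>

lemma alternating_inverse_squares_sums: "(\<lambda>k. (- 1) ^ k / (real k + 1)\<^sup>2) sums (pi\<^sup>2 / 12)"
proof -
  have a: "(\<lambda>k. 1 / (real k + 1)\<^sup>2) sums (pi\<^sup>2 / 6)"
    using inverse_squares_sums by (simp add: add.commute)
  \<comment> \<open>the terms that change sign: a quarter of the whole series\<close>
  define b where "b = (\<lambda>k. if odd k then 1 / (real k + 1)\<^sup>2 else 0)"
  have "(\<lambda>j. b (2 * j + 1)) sums (pi\<^sup>2 / 6 / 4)"
  proof -
    have "(\<lambda>j. b (2 * j + 1)) = (\<lambda>j. 1 / (real j + 1)\<^sup>2 / 4)"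
      by (auto simp: b_def power2_eq_square field_simps)
    then show ?thesis using sums_divide[OF a, of 4] by simp
  qed
  also have "(\<lambda>j. b (2 * j + 1)) sums (pi\<^sup>2 / 6 / 4) \<longleftrightarrow> b sums (pi\<^sup>2 / 6 / 4)"
  proof (rule sums_mono_reindex)
    fix j assume j: "j \<notin> range (\<lambda>j :: nat. 2 * j + 1)"
    have "j \<in> range (\<lambda>j. 2 * j + 1)" if "odd j" using that by (elim oddE) auto
    with j show "b j = 0" by (auto simp: b_def)
  qed (auto simp: strict_mono_def)
  finally have "(\<lambda>k. 1 / (real k + 1)\<^sup>2 - 2 * b k) sums (pi\<^sup>2 / 6 - 2 * (pi\<^sup>2 / 6 / 4))"
    by (intro sums_diff sums_mult a)
  also have "(\<lambda>k. 1 / (real k + 1)\<^sup>2 - 2 * b k) = (\<lambda>k. (- 1) ^ k / (real k + 1)\<^sup>2)"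
    by (auto simp: b_def)
  finally show ?thesis by simp
qed

text \<open>
  The function \<open>- Li\<^sub>2(-y)\<close>. Its derivative is \<open>ln (1 + y) / y\<close>, so \<open>- eta_dilog (exp (- x))\<close> is an antiderivative
  of \<open>ln (1 + exp (- x))\<close>; its value at \<open>y = 1\<close> supplies the \<open>\<pi>\<^sup>2\<close> of the exponent.
\<close>
definition eta_dilog :: "real \<Rightarrow> real" where
  "eta_dilog y = (\<Sum>k. (- 1) ^ k / (real k + 1)\<^sup>2 * y ^ Suc k)"

lemma eta_dilog_summable:
  assumes "0 \<le> y" "y \<le> 1"
  shows "summable (\<lambda>k. norm ((- 1) ^ k / (real k + 1)\<^sup>2 * y ^ Suc k))"
proof (rule summable_comparison_test')
  show "summable (\<lambda>k. 1 / (real k + 1)\<^sup>2)"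
    using inverse_squares_sums by (simp add: sums_iff add.commute)
  fix k :: nat
  have "y ^ Suc k \<le> 1" using assms by (intro power_le_one) auto
  then show "norm (norm ((- 1) ^ k / (real k + 1)\<^sup>2 * y ^ Suc k)) \<le> 1 / (real k + 1)\<^sup>2"
    using assms by (simp add: abs_mult divide_right_mono)
qed

lemma eta_dilog_1: "eta_dilog 1 = pi\<^sup>2 / 12"
  using alternating_inverse_squares_sums by (simp add: eta_dilog_def sums_iff)

lemma abs_eta_dilog_le:
  assumes "0 \<le> y" "y \<le> 1"
  shows "\<bar>eta_dilog y\<bar> \<le> pi\<^sup>2 / 6 * y"
proof -
  have s: "(\<lambda>k. 1 / (real k + 1)\<^sup>2 * y) sums (pi\<^sup>2 / 6 * y)"
    by (rule sums_mult2) (use inverse_squares_sums in \<open>simp add: add.commute\<close>)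
  have "\<bar>eta_dilog y\<bar> \<le> (\<Sum>k. norm ((- 1) ^ k / (real k + 1)\<^sup>2 * y ^ Suc k))"
    unfolding eta_dilog_def using summable_norm[OF eta_dilog_summable[OF assms]] by simp
  also have "\<dots> \<le> (\<Sum>k. 1 / (real k + 1)\<^sup>2 * y)"
  proof (rule suminf_le[OF _ eta_dilog_summable[OF assms] sums_summable[OF s]])
    fix k :: nat
    have "y ^ Suc k \<le> y" using assms power_decreasing[of 1 "Suc k" y] by simp
    then show "norm ((- 1) ^ k / (real k + 1)\<^sup>2 * y ^ Suc k) \<le> 1 / (real k + 1)\<^sup>2 * y"
      using assms by (simp add: abs_mult divide_right_mono)
  qed
  finally show ?thesis using s by (simp add: sums_iff)
qed

lemma continuous_on_eta_dilog: "continuous_on {0..1} eta_dilog"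
proof -
  have "uniform_limit {0..1} (\<lambda>n y. \<Sum>k<n. (- 1) ^ k / (real k + 1)\<^sup>2 * y ^ Suc k) eta_dilog sequentially"
    unfolding eta_dilog_def
  proof (rule Weierstrass_m_test)
    show "summable (\<lambda>k. 1 / (real k + 1)\<^sup>2)"
      using inverse_squares_sums by (simp add: sums_iff add.commute)
    fix k :: nat and y :: real assume "y \<in> {0..1}"
    then have "y ^ Suc k \<le> 1" "0 \<le> y" by (auto intro: power_le_one simp del: power_Suc)
    then show "norm ((- 1) ^ k / (real k + 1)\<^sup>2 * y ^ Suc k) \<le> 1 / (real k + 1)\<^sup>2"
      by (simp add: abs_mult divide_right_mono)
  qed
  then show ?thesis
    by (rule uniform_limit_theorem[rotated]) (auto intro!: always_eventually continuous_intros)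
qed

lemma eta_dilog_has_derivative:
  assumes "0 < y" "y < 1"
  shows "(eta_dilog has_real_derivative ln (1 + y) / y) (at y)"
proof -
  define c where "c = (\<lambda>n. if n = 0 then 0 else (- 1) ^ (n - 1) / (real n)\<^sup>2 :: real)"
  have eq: "eta_dilog x = (\<Sum>n. c n * x ^ n)" if "0 < x" "x < 1" for x
  proof -
    have *: "(\<lambda>n. c (Suc n) * x ^ Suc n) = (\<lambda>k. (- 1) ^ k / (real k + 1)\<^sup>2 * x ^ Suc k)"
      by (simp add: c_def add.commute)
    have "summable (\<lambda>n. c (Suc n) * x ^ Suc n)"
      unfolding * using that by (intro summable_norm_cancel[OF eta_dilog_summable]) auto
    then have "summable (\<lambda>n. c n * x ^ n)" by (subst (asm) summable_Suc_iff)
    from suminf_split_head[OF this] show ?thesis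
      unfolding * eta_dilog_def by (simp add: c_def)
  qed
  have summ: "summable (\<lambda>n. c n * x ^ n)" if "norm x < 1" for x
  proof (rule summable_comparison_test')
    show "summable (\<lambda>n. norm x ^ n)" using that by (intro summable_geometric) simp
    fix n :: nat
    have "\<bar>c n\<bar> \<le> 1" by (auto simp: c_def field_simps)
    then show "norm (c n * x ^ n) \<le> norm x ^ n"
      using mult_right_mono[of "\<bar>c n\<bar>" 1 "\<bar>x\<bar> ^ n"] by (simp add: abs_mult power_abs)
  qed
  have "((\<lambda>x. \<Sum>n. c n * x ^ n) has_real_derivative (\<Sum>n. diffs c n * y ^ n)) (at y)"
    by (rule termdiffs_strong'[where K = 1]) (use assms summ in auto)
  also have "(\<Sum>n. diffs c n * y ^ n) = ln (1 + y) / y"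
  proof -
    have d: "diffs c n * y ^ n = (- 1) ^ n * (1 / real (n + 1)) * y ^ Suc n / y" for n
    proof -
      have "diffs c n = (- 1) ^ n * (1 / real (n + 1))"
        by (simp add: diffs_def c_def power2_eq_square del: of_nat_Suc)
      then show ?thesis using assms by simp
    qed
    have "ln (1 + y) = (\<Sum>n. (- 1) ^ n * (1 / real (n + 1)) * ((1 + y) - 1) ^ Suc n)"
      by (rule ln_series) (use assms in auto)
    moreover have "summable (\<lambda>n. (- 1) ^ n * (1 / real (n + 1)) * y ^ Suc n)"
    proof (rule summable_comparison_test')
      show "summable (\<lambda>n. y ^ n)" using assms by (intro summable_geometric) simp
      fix n :: nat
      have "y ^ Suc n \<le> y ^ n * 1" using assms by (simp add: mult_left_le_one_le)
      moreover have "1 / real (n + 1) \<le> 1" by simp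
      ultimately have "1 / real (n + 1) * y ^ Suc n \<le> 1 * (y ^ n * 1)"
        using assms by (intro mult_mono) auto
      then show "norm ((- 1) ^ n * (1 / real (n + 1)) * y ^ Suc n) \<le> y ^ n"
        using assms by (simp add: abs_mult)
    qed
    ultimately show ?thesis unfolding d by (subst suminf_divide) simp_all
  qed
  finally show ?thesis
    by (rule has_field_derivative_transform_within_open[of _ _ _ "{0<..<1}"])
       (use assms eq in auto)
qed

text \<open>
  The error of the trapezoidal rule on one interval for the convex function \<open>f\<close>: as a function of the length
  \<open>u\<close> it has derivative \<open>u (f'(a + u) - f'(\<xi>)) / 2\<close> with \<open>a < \<xi> < a + u\<close>, and \<open>f'\<close> increases. The bound
  telescopes when the intervals are put together.
\<close>
lemma softplus_trapezoid:
  fixes a h :: real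
  assumes "0 \<le> a" "0 < h"
  defines "f \<equiv> \<lambda>x. ln (1 + exp (- x))" and "g \<equiv> \<lambda>x. - 1 / (1 + exp x)"
    and "G \<equiv> \<lambda>x. - eta_dilog (exp (- x))"
  shows "0 \<le> h * (f a + f (a + h)) / 2 - (G (a + h) - G a)"
    and "h * (f a + f (a + h)) / 2 - (G (a + h) - G a) \<le> h\<^sup>2 * (g (a + h) - g a) / 2"
proof -
  have f': "(f has_real_derivative g x) (at x)" for x
  proof -
    have "1 + exp (- x) > 0" by (simp add: add_pos_pos)
    then show ?thesis unfolding f_def g_def
      by (auto intro!: derivative_eq_intros simp: exp_minus field_simps)
  qed
  have G': "(G has_real_derivative f x) (at x)" if "x > 0" for x
  proof -
    have e: "0 < exp (- x)" "exp (- x) < 1" using that by auto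
    have "((\<lambda>x. eta_dilog (exp (- x))) has_real_derivative
        ln (1 + exp (- x)) / exp (- x) * (exp (- x) * (- 1))) (at x)"
      by (rule DERIV_chain2[where f = eta_dilog and g = "\<lambda>x. exp (- x)", OF eta_dilog_has_derivative[OF e]]) (auto intro!: derivative_eq_intros)
    from DERIV_minus[OF this] show ?thesis unfolding G_def f_def by simp
  qed
  have Gcont: "continuous_on {0..} G"
    unfolding G_def
    by (intro continuous_on_minus continuous_on_compose2[OF continuous_on_eta_dilog] continuous_intros) auto
  have gmono: "g x \<le> g y" if "x \<le> y" for x y
    using that by (simp add: g_def frac_le add_pos_pos)
  define T where "T = (\<lambda>u. u * (f a + f (a + u)) / 2 - (G (a + u) - G a))"
  have "\<exists>l z. 0 < z \<and> z < h \<and> DERIV T z :> l \<and> T h - T 0 = (h - 0) * l"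
  proof (rule MVT)
    have fc: "continuous_on {0..h} (\<lambda>u. f (a + u))"
      unfolding f_def by (intro continuous_intros) (simp add: add_pos_pos less_imp_neq[THEN not_sym])
    have Gc: "continuous_on {0..h} (\<lambda>u. G (a + u))"
      using assms by (intro continuous_on_compose2[OF Gcont] continuous_intros) auto
    show "continuous_on {0..h} T" unfolding T_def by (intro continuous_intros fc Gc) auto
    fix u assume u: "0 < u" "u < h"
    have "((\<lambda>u. f (a + u)) has_real_derivative g (a + u)) (at u)"
      using DERIV_shift[of f "g (a + u)" u a] f' by (simp add: add.commute)
    moreover have "((\<lambda>u. G (a + u)) has_real_derivative f (a + u)) (at u)"
      using DERIV_shift[of G "f (a + u)" u a] G'[of "a + u"] u assms by (simp add: add.commute)
    ultimately have "(T has_real_derivative (f a - f (a + u) + u * g (a + u)) / 2) (at u)"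
      unfolding T_def by (auto intro!: derivative_eq_intros simp: field_simps)
    then show "T differentiable (at u)" by (auto simp: real_differentiable_def)
  qed (use assms in auto)
  then obtain z l where z: "0 < z" "z < h" "DERIV T z :> l" "T h = h * l"
    by (auto simp: T_def)
  have l: "l = (f a - f (a + z) + z * g (a + z)) / 2"
  proof (rule DERIV_unique[OF z(3)])
    have "((\<lambda>u. f (a + u)) has_real_derivative g (a + z)) (at z)"
      using DERIV_shift[of f "g (a + z)" z a] f' by (simp add: add.commute)
    moreover have "((\<lambda>u. G (a + u)) has_real_derivative f (a + z)) (at z)"
      using DERIV_shift[of G "f (a + z)" z a] G'[of "a + z"] z assms by (simp add: add.commute)
    ultimately show "(T has_real_derivative (f a - f (a + z) + z * g (a + z)) / 2) (at z)"
      unfolding T_def by (auto intro!: derivative_eq_intros simp: field_simps)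
  qed
  obtain x where x: "a < x" "x < a + z" "f (a + z) - f a = (a + z - a) * g x"
    using MVT2[of a "a + z" f g] z f' by auto
  have l2: "l = z * (g (a + z) - g x) / 2" using l x(3) by (simp add: algebra_simps)
  have ge: "0 \<le> g (a + z) - g x" using gmono x by simp
  have le: "g (a + z) - g x \<le> g (a + h) - g a" using gmono[of a x] gmono[of "a + z" "a + h"] x z by simp
  have "0 \<le> l" unfolding l2 using ge z by simp
  then have "0 \<le> T h" using z assms by simp
  then show "0 \<le> h * (f a + f (a + h)) / 2 - (G (a + h) - G a)" by (simp add: T_def)
  have "z * (g (a + z) - g x) \<le> h * (g (a + h) - g a)"
    using z ge le by (intro mult_mono) auto
  then have "T h \<le> h * (h * (g (a + h) - g a) / 2)"
    unfolding z(4) l2 using assms by (intro mult_left_mono) auto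
  then show "h * (f a + f (a + h)) / 2 - (G (a + h) - G a) \<le> h\<^sup>2 * (g (a + h) - g a) / 2"
    by (simp add: T_def power2_eq_square)
qed

lemma sum_softplus_bounds:
  fixes t :: real and N :: nat
  assumes "0 < t"
  shows "\<bar>(\<Sum>m=1..N. ln (1 + exp (- (real m * t)))) - pi\<^sup>2 / (12 * t) + ln 2 / 2\<bar>
     \<le> t / 4 + exp (- (real N * t)) * (1 / 2 + pi\<^sup>2 / (6 * t))"
proof -
  define f where "f = (\<lambda>x::real. ln (1 + exp (- x)))"
  define g where "g = (\<lambda>x::real. - 1 / (1 + exp x))"
  define G where "G = (\<lambda>x. - eta_dilog (exp (- x)))"
  have "0 \<le> t * (f 0 / 2 + (\<Sum>m=1..N. f (real m * t)) - f (real N * t) / 2) - (G (real N * t) - G 0)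
    \<and> t * (f 0 / 2 + (\<Sum>m=1..N. f (real m * t)) - f (real N * t) / 2) - (G (real N * t) - G 0)
      \<le> t\<^sup>2 * (g (real N * t) - g 0) / 2"
  proof (induction N)
    case (Suc N)
    define x where "x = real N * t"
    define S where "S = (\<Sum>m=1..N. f (real m * t))"
    have x': "real (Suc N) * t = x + t" by (simp add: x_def algebra_simps)
    have S': "(\<Sum>m=1..Suc N. f (real m * t)) = S + f (x + t)" by (simp add: S_def flip: x')
    have "0 \<le> t * (f x + f (x + t)) / 2 - (G (x + t) - G x)"
      "t * (f x + f (x + t)) / 2 - (G (x + t) - G x) \<le> t\<^sup>2 * (g (x + t) - g x) / 2"
      unfolding f_def g_def G_def using assms by (intro softplus_trapezoid; simp add: x_def)+
    moreover have "0 \<le> t * (f 0 / 2 + S - f x / 2) - (G x - G 0)"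
      "t * (f 0 / 2 + S - f x / 2) - (G x - G 0) \<le> t\<^sup>2 * (g x - g 0) / 2"
      using Suc unfolding x_def S_def by auto
    ultimately show ?case unfolding x' S' by (simp add: field_simps)
  qed simp
  then obtain E where E: "0 \<le> E" "E \<le> t\<^sup>2 * (g (real N * t) - g 0) / 2"
    "t * (f 0 / 2 + (\<Sum>m=1..N. f (real m * t)) - f (real N * t) / 2) = G (real N * t) - G 0 + E"
    by (metis add.commute diff_add_cancel)
  have "g (real N * t) - g 0 \<le> 1 / 2" by (simp add: g_def)
  then have "t\<^sup>2 * (g (real N * t) - g 0) / 2 \<le> t\<^sup>2 * (1/2) / 2"
    by (intro divide_right_mono mult_left_mono) auto
  with E have E': "E \<le> t\<^sup>2 / 4" by simp
  have fN: "0 \<le> f (real N * t)" "f (real N * t) \<le> exp (- (real N * t))"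
    unfolding f_def by (auto intro: ln_add_one_self_le_self)
  have GN: "\<bar>G (real N * t)\<bar> \<le> pi\<^sup>2 / 6 * exp (- (real N * t))"
    unfolding G_def using abs_eta_dilog_le[of "exp (- (real N * t))"] assms by simp
  have G0: "G 0 = - (pi\<^sup>2 / 12)" by (simp add: G_def eta_dilog_1)
  have "(\<Sum>m=1..N. f (real m * t)) = (G (real N * t) - G 0 + E) / t - f 0 / 2 + f (real N * t) / 2"
    using E(3) assms by (simp add: field_simps)
  then have "(\<Sum>m=1..N. f (real m * t)) - pi\<^sup>2 / (12 * t) + ln 2 / 2
      = G (real N * t) / t + E / t + f (real N * t) / 2"
    using assms by (simp add: G0 f_def field_simps)
  moreover have "\<bar>G (real N * t) / t\<bar> \<le> pi\<^sup>2 / 6 * exp (- (real N * t)) / t"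
    using divide_right_mono[OF GN, of t] assms by (simp add: abs_divide)
  moreover have "0 \<le> E / t" "E / t \<le> t / 4"
    using E E' assms by (auto simp: field_simps power2_eq_square)
  ultimately have "\<bar>(\<Sum>m=1..N. f (real m * t)) - pi\<^sup>2 / (12 * t) + ln 2 / 2\<bar>
      \<le> pi\<^sup>2 / 6 * exp (- (real N * t)) / t + t / 4 + exp (- (real N * t)) / 2"
    using fN by linarith
  then show ?thesis by (simp add: f_def algebra_simps)
qed

text \<open>
  The truncation at \<open>m = n\<close> costs only \<open>exp (- n s) / s\<close>, which vanishes because \<open>n s\<close> is of order \<open>sqrt n\<close>.
\<close>
lemma sum_softplus_asymptotic:
  fixes s :: "nat \<Rightarrow> real"
  assumes pos: "\<forall>\<^sub>F n in sequentially. 0 < s n" and s0: "s \<longlonglongrightarrow> 0"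
    and a: "(\<lambda>n. sqrt (real n) * s n) \<longlonglongrightarrow> a" "a > 0"
  shows "(\<lambda>n. (\<Sum>m=1..n. ln (1 + exp (- (real m * s n)))) - pi\<^sup>2 / (12 * s n)) \<longlonglongrightarrow> - (ln 2 / 2)"
proof -
  let ?D = "\<lambda>n. (\<Sum>m=1..n. ln (1 + exp (- (real m * s n)))) - pi\<^sup>2 / (12 * s n)"
  define B where "B = (\<lambda>n. s n / 4 + (1 / (sqrt (real n) * (sqrt (real n) * s n)) + pi\<^sup>2 / 3 / (sqrt (real n) * (sqrt (real n) * s n)^3)))"
  have inv: "(\<lambda>n. 1 / sqrt (real n)) \<longlonglongrightarrow> 0" by real_asymp
  have 1: "(\<lambda>n. 1 / sqrt (real n) * (1 / (sqrt (real n) * s n))) \<longlonglongrightarrow> 0 * (1 / a)"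
    by (intro tendsto_mult tendsto_divide inv tendsto_const a(1)) (use a(2) in auto)
  have 2: "(\<lambda>n. pi\<^sup>2 / 3 * (1 / sqrt (real n)) * (1 / (sqrt (real n) * s n)^3)) \<longlonglongrightarrow> pi\<^sup>2 / 3 * 0 * (1 / a^3)"
    by (intro tendsto_mult tendsto_divide tendsto_power inv tendsto_const a(1)) (use a(2) in auto)
  have "B \<longlonglongrightarrow> 0 / 4 + (0 * (1 / a) + pi\<^sup>2 / 3 * 0 * (1 / a^3))"
    unfolding B_def using tendsto_add[OF tendsto_divide[OF s0 tendsto_const[of 4]] tendsto_add[OF 1 2]]
    by (simp add: mult.assoc)
  then have B0: "B \<longlonglongrightarrow> 0" by simp
  have "\<forall>\<^sub>F n in sequentially. \<bar>?D n + ln 2 / 2\<bar> \<le> B n"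
    using pos eventually_gt_at_top[of 0]
  proof eventually_elim
    case (elim n)
    define x where "x = real n * s n"
    have x: "x > 0" using elim by (simp add: x_def)
    have "1 + x + x\<^sup>2 / 2 \<le> exp x" using exp_lower_Taylor_quadratic[of x] x by simp
    then have "x \<le> exp x" "x\<^sup>2 / 2 \<le> exp x" using x zero_le_power2[of x] by linarith+
    then have e: "exp (- x) \<le> 1 / x" "exp (- x) \<le> 2 / x\<^sup>2"
      using x by (auto simp: exp_minus field_simps)
    have "exp (- x) * (1 / 2 + pi\<^sup>2 / (6 * s n)) = exp (- x) * (1 / 2) + exp (- x) * (pi\<^sup>2 / (6 * s n))"
      by (simp add: algebra_simps)
    also have "\<dots> \<le> 1 / x * 1 + 2 / x\<^sup>2 * (pi\<^sup>2 / (6 * s n))"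
      using elim x e by (intro add_mono mult_mono) auto
    also have "\<dots> = 1 / (sqrt (real n) * (sqrt (real n) * s n)) + pi\<^sup>2 / 3 / (sqrt (real n) * (sqrt (real n) * s n)^3)"
    proof -
      have sq: "sqrt (real n) * (sqrt (real n) * y) = real n * y" for y
        by (simp flip: mult.assoc)
      have "sqrt (real n) * (sqrt (real n) * s n)^3 = (real n)\<^sup>2 * s n ^ 3"
        using sq by (simp add: power3_eq_cube power2_eq_square mult.assoc mult.left_commute)
      then show ?thesis using elim unfolding x_def sq
        by (simp add: field_simps power2_eq_square power3_eq_cube)
    qed
    finally show ?case
      using sum_softplus_bounds[of "s n" n] elim unfolding B_def x_def by linarith
  qed
  then have "(\<lambda>n. ?D n + ln 2 / 2) \<longlonglongrightarrow> 0"
    by (intro Lim_null_comparison[OF _ B0]) simp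
  from tendsto_diff[OF this tendsto_const[of "ln 2 / 2"]] show ?thesis by simp
qed

section \<open>From the real axis to the imaginary axis\<close>

text \<open>
  A version of Curtiss' theorem on moment generating functions. With nonnegative weights the modulus at \<open>z\<close> is at
  most the sum of the values at \<open>R\<close> and \<open>- R\<close> whenever \<open>norm z \<le> R\<close>, so convergence on the real axis makes the family
  locally bounded. Montel's theorem gives locally uniform limits of subsequences, and each of them agrees with \<open>exp (A z\<^sup>2)\<close> on
  the real axis, hence everywhere.
\<close>
lemma positive_exponential_sum_limit:
  fixes w b :: "nat \<Rightarrow> nat \<Rightarrow> real" and d :: "nat \<Rightarrow> nat" and A :: real
  assumes w: "\<And>n k. 0 \<le> w n k"
    and lim: "\<And>x. (\<lambda>n. \<Sum>k\<le>d n. w n k * exp (b n k * x)) \<longlonglongrightarrow> exp (A * x\<^sup>2)"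
  shows "(\<lambda>n. \<Sum>k\<le>d n. complex_of_real (w n k) * exp (complex_of_real (b n k) * z))
     \<longlonglongrightarrow> exp (complex_of_real A * z\<^sup>2)"
proof (rule ccontr)
  define \<phi> where "\<phi> = (\<lambda>n z. \<Sum>k\<le>d n. complex_of_real (w n k) * exp (complex_of_real (b n k) * z))"
  define \<phi>r where "\<phi>r = (\<lambda>n x. \<Sum>k\<le>d n. w n k * exp (b n k * x))"
  let ?E = "\<lambda>z. exp (complex_of_real A * z\<^sup>2)"
  have real: "\<phi> n (of_real x) = of_real (\<phi>r n x)" for n x
    unfolding \<phi>_def \<phi>r_def of_real_sum of_real_mult exp_of_real[symmetric] by simp
  have holo: "\<phi> n holomorphic_on UNIV" for n
    unfolding \<phi>_def by (intro holomorphic_intros)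
  have bd: "norm (\<phi> n z) \<le> \<phi>r n R + \<phi>r n (- R)" if "norm z \<le> R" for n z R
  proof -
    have "\<bar>Re z\<bar> \<le> R" using that abs_Re_le_cmod order_trans by blast
    have "norm (\<phi> n z) \<le> (\<Sum>k\<le>d n. norm (complex_of_real (w n k) * exp (complex_of_real (b n k) * z)))"
      unfolding \<phi>_def by (rule norm_sum)
    also have "\<dots> = (\<Sum>k\<le>d n. w n k * exp (b n k * Re z))"
      by (simp add: norm_mult w)
    also have "\<dots> \<le> (\<Sum>k\<le>d n. w n k * exp (b n k * R) + w n k * exp (b n k * (- R)))"
    proof (rule sum_mono)
      fix k
      have "b n k * Re z \<le> b n k * R \<or> b n k * Re z \<le> b n k * (- R)"
      proof (cases "b n k \<ge> 0")
        case True
        then show ?thesis using \<open>\<bar>Re z\<bar> \<le> R\<close> by (intro disjI1 mult_left_mono) auto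
      next
        case False
        then show ?thesis using \<open>\<bar>Re z\<bar> \<le> R\<close> by (intro disjI2 mult_left_mono_neg) auto
      qed
      then have "exp (b n k * Re z) \<le> exp (b n k * R) + exp (b n k * (- R))"
        by (smt (verit) exp_le_cancel_iff exp_gt_zero)
      then show "w n k * exp (b n k * Re z) \<le> w n k * exp (b n k * R) + w n k * exp (b n k * (- R))"
        using w mult_left_mono[of _ _ "w n k"] by (simp flip: distrib_left)
    qed
    also have "\<dots> = \<phi>r n R + \<phi>r n (- R)" by (simp add: \<phi>r_def sum.distrib)
    finally show ?thesis .
  qed
  assume "\<not> (\<lambda>n. \<Sum>k\<le>d n. complex_of_real (w n k) * exp (complex_of_real (b n k) * z)) \<longlonglongrightarrow> ?E z"
  then obtain e where e: "e > 0" "\<not> (\<forall>\<^sub>F n in sequentially. dist (\<phi> n z) (?E z) < e)"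
    unfolding \<phi>_def tendsto_iff by blast
  then obtain r :: "nat \<Rightarrow> nat" where r: "strict_mono r" "\<And>n. \<not> dist (\<phi> (r n) z) (?E z) < e"
    using not_eventually_sequentiallyD by blast
  have "\<exists>B. \<forall>h\<in>range (\<lambda>n. \<phi> (r n)). \<forall>z\<in>K. norm (h z) \<le> B" if K: "compact K" for K
  proof -
    obtain R where R: "\<forall>z\<in>K. norm z \<le> R" using compact_imp_bounded[OF K] by (auto simp: bounded_iff)
    have "convergent (\<lambda>n. \<phi>r n R + \<phi>r n (- R))"
      using tendsto_add[OF lim[of R] lim[of "- R"]] unfolding convergent_def \<phi>r_def by blast
    then have "Bseq (\<lambda>n. \<phi>r n R + \<phi>r n (- R))" by (rule convergent_imp_Bseq)
    then obtain B where B: "\<And>n. norm (\<phi>r n R + \<phi>r n (- R)) \<le> B" by (auto simp: Bseq_def)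
    have "norm (\<phi> (r n) z) \<le> B" if "z \<in> K" for n z
      using bd[of z R "r n"] B[of "r n"] R that by fastforce
    then show ?thesis by blast
  qed
  then have bdd: "\<exists>B. \<forall>h\<in>range (\<lambda>n. \<phi> (r n)). \<forall>z\<in>K. norm (h z) \<le> B"
    if "compact K" "K \<subseteq> UNIV" for K using that by blast
  obtain g q where g: "g holomorphic_on UNIV" "strict_mono (q :: nat \<Rightarrow> nat)"
    "\<And>z. z \<in> UNIV \<Longrightarrow> (\<lambda>n. \<phi> (r (q n)) z) \<longlonglongrightarrow> g z"
  proof (rule Montel[of UNIV "range (\<lambda>n. \<phi> (r n))" "\<lambda>n. \<phi> (r n)", OF open_UNIV _ bdd])
    show "h holomorphic_on UNIV" if "h \<in> range (\<lambda>n. \<phi> (r n))" for h using that holo by auto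
  qed blast+
  have "g (of_real x) = ?E (of_real x)" for x
  proof (rule LIMSEQ_unique[OF g(3)])
    have "(\<lambda>n. \<phi>r (r (q n)) x) \<longlonglongrightarrow> exp (A * x\<^sup>2)"
      using LIMSEQ_subseq_LIMSEQ[OF lim[of x, folded \<phi>r_def] strict_mono_o[OF r(1) g(2)]]
      by (simp add: o_def \<phi>r_def)
    then have "(\<lambda>n. complex_of_real (\<phi>r (r (q n)) x)) \<longlonglongrightarrow> of_real (exp (A * x\<^sup>2))"
      by (rule tendsto_of_real)
    then show "(\<lambda>n. \<phi> (r (q n)) (of_real x)) \<longlonglongrightarrow> ?E (of_real x)"
      by (simp add: real exp_of_real flip: of_real_mult of_real_power)
  qed simp
  then have 0: "g w - ?E w = 0" if "w \<in> range complex_of_real" for w using that by auto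
  have isl: "0 islimpt range complex_of_real"
  proof (rule islimptI)
    fix T :: "complex set" assume "0 \<in> T" "open T"
    then obtain \<epsilon> where "\<epsilon> > 0" "ball 0 \<epsilon> \<subseteq> T" by (meson openE)
    then have "complex_of_real (\<epsilon> / 2) \<in> T" by (auto simp: subset_eq)
    then show "\<exists>y\<in>range complex_of_real. y \<in> T \<and> y \<noteq> 0" using \<open>\<epsilon> > 0\<close>
      by (intro bexI[OF _ rangeI[of complex_of_real "\<epsilon> / 2"]]) auto
  qed
  have "g z - ?E z = 0"
    by (rule analytic_continuation[of "\<lambda>w. g w - ?E w" UNIV "range complex_of_real" 0])
       (use g(1) 0 isl in \<open>auto intro!: holomorphic_intros\<close>)
  then have "(\<lambda>n. \<phi> (r (q n)) z) \<longlonglongrightarrow> ?E z" using g(3)[of z] by simp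
  then have "\<forall>\<^sub>F n in sequentially. dist (\<phi> (r (q n)) z) (?E z) < e" using e(1) by (rule tendstoD)
  then show False using r(2) by simp
qed

text \<open>
  From \<open>1 - cos \<theta> = 2 (sin (\<theta>/2))\<^sup>2\<close>, where the sine is bounded below by one more halving of the angle: up to
  \<open>\<pi>/4\<close> the cosine is at least \<open>1/2\<close>.
\<close>
lemma one_minus_cos_lower:
  fixes \<theta> :: real
  assumes "\<bar>\<theta>\<bar> \<le> pi"
  shows "\<theta>\<^sup>2 / 32 \<le> 1 - cos \<theta>"
proof -
  define x where "x = \<bar>\<theta>\<bar> / 2"
  define y where "y = x / 2"
  have y: "0 \<le> y" "y \<le> pi / 4" using assms by (auto simp: x_def y_def)
  have c: "1 / 2 \<le> cos u" if "0 \<le> u" "u \<le> y" for u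
    using cos_monotone_0_pi_le[of u "pi / 3"] that y by (simp add: cos_60)
  have "y / 2 \<le> sin y"
  proof (cases "y = 0")
    case False
    then obtain u where u: "0 < u" "u < y" "sin y - sin 0 = (y - 0) * cos u"
      using MVT2[of 0 y sin cos] y by (auto intro: DERIV_sin)
    then show ?thesis using mult_left_mono[OF c[of u], of y] y by simp
  qed simp
  then have "y / 2 * (1 / 2) \<le> sin y * cos y"
    using c[of y] y by (intro mult_mono) auto
  then have s: "x / 4 \<le> sin x"
    using sin_double[of y] by (simp add: y_def)
  have "(x / 4)\<^sup>2 \<le> (sin x)\<^sup>2" using s by (intro power_mono) (auto simp: x_def)
  moreover have "cos \<theta> = 1 - 2 * (sin x)\<^sup>2"
    using cos_double_sin[of x] by (simp add: x_def)
  moreover have "(x / 4)\<^sup>2 = \<theta>\<^sup>2 / 64" by (simp add: x_def power_divide)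
  ultimately show ?thesis by linarith
qed

lemma norm_one_plus_ratio:
  fixes \<rho> \<theta> :: real
  assumes "0 \<le> \<rho>" "\<rho> \<le> 1"
  shows "(norm (1 + of_real \<rho> * cis \<theta>))\<^sup>2 / (1 + \<rho>)\<^sup>2 \<le> exp (- (\<rho> * (1 - cos \<theta>) / 2))"
proof -
  have "(norm (1 + of_real \<rho> * cis \<theta>))\<^sup>2 = (1 + \<rho> * cos \<theta>)\<^sup>2 + (\<rho> * sin \<theta>)\<^sup>2"
    by (simp add: cmod_power2)
  also have "\<dots> = 1 + 2 * \<rho> * cos \<theta> + \<rho>\<^sup>2 * ((sin \<theta>)\<^sup>2 + (cos \<theta>)\<^sup>2)"
    by (simp only: power2_eq_square algebra_simps)
  also have "\<dots> = (1 + \<rho>)\<^sup>2 - 2 * \<rho> * (1 - cos \<theta>)"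
    by (simp add: power2_eq_square algebra_simps)
  finally have eq: "(norm (1 + of_real \<rho> * cis \<theta>))\<^sup>2 / (1 + \<rho>)\<^sup>2 = 1 - 2 * \<rho> * (1 - cos \<theta>) / (1 + \<rho>)\<^sup>2"
    using assms by (simp add: diff_divide_distrib)
  have "(1 + \<rho>)\<^sup>2 \<le> 2\<^sup>2" using assms by (intro power_mono) auto
  then have "2 * \<rho> * (1 - cos \<theta>) / 4 \<le> 2 * \<rho> * (1 - cos \<theta>) / (1 + \<rho>)\<^sup>2"
    using assms by (intro divide_left_mono mult_nonneg_nonneg mult_pos_pos) (auto simp: add_pos_nonneg)
  then have "1 - 2 * \<rho> * (1 - cos \<theta>) / (1 + \<rho>)\<^sup>2 \<le> 1 + - (\<rho> * (1 - cos \<theta>) / 2)" by simp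
  also have "\<dots> \<le> exp (- (\<rho> * (1 - cos \<theta>) / 2))" by (rule exp_ge_add_one_self)
  finally show ?thesis unfolding eq .
qed

text \<open>
  The full geometric series gives \<open>1/(1 - \<rho>) - Re (1/(1 - q))\<close> with \<open>q = \<rho> e\<^bsup>i\<theta>\<^esup>\<close>, which is the first term; the second
  one bounds the two tails.
\<close>
lemma sum_power_one_minus_cos_lower:
  fixes \<rho> \<theta> :: real
  assumes "0 < \<rho>" "\<rho> < 1"
  shows "\<rho> * (1 + \<rho>) * (1 - cos \<theta>) / ((1 - \<rho>) * ((1 - \<rho>)\<^sup>2 + 2 * \<rho> * (1 - cos \<theta>))) - 2 * \<rho> ^ N / (1 - \<rho>)
     \<le> (\<Sum>m<N. \<rho> ^ m * (1 - cos (real m * \<theta>)))"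
proof -
  define q where "q = complex_of_real \<rho> * cis \<theta>"
  define v where "v = 1 - cos \<theta>"
  have v: "v \<ge> 0" by (simp add: v_def)
  have nq: "norm q = \<rho>" using assms by (simp add: q_def norm_mult)
  then have q1: "q \<noteq> 1" using assms by auto
  have "q ^ m = of_real (\<rho> ^ m) * cis (real m * \<theta>)" for m
    by (simp add: q_def power_mult_distrib Complex.DeMoivre)
  then have "(\<Sum>m<N. \<rho> ^ m * (1 - cos (real m * \<theta>))) = (\<Sum>m<N. \<rho> ^ m) - Re (\<Sum>m<N. q ^ m)"
    by (simp add: sum_subtractf algebra_simps)
  also have "(\<Sum>m<N. \<rho> ^ m) = 1 / (1 - \<rho>) - \<rho> ^ N / (1 - \<rho>)"
    using assms by (simp add: sum_gp_strict diff_divide_distrib)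
  also have "(\<Sum>m<N. q ^ m) = 1 / (1 - q) - q ^ N / (1 - q)"
    using q1 by (simp add: sum_gp_strict diff_divide_distrib)
  finally have S: "(\<Sum>m<N. \<rho> ^ m * (1 - cos (real m * \<theta>)))
      = 1 / (1 - \<rho>) - \<rho> ^ N / (1 - \<rho>) - Re (1 / (1 - q)) + Re (q ^ N / (1 - q))" by simp
  have "\<bar>Re (q ^ N / (1 - q))\<bar> \<le> norm (q ^ N / (1 - q))" by (rule abs_Re_le_cmod)
  also have "\<dots> = \<rho> ^ N / norm (1 - q)" by (simp add: norm_divide norm_power nq)
  also have "\<dots> \<le> \<rho> ^ N / (1 - \<rho>)"
  proof (rule divide_left_mono)
    show "1 - \<rho> \<le> norm (1 - q)" using norm_triangle_ineq2[of 1 q] nq by simp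
  qed (use assms q1 in auto)
  finally have R: "- (\<rho> ^ N / (1 - \<rho>)) \<le> Re (q ^ N / (1 - q))" by linarith
  have den: "(Re (1 - q))\<^sup>2 + (Im (1 - q))\<^sup>2 = (1 - \<rho>)\<^sup>2 + 2 * \<rho> * v"
  proof -
    have "(Re (1 - q))\<^sup>2 + (Im (1 - q))\<^sup>2 = (1 - \<rho> * cos \<theta>)\<^sup>2 + (\<rho> * sin \<theta>)\<^sup>2"
      by (simp add: q_def)
    also have "\<dots> = 1 - 2 * \<rho> * cos \<theta> + \<rho>\<^sup>2 * ((sin \<theta>)\<^sup>2 + (cos \<theta>)\<^sup>2)"
      by (simp only: power2_eq_square algebra_simps)
    finally show ?thesis by (simp add: v_def power2_eq_square algebra_simps)
  qed
  have dpos: "(1 - \<rho>)\<^sup>2 + 2 * \<rho> * v > 0" using assms v by (intro add_pos_nonneg) auto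
  have "Re (1 / (1 - q)) = (1 - \<rho> + \<rho> * v) / ((1 - \<rho>)\<^sup>2 + 2 * \<rho> * v)"
    by (simp only: Re_divide den) (simp add: q_def v_def algebra_simps)
  moreover have "1 / (1 - \<rho>) - (1 - \<rho> + \<rho> * v) / ((1 - \<rho>)\<^sup>2 + 2 * \<rho> * v)
      = (1 * ((1 - \<rho>)\<^sup>2 + 2 * \<rho> * v) - (1 - \<rho> + \<rho> * v) * (1 - \<rho>))
        / ((1 - \<rho>) * ((1 - \<rho>)\<^sup>2 + 2 * \<rho> * v))"
    by (rule diff_frac_eq) (use dpos assms in auto)
  ultimately have "1 / (1 - \<rho>) - Re (1 / (1 - q))
      = (((1 - \<rho>)\<^sup>2 + 2 * \<rho> * v) - (1 - \<rho> + \<rho> * v) * (1 - \<rho>))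
        / ((1 - \<rho>) * ((1 - \<rho>)\<^sup>2 + 2 * \<rho> * v))"
    by (simp only: mult_1)
  also have "((1 - \<rho>)\<^sup>2 + 2 * \<rho> * v) - (1 - \<rho> + \<rho> * v) * (1 - \<rho>) = \<rho> * (1 + \<rho>) * v"
    by (simp add: power2_eq_square algebra_simps)
  finally have "1 / (1 - \<rho>) - Re (1 / (1 - q))
      = \<rho> * (1 + \<rho>) * v / ((1 - \<rho>) * ((1 - \<rho>)\<^sup>2 + 2 * \<rho> * v))" .
  then show ?thesis using S R unfolding v_def by linarith
qed

section \<open>The saddle point\<close>

definition distinct_gf :: "nat \<Rightarrow> real fps" where
  "distinct_gf n = (\<Prod>m=1..n. 1 + fps_X ^ m)\<^sup>2"

text \<open>
  The product is a polynomial with nonnegative coefficients. Evaluating it at complex arguments through its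
  coefficients is what connects the coefficient of \<open>q\<^sup>n\<close> to integrals over a circle.
\<close>
lemma distinct_gf_nonneg_poly:
  "(\<forall>k. 0 \<le> distinct_gf n $ k) \<and>
   (\<exists>p :: complex poly. (\<forall>k. coeff p k = of_real (distinct_gf n $ k)) \<and>
      (\<forall>q. poly p q = (\<Prod>m=1..n. 1 + q ^ m)\<^sup>2))"
proof -
  define R :: "real fps \<Rightarrow> (complex \<Rightarrow> complex) \<Rightarrow> bool" where
    "R = (\<lambda>f F. (\<forall>k. 0 \<le> f $ k) \<and> (\<exists>p. (\<forall>k. coeff p k = of_real (f $ k)) \<and> (\<forall>q. poly p q = F q)))"
  have mult: "R (f * g) (\<lambda>q. F q * G q)" if "R f F" "R g G" for f g F G
  proof -
    from that obtain p r where "\<forall>k. 0 \<le> f $ k" "\<forall>k. 0 \<le> g $ k"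
      "\<forall>k. coeff p k = of_real (f $ k)" "\<forall>q. poly p q = F q"
      "\<forall>k. coeff r k = of_real (g $ k)" "\<forall>q. poly r q = G q" by (auto simp: R_def)
    then show ?thesis unfolding R_def
      by (intro conjI allI exI[of _ "p * r"])
         (auto simp: fps_mult_nth coeff_mult atLeast0AtMost intro!: sum_nonneg)
  qed
  have base: "R (1 + fps_X ^ m) (\<lambda>q. 1 + q ^ m)" for m
    unfolding R_def
    by (intro conjI allI exI[of _ "1 + monom 1 m"]) (auto simp: poly_monom)
  have "R (\<Prod>m=1..n. 1 + fps_X ^ m) (\<lambda>q. \<Prod>m=1..n. 1 + q ^ m)"
  proof (induction n)
    case 0
    show ?case unfolding R_def by (auto intro!: exI[of _ 1])
  next
    case (Suc n)
    from mult[OF this base[of "Suc n"]] show ?case by (simp del: power_Suc)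
  qed
  from mult[OF this this] show ?thesis
    unfolding R_def distinct_gf_def power2_eq_square .
qed

text \<open>
  The logarithm of \<open>\<Prod>(1 + e\<^bsup>-mt\<^esup>)\<^sup>2\<close> is about \<open>A/t\<close> with \<open>A = \<pi>\<^sup>2/6\<close>, so \<open>A/t + n t\<close> is stationary at \<open>t = \<pi>/\<surd>(6n)\<close>.
\<close>
definition saddle :: "nat \<Rightarrow> real" where
  "saddle n = pi / sqrt (6 * real n)"

text \<open>
  At the saddle point the second derivative of \<open>A/t + n t\<close> is \<open>2A/t\<^sup>3\<close>; so \<open>t\<^bsup>3/2\<^esup>\<close> is the scale on which the integrand
  is Gaussian.
\<close>
definition saddle_width :: "nat \<Rightarrow> real" where
  "saddle_width n = saddle n * sqrt (saddle n)"

lemma saddle_pos: "n > 0 \<Longrightarrow> saddle n > 0"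
  by (simp add: saddle_def)

lemma eventually_saddle_pos: "\<forall>\<^sub>F n in sequentially. saddle n > 0"
  using eventually_gt_at_top[of 0] by eventually_elim (rule saddle_pos)

lemma saddle_width_pos: "n > 0 \<Longrightarrow> saddle_width n > 0"
  by (simp add: saddle_width_def saddle_pos)

lemma saddle_eq: "n > 0 \<Longrightarrow> real n = pi\<^sup>2 / 6 / (saddle n)\<^sup>2"
  by (simp add: saddle_def power_divide)

lemma tendsto_saddle: "saddle \<longlonglongrightarrow> 0"
  unfolding saddle_def by real_asymp

lemma sqrt_mult_saddle: "(\<lambda>n. sqrt (real n) * saddle n) \<longlonglongrightarrow> pi / sqrt 6"
proof (rule Lim_transform_eventually[OF tendsto_const])
  show "\<forall>\<^sub>F n in sequentially. pi / sqrt 6 = sqrt (real n) * saddle n"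
    using eventually_gt_at_top[of 0] by eventually_elim (simp add: saddle_def real_sqrt_mult)
qed

definition tilted_norm :: "nat \<Rightarrow> real" where
  "tilted_norm n = (\<Prod>m=1..n. 1 + exp (- saddle n) ^ m)\<^sup>2"

text \<open>
  \<open>Q(t + \<kappa>z) e\<^bsup>n\<kappa>z\<^esup> / Q(t)\<close> for \<open>Q(s) = \<Prod>(1 + e\<^bsup>-ms\<^esup>)\<^sup>2\<close>, where \<open>t\<close> is the saddle point and \<open>\<kappa>\<close> its width. On the
  imaginary axis this is the characteristic function of a centred and rescaled sum of independent variables.
\<close>
definition tilted_cf :: "nat \<Rightarrow> complex \<Rightarrow> complex" where
  "tilted_cf n z = (\<Prod>m=1..n. 1 + exp (- (of_real (saddle n) + of_real (saddle_width n) * z)) ^ m)\<^sup>2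
     * exp (of_real (real n * saddle_width n) * z) / of_real (tilted_norm n)"

lemma tilted_norm_pos: "tilted_norm n > 0"
  unfolding tilted_norm_def
  by (intro zero_less_power prod_pos) (simp add: add_pos_nonneg)

lemma prod_one_plus_exp:
  "(\<Prod>m=1..n. 1 + exp (- s :: real) ^ m) = exp (\<Sum>m=1..n. ln (1 + exp (- (real m * s))))"
proof -
  have "exp (ln (1 + exp (- (real m * s)))) = 1 + exp (- s) ^ m" for m
    by (subst exp_ln) (simp_all add: add_pos_pos flip: exp_of_nat_mult)
  then show ?thesis by (simp add: exp_sum)
qed

text \<open>
  With \<open>Q(s)\<close> about \<open>e\<^bsup>A/s\<^esup>/2\<close>, the factors \<open>1/2\<close> cancel. Put \<open>t\<close> for the saddle point and \<open>\<epsilon> = \<surd>t\<close>. As \<open>n = A/t\<^sup>2\<close>, the exponent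
  \<open>A/(t + t\<epsilon>x) - A/t + n t\<epsilon>x\<close> equals \<open>A x\<^sup>2 / (1 + \<epsilon>x)\<close>.
\<close>
lemma tilted_real_limit:
  "(\<lambda>n. (\<Prod>m=1..n. 1 + exp (- (saddle n + saddle_width n * x)) ^ m)\<^sup>2
     * exp (real n * saddle_width n * x) / tilted_norm n) \<longlonglongrightarrow> exp (pi\<^sup>2 / 6 * x\<^sup>2)"
proof -
  define S where "S = (\<lambda>n s. \<Sum>m=1..n. ln (1 + exp (- (real m * s))))"
  define s where "s = (\<lambda>n. saddle n + saddle_width n * x)"
  have s_eq: "s n = saddle n * (1 + x * sqrt (saddle n))" for n
    by (simp add: s_def saddle_width_def algebra_simps)
  have sq0: "(\<lambda>n. sqrt (saddle n)) \<longlonglongrightarrow> 0"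
    using tendsto_real_sqrt[OF tendsto_saddle] by simp
  then have fac: "(\<lambda>n. 1 + x * sqrt (saddle n)) \<longlonglongrightarrow> 1 + x * 0"
    by (intro tendsto_intros)
  then have facpos: "\<forall>\<^sub>F n in sequentially. 1 + x * sqrt (saddle n) > 0"
    by (rule order_tendstoD) simp
  have spos: "\<forall>\<^sub>F n in sequentially. s n > 0"
    using facpos eventually_gt_at_top[of 0]
    by eventually_elim (simp add: s_eq saddle_pos)
  have s0: "s \<longlonglongrightarrow> 0"
    using tendsto_mult[OF tendsto_saddle fac] by (simp add: s_eq[abs_def])
  have sqs: "(\<lambda>n. sqrt (real n) * saddle n) \<longlonglongrightarrow> pi / sqrt 6"
    by (rule sqrt_mult_saddle)
  have sqs': "(\<lambda>n. sqrt (real n) * s n) \<longlonglongrightarrow> pi / sqrt 6"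
    using tendsto_mult[OF sqs fac] by (simp add: s_eq mult.assoc)
  have L1: "(\<lambda>n. S n (s n) - pi\<^sup>2 / (12 * s n)) \<longlonglongrightarrow> - (ln 2 / 2)"
    unfolding S_def by (rule sum_softplus_asymptotic[OF spos s0 sqs']) simp
  have L2: "(\<lambda>n. S n (saddle n) - pi\<^sup>2 / (12 * saddle n)) \<longlonglongrightarrow> - (ln 2 / 2)"
    unfolding S_def
    by (rule sum_softplus_asymptotic[OF eventually_saddle_pos tendsto_saddle sqs]) simp
  have L3: "(\<lambda>n. pi\<^sup>2 / 6 * x\<^sup>2 / (1 + x * sqrt (saddle n))) \<longlonglongrightarrow> pi\<^sup>2 / 6 * x\<^sup>2 / (1 + x * 0)"
    by (intro tendsto_divide fac tendsto_const) simp
  have "(\<lambda>n. 2 * (S n (s n) - pi\<^sup>2 / (12 * s n)) - 2 * (S n (saddle n) - pi\<^sup>2 / (12 * saddle n))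
      + pi\<^sup>2 / 6 * x\<^sup>2 / (1 + x * sqrt (saddle n)))
    \<longlonglongrightarrow> 2 * (- (ln 2 / 2)) - 2 * (- (ln 2 / 2)) + pi\<^sup>2 / 6 * x\<^sup>2 / (1 + x * 0)"
    by (intro tendsto_add tendsto_diff tendsto_mult tendsto_const L1 L2 L3)
  then have "(\<lambda>n. exp (2 * (S n (s n) - pi\<^sup>2 / (12 * s n)) - 2 * (S n (saddle n) - pi\<^sup>2 / (12 * saddle n))
      + pi\<^sup>2 / 6 * x\<^sup>2 / (1 + x * sqrt (saddle n)))) \<longlonglongrightarrow> exp (pi\<^sup>2 / 6 * x\<^sup>2)"
    by (intro tendsto_exp) simp
  then show ?thesis
  proof (rule Lim_transform_eventually)
    show "\<forall>\<^sub>F n in sequentially. exp (2 * (S n (s n) - pi\<^sup>2 / (12 * s n)) - 2 * (S n (saddle n) - pi\<^sup>2 / (12 * saddle n))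
      + pi\<^sup>2 / 6 * x\<^sup>2 / (1 + x * sqrt (saddle n)))
      = (\<Prod>m=1..n. 1 + exp (- (saddle n + saddle_width n * x)) ^ m)\<^sup>2
         * exp (real n * saddle_width n * x) / tilted_norm n"
      using facpos eventually_gt_at_top[of 0]
    proof eventually_elim
      case (elim n)
      define t where "t = saddle n"
      define \<epsilon> where "\<epsilon> = sqrt t"
      have t: "t > 0" "\<epsilon> > 0" "\<epsilon>\<^sup>2 = t" using elim by (simp_all add: t_def \<epsilon>_def saddle_pos less_imp_le)
      have e: "1 + x * \<epsilon> > 0" using elim by (simp add: \<epsilon>_def t_def)
      have n: "real n = pi\<^sup>2 / 6 / t\<^sup>2" using saddle_eq elim by (simp add: t_def)
      have half: "2 * (pi\<^sup>2 / (12 * z)) = pi\<^sup>2 / 6 * (1 / z)" for z by simp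
      have "1 / (t * (1 + x * \<epsilon>)) - 1 / t + t * \<epsilon> * x / t\<^sup>2 = x\<^sup>2 / (1 + x * \<epsilon>)"
      proof -
      have "1 / (t * (1 + x * \<epsilon>)) - 1 / t + t * \<epsilon> * x / t\<^sup>2
            = (1 - (1 + x * \<epsilon>) + \<epsilon> * x * (1 + x * \<epsilon>)) / (t * (1 + x * \<epsilon>))"
          using t(1) e by (simp add: divide_simps power2_eq_square)
        also have "1 - (1 + x * \<epsilon>) + \<epsilon> * x * (1 + x * \<epsilon>) = t * x\<^sup>2"
          by (simp add: algebra_simps power2_eq_square flip: t(3))
        finally show ?thesis using t(1) by simp
      qed
      then have "pi\<^sup>2 / 6 * (1 / (t * (1 + x * \<epsilon>)) - 1 / t + t * \<epsilon> * x / t\<^sup>2) = pi\<^sup>2 / 6 * (x\<^sup>2 / (1 + x * \<epsilon>))"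
        by simp
      then have "pi\<^sup>2 / 6 * x\<^sup>2 / (1 + x * \<epsilon>)
          = 2 * (pi\<^sup>2 / (12 * (t * (1 + x * \<epsilon>)))) - 2 * (pi\<^sup>2 / (12 * t)) + pi\<^sup>2 / 6 / t\<^sup>2 * (t * \<epsilon>) * x"
        unfolding half by (simp add: algebra_simps)
      then have key: "pi\<^sup>2 / 6 * x\<^sup>2 / (1 + x * sqrt (saddle n))
          = 2 * (pi\<^sup>2 / (12 * s n)) - 2 * (pi\<^sup>2 / (12 * saddle n)) + real n * saddle_width n * x"
        unfolding s_eq saddle_width_def n by (simp add: t_def \<epsilon>_def)
      have "2 * (S n (s n) - pi\<^sup>2 / (12 * s n)) - 2 * (S n (saddle n) - pi\<^sup>2 / (12 * saddle n))
          + pi\<^sup>2 / 6 * x\<^sup>2 / (1 + x * sqrt (saddle n))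
          = S n (s n) + S n (s n) + real n * saddle_width n * x - (S n (saddle n) + S n (saddle n))"
        unfolding key by (simp add: algebra_simps)
      also have "exp \<dots> = (exp (S n (s n)))\<^sup>2 * exp (real n * saddle_width n * x) / (exp (S n (saddle n)))\<^sup>2"
        by (simp only: exp_add exp_diff power2_eq_square)
      finally show ?case
        unfolding tilted_norm_def prod_one_plus_exp S_def s_def .
    qed
  qed
qed

lemma tilted_norm_limit: "(\<lambda>n. tilted_norm n * exp (- (pi\<^sup>2 / (6 * saddle n)))) \<longlonglongrightarrow> 1 / 2"
proof -
  have sqs: "(\<lambda>n. sqrt (real n) * saddle n) \<longlonglongrightarrow> pi / sqrt 6"
    by (rule sqrt_mult_saddle)
  have "(\<lambda>n. (\<Sum>m=1..n. ln (1 + exp (- (real m * saddle n)))) - pi\<^sup>2 / (12 * saddle n)) \<longlonglongrightarrow> - (ln 2 / 2)"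
    by (rule sum_softplus_asymptotic[OF eventually_saddle_pos tendsto_saddle sqs]) simp
  then have "(\<lambda>n. exp ((\<Sum>m=1..n. ln (1 + exp (- (real m * saddle n)))) - pi\<^sup>2 / (12 * saddle n)) ^ 2)
      \<longlonglongrightarrow> exp (- (ln 2 / 2)) ^ 2"
    by (intro tendsto_power tendsto_exp)
  also have "exp (- (ln 2 / 2)) ^ 2 = (1 / 2 :: real)"
    by (simp only: exp_double[symmetric]) (simp add: exp_minus)
  also have "(\<lambda>n. exp ((\<Sum>m=1..n. ln (1 + exp (- (real m * saddle n)))) - pi\<^sup>2 / (12 * saddle n)) ^ 2)
      = (\<lambda>n. tilted_norm n * exp (- (pi\<^sup>2 / (6 * saddle n))))"
  proof
    fix n
    have *: "exp (- (pi\<^sup>2 / (6 * saddle n))) = exp (- (pi\<^sup>2 / (12 * saddle n))) ^ 2"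
      by (simp only: exp_double[symmetric]) simp
    show "exp ((\<Sum>m=1..n. ln (1 + exp (- (real m * saddle n)))) - pi\<^sup>2 / (12 * saddle n)) ^ 2
       = tilted_norm n * exp (- (pi\<^sup>2 / (6 * saddle n)))"
      unfolding tilted_norm_def prod_one_plus_exp *
      by (simp only: power_mult_distrib[symmetric] exp_add[symmetric]) simp
  qed
  finally show ?thesis .
qed

text \<open>
  Tilting by \<open>e\<^bsup>-kt\<^esup>\<close> turns the coefficients of the polynomial into nonnegative weights, and the exponent
  belonging to the coefficient of \<open>q\<^sup>n\<close> vanishes.
\<close>
lemma tilted_cf_expansion:
  obtains w :: "nat \<Rightarrow> nat \<Rightarrow> real" and d :: "nat \<Rightarrow> nat" where
    "\<And>n k. 0 \<le> w n k"
    "\<And>n. w n n = distinct_gf n $ n * exp (- (real n * saddle n)) / tilted_norm n"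
    "\<And>n k. k > d n \<Longrightarrow> w n k = 0"
    "\<And>n z. tilted_cf n z = (\<Sum>k\<le>d n. of_real (w n k) * exp (of_real (saddle_width n * (real n - real k)) * z))"
proof -
  have "\<forall>n. \<exists>p :: complex poly. (\<forall>k. coeff p k = of_real (distinct_gf n $ k)) \<and>
      (\<forall>q. poly p q = (\<Prod>m=1..n. 1 + q ^ m)\<^sup>2)"
    using distinct_gf_nonneg_poly by blast
  then obtain P :: "nat \<Rightarrow> complex poly" where P: "\<And>n k. coeff (P n) k = of_real (distinct_gf n $ k)"
    "\<And>n q. poly (P n) q = (\<Prod>m=1..n. 1 + q ^ m)\<^sup>2" by metis
  define d where "d = (\<lambda>n. degree (P n))"
  define w where "w = (\<lambda>n k. distinct_gf n $ k * exp (- (real k * saddle n)) / tilted_norm n)"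
  show ?thesis
  proof (rule that[of w d])
    show "0 \<le> w n k" for n k
      using distinct_gf_nonneg_poly[of n] tilted_norm_pos[of n] by (simp add: w_def)
    show "w n n = distinct_gf n $ n * exp (- (real n * saddle n)) / tilted_norm n" for n
      by (simp add: w_def)
    show "w n k = 0" if "k > d n" for n k
    proof -
      have "coeff (P n) k = 0" using that by (simp add: d_def coeff_eq_0)
      then show ?thesis using P(1)[of n k] by (simp add: w_def)
    qed
    fix n z
    let ?t = "complex_of_real (saddle n)" and ?k = "complex_of_real (saddle_width n)"
    have "tilted_cf n z = poly (P n) (exp (- (?t + ?k * z)))
        * exp (of_real (real n * saddle_width n) * z) / of_real (tilted_norm n)"
      by (simp add: tilted_cf_def P(2))
    also have "\<dots> = (\<Sum>k\<le>d n. of_real (distinct_gf n $ k) * exp (- (?t + ?k * z)) ^ k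
        * exp (of_real (real n * saddle_width n) * z) / of_real (tilted_norm n))"
      by (simp add: poly_altdef d_def P(1) sum_distrib_right sum_divide_distrib)
    also have "\<dots> = (\<Sum>k\<le>d n. of_real (w n k) * exp (of_real (saddle_width n * (real n - real k)) * z))"
    proof (rule sum.cong[OF refl])
      fix k
      have "exp (- (?t + ?k * z)) ^ k * exp (of_real (real n * saddle_width n) * z)
          = exp (of_nat k * (- (?t + ?k * z)) + of_real (real n * saddle_width n) * z)"
        by (simp add: exp_add exp_of_nat_mult)
      also have "of_nat k * (- (?t + ?k * z)) + of_real (real n * saddle_width n) * z
          = of_real (- (real k * saddle n)) + of_real (saddle_width n * (real n - real k)) * z"
        by (simp add: algebra_simps)
      also have "exp \<dots> = of_real (exp (- (real k * saddle n))) * exp (of_real (saddle_width n * (real n - real k)) * z)"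
        by (simp only: exp_add exp_of_real)
      finally show "of_real (distinct_gf n $ k) * exp (- (?t + ?k * z)) ^ k
        * exp (of_real (real n * saddle_width n) * z) / of_real (tilted_norm n)
        = of_real (w n k) * exp (of_real (saddle_width n * (real n - real k)) * z)"
        by (simp add: w_def mult.assoc)
    qed
    finally show "tilted_cf n z = (\<Sum>k\<le>d n. of_real (w n k) * exp (of_real (saddle_width n * (real n - real k)) * z))" .
  qed
qed

lemma tilted_cf_limit: "(\<lambda>n. tilted_cf n z) \<longlonglongrightarrow> exp (of_real (pi\<^sup>2 / 6) * z\<^sup>2)"
proof -
  obtain w d where w: "\<And>n k. 0 \<le> w n k"
    "\<And>n. w n n = distinct_gf n $ n * exp (- (real n * saddle n)) / tilted_norm n"
    "\<And>n k. k > d n \<Longrightarrow> w n k = 0"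
    "\<And>n z. tilted_cf n z = (\<Sum>k\<le>d n. of_real (w n k) * exp (of_real (saddle_width n * (real n - real k)) * z))"
    by (rule tilted_cf_expansion) blast
  show ?thesis unfolding w(4)
  proof (rule positive_exponential_sum_limit[OF w(1)])
    fix x :: real
    have "(\<Prod>m=1..n. 1 + exp (- (saddle n + saddle_width n * x)) ^ m)\<^sup>2
       * exp (real n * saddle_width n * x) / tilted_norm n
       = (\<Sum>k\<le>d n. w n k * exp (saddle_width n * (real n - real k) * x))" for n
    proof -
      have "complex_of_real ((\<Prod>m=1..n. 1 + exp (- (saddle n + saddle_width n * x)) ^ m)\<^sup>2
         * exp (real n * saddle_width n * x) / tilted_norm n) = tilted_cf n (of_real x)"
        by (simp only: tilted_cf_def of_real_mult of_real_add of_real_minus of_real_divide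
              of_real_power of_real_prod of_real_1 exp_of_real[symmetric])
      also have "\<dots> = of_real (\<Sum>k\<le>d n. w n k * exp (saddle_width n * (real n - real k) * x))"
        unfolding w(4) by (simp only: of_real_sum of_real_mult of_real_diff exp_of_real[symmetric])
      finally show ?thesis by (simp only: of_real_eq_iff)
    qed
    with tilted_real_limit[of x]
    show "(\<lambda>n. \<Sum>k\<le>d n. w n k * exp (saddle_width n * (real n - real k) * x)) \<longlonglongrightarrow> exp (pi\<^sup>2 / 6 * x\<^sup>2)"
      by simp
  qed
qed

lemma integral_cis_symmetric:
  fixes b c :: real
  assumes "c \<ge> 0" "b \<noteq> 0" "sin (b * c) = 0"
  shows "((\<lambda>y. exp (of_real b * (\<i> * of_real y))) has_integral 0) {- c..c}"
proof -
  define F where "F = (\<lambda>y::real. 1 / (\<i> * of_real b) * exp (y *\<^sub>R (\<i> * complex_of_real b)))"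
  have "((\<lambda>y. exp (of_real b * (\<i> * of_real y))) has_integral (F c - F (- c))) {- c..c}"
  proof (rule fundamental_theorem_of_calculus)
    fix y assume "y \<in> {- c..c}"
    have "(F has_vector_derivative 1 / (\<i> * of_real b) * (exp (y *\<^sub>R (\<i> * complex_of_real b)) * (\<i> * of_real b)))
        (at y within {- c..c})"
      unfolding F_def
      by (intro has_vector_derivative_mult_right exp_scaleR_has_vector_derivative_right)
    also have "1 / (\<i> * of_real b) * (exp (y *\<^sub>R (\<i> * complex_of_real b)) * (\<i> * of_real b))
        = exp (of_real b * (\<i> * of_real y))"
      using assms by (simp add: scaleR_conv_of_real mult_ac)
    finally show "(F has_vector_derivative exp (of_real b * (\<i> * of_real y))) (at y within {- c..c})" .
  qed (use assms in auto)
  moreover have "exp (c *\<^sub>R (\<i> * complex_of_real b)) = exp ((- c) *\<^sub>R (\<i> * complex_of_real b))"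
  proof -
    have "exp (c *\<^sub>R (\<i> * complex_of_real b)) = cis (b * c)"
      by (simp add: cis_conv_exp scaleR_conv_of_real mult_ac)
    moreover have "exp ((- c) *\<^sub>R (\<i> * complex_of_real b)) = cis (- (b * c))"
      unfolding cis_conv_exp by (simp add: scaleR_conv_of_real mult_ac)
    ultimately show ?thesis using assms(3) by (simp add: complex_eq_iff)
  qed
  ultimately show ?thesis by (simp add: F_def)
qed

text \<open>
  On an interval of length \<open>2\<pi>/\<kappa>\<close>, \<open>\<kappa>\<close> being the width, all exponentials integrate to zero except the constant one, which
  belongs to the coefficient of \<open>q\<^sup>n\<close>.
\<close>
lemma tilted_cf_integral:
  assumes "n > 0"
  shows "((\<lambda>y. tilted_cf n (\<i> * of_real y)) has_integral
      of_real (2 * pi / saddle_width n * (distinct_gf n $ n * exp (- (real n * saddle n)) / tilted_norm n)))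
     {- (pi / saddle_width n)..pi / saddle_width n}"
proof -
  obtain w d where w0: "\<And>n k. 0 \<le> w n k" and w: "\<And>n. w n n = distinct_gf n $ n * exp (- (real n * saddle n)) / tilted_norm n"
    "\<And>n k. k > d n \<Longrightarrow> w n k = 0"
    "\<And>n z. tilted_cf n z = (\<Sum>k\<le>d n. of_real (w n k) * exp (of_real (saddle_width n * (real n - real k)) * z))"
    by (rule tilted_cf_expansion) blast
  define c where "c = pi / saddle_width n"
  have k: "saddle_width n > 0" using assms by (rule saddle_width_pos)
  then have c: "c > 0" by (simp add: c_def)
  have ck: "((\<lambda>y. exp (of_real (saddle_width n * (real n - real k)) * (\<i> * of_real y))) has_integral
      (if k = n then of_real (2 * c) else 0)) {- c..c}" for k
  proof (cases "k = n")
    case True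
    then show ?thesis using has_integral_const_real[of "1 :: complex" "- c" c] c
      by (simp add: scaleR_conv_of_real)
  next
    case False
    have "saddle_width n * (real n - real k) * c = pi * real_of_int (int n - int k)"
      using k by (simp add: c_def)
    then have "sin (saddle_width n * (real n - real k) * c) = 0"
      by (simp only: sin_npi_int)
    then have "((\<lambda>y. exp (of_real (saddle_width n * (real n - real k)) * (\<i> * of_real y))) has_integral 0) {- c..c}"
      using c k False \<open>saddle_width n > 0\<close> by (intro integral_cis_symmetric) auto
    then show ?thesis by (simp only: if_not_P[OF False])
  qed
  have "((\<lambda>y. tilted_cf n (\<i> * of_real y)) has_integral
      (\<Sum>k\<le>d n. of_real (w n k) * (if k = n then of_real (2 * c) else 0))) {- c..c}"
    unfolding w(3) by (intro has_integral_sum has_integral_mult_right ck finite_atMost)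
  also have "(\<Sum>k\<le>d n. of_real (w n k) * (if k = n then of_real (2 * c) else 0)) = complex_of_real (w n n * (2 * c))"
    using w(2)[of n n] by (auto simp: if_distrib cong: if_cong)
  finally show ?thesis by (simp add: w(1) c_def mult_ac)
qed

text \<open>
  The modulus is at most \<open>exp (1 - E/2)\<close> with \<open>E = (y\<^sup>2/64) / (1 + t y\<^sup>2/16)\<close>, which is quadratic in the central region
  and, because \<open>t\<^sup>3 y\<^sup>2 \<le> \<pi>\<^sup>2\<close>, still of order \<open>\<bar>y\<bar>\<^bsup>2/3\<^esup>\<close> at the ends of the interval. This one bound replaces a division into
  major and minor arcs; it is weakened to \<open>1/(1 + y\<^sup>2)\<close>, an integrable function independent of \<open>n\<close>.
\<close>
lemma tilted_cf_bound:
  fixes y :: real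
  assumes n: "n > 0" and t: "saddle n \<le> 1 / 2"
    and tail: "2 * exp (- saddle n) ^ Suc n / (1 - exp (- saddle n)) \<le> 2"
    and y: "\<bar>y\<bar> \<le> pi / saddle_width n"
  shows "norm (tilted_cf n (\<i> * of_real y)) \<le> exp 1 * (2 * (216 * 64^3 * 8)) / (1 + y\<^sup>2)"
proof -
  define t where "t = saddle n"
  define \<kappa> where "\<kappa> = saddle_width n"
  define \<rho> where "\<rho> = exp (- t)"
  define \<theta> where "\<theta> = \<kappa> * y"
  have t0: "0 < t" "t \<le> 1 / 2" using assms saddle_pos by (auto simp: t_def)
  have \<kappa>: "\<kappa> > 0" "\<kappa>\<^sup>2 = t^3"
    using n t0 by (auto simp: \<kappa>_def saddle_width_pos)
      (simp add: saddle_width_def t_def power_mult_distrib power2_eq_square power3_eq_cube)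
  have \<rho>: "0 < \<rho>" "\<rho> < 1" "1 - \<rho> \<le> t" "1 / 2 \<le> \<rho>"
    using t0 exp_ge_add_one_self[of "- t"] by (auto simp: \<rho>_def)
  have \<theta>: "\<bar>\<theta>\<bar> \<le> pi" "\<theta>\<^sup>2 = t^3 * y\<^sup>2"
    using y \<kappa> by (auto simp: \<theta>_def \<kappa>_def abs_mult field_simps power_mult_distrib)
  define v where "v = 1 - cos \<theta>"
  define v' where "v' = \<theta>\<^sup>2 / 32"
  have v: "0 \<le> v'" "v' \<le> v" using one_minus_cos_lower[OF \<theta>(1)] by (auto simp: v_def v'_def)
  define E where "E = (y\<^sup>2 / 64) / (1 + t * y\<^sup>2 / 16)"
  have E0: "E \<ge> 0" using t0 by (simp add: E_def)
  have q: "exp (- (of_real t + of_real \<kappa> * (\<i> * of_real y))) = of_real \<rho> * cis (- \<theta>)"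
  proof -
    have *: "- (of_real t + of_real \<kappa> * (\<i> * of_real y)) = complex_of_real (- t) + \<i> * of_real (- \<theta>)"
      by (simp add: \<theta>_def algebra_simps)
    show ?thesis unfolding * by (simp only: exp_add cis_conv_exp exp_of_real \<rho>_def)
  qed
  have qm: "(of_real \<rho> * cis (- \<theta>)) ^ m = of_real (\<rho> ^ m) * cis (- (real m * \<theta>))" for m
    by (simp add: power_mult_distrib Complex.DeMoivre)
  have "norm (tilted_cf n (\<i> * of_real y))
      = (norm (\<Prod>m=1..n. 1 + (of_real \<rho> * cis (- \<theta>)) ^ m))\<^sup>2 / tilted_norm n"
    using tilted_norm_pos[of n] unfolding tilted_cf_def t_def[symmetric] \<kappa>_def[symmetric] q
    by (simp add: norm_mult norm_divide norm_power)
  also have "\<dots> = (\<Prod>m=1..n. (norm (1 + of_real (\<rho> ^ m) * cis (- (real m * \<theta>))))\<^sup>2 / (1 + \<rho> ^ m)\<^sup>2)"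
    by (simp only: qm tilted_norm_def prod_norm[symmetric] prod_power_distrib[symmetric] prod_dividef
          \<rho>_def[symmetric] t_def[symmetric])
  also have "\<dots> \<le> (\<Prod>m=1..n. exp (- (\<rho> ^ m * (1 - cos (real m * \<theta>)) / 2)))"
  proof (intro prod_mono conjI)
    fix m
    have "\<rho> ^ m \<le> 1" using \<rho> by (intro power_le_one) auto
    then show "(norm (1 + of_real (\<rho> ^ m) * cis (- (real m * \<theta>))))\<^sup>2 / (1 + \<rho> ^ m)\<^sup>2
        \<le> exp (- (\<rho> ^ m * (1 - cos (real m * \<theta>)) / 2))"
      using norm_one_plus_ratio[of "\<rho> ^ m" "- (real m * \<theta>)"] \<rho> by simp
  qed simp
  also have "\<dots> = exp (- ((\<Sum>m=1..n. \<rho> ^ m * (1 - cos (real m * \<theta>))) / 2))"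
    by (simp add: sum_negf sum_divide_distrib flip: exp_sum)
  also have "(\<Sum>m=1..n. \<rho> ^ m * (1 - cos (real m * \<theta>))) = (\<Sum>m<Suc n. \<rho> ^ m * (1 - cos (real m * \<theta>)))"
    by (simp only: lessThan_Suc_atMost, subst sum.atMost_shift) (simp add: sum.shift_bounds_Suc_ivl sum.atLeast1_atMost_eq lessThan_atLeast0)
  also have "exp (- ((\<Sum>m<Suc n. \<rho> ^ m * (1 - cos (real m * \<theta>))) / 2)) \<le> exp (- ((E - 2) / 2))"
  proof -
    have "v' * ((1 - \<rho>)\<^sup>2 + 2 * \<rho> * v) \<le> v * (t\<^sup>2 + 2 * v')"
    proof -
      have "v' * (1 - \<rho>)\<^sup>2 \<le> v * t\<^sup>2"
        using v \<rho> by (intro mult_mono power_mono) auto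
      moreover have "\<rho> * (v * v') \<le> 1 * (v * v')"
        using v \<rho> by (intro mult_right_mono mult_nonneg_nonneg) auto
      ultimately show ?thesis by (simp add: algebra_simps)
    qed
    moreover have d1: "(1 - \<rho>)\<^sup>2 + 2 * \<rho> * v > 0" using \<rho> v by (intro add_pos_nonneg) auto
    moreover have d2: "t\<^sup>2 + 2 * v' > 0" using t0 v by (intro add_pos_nonneg) auto
    ultimately have r1: "v' / (t\<^sup>2 + 2 * v') \<le> v / ((1 - \<rho>)\<^sup>2 + 2 * \<rho> * v)"
      by (simp add: frac_le_eq divide_simps mult_ac)
    have "1 / 2 * 1 \<le> \<rho> * (1 + \<rho>)" using \<rho> by (intro mult_mono) auto
    then have r2: "1 / 2 / t \<le> \<rho> * (1 + \<rho>) / (1 - \<rho>)"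
      using \<rho> by (intro frac_le) auto
    have "E = 1 / 2 / t * (v' / (t\<^sup>2 + 2 * v'))"
    proof -
      have "t\<^sup>2 + 2 * v' = t\<^sup>2 * (1 + t * y\<^sup>2 / 16)"
        unfolding v'_def \<theta>(2) by (simp add: power2_eq_square power3_eq_cube algebra_simps)
      then have "1 / 2 / t * (v' / (t\<^sup>2 + 2 * v')) = 1 / 2 / t * (t^3 * y\<^sup>2 / 32 / (t\<^sup>2 * (1 + t * y\<^sup>2 / 16)))"
        by (simp add: v'_def \<theta>(2))
      also have "\<dots> = E" using t0 unfolding E_def by (simp add: power2_eq_square power3_eq_cube)
      finally show ?thesis by simp
    qed
    also have "\<dots> \<le> \<rho> * (1 + \<rho>) / (1 - \<rho>) * (v / ((1 - \<rho>)\<^sup>2 + 2 * \<rho> * v))"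
      using r1 r2 t0 v d2 \<rho> by (intro mult_mono) auto
    also have "\<dots> = \<rho> * (1 + \<rho>) * (1 - cos \<theta>) / ((1 - \<rho>) * ((1 - \<rho>)\<^sup>2 + 2 * \<rho> * (1 - cos \<theta>)))"
      by (simp add: v_def)
    finally have "E - 2 \<le> (\<Sum>m<Suc n. \<rho> ^ m * (1 - cos (real m * \<theta>)))"
      using sum_power_one_minus_cos_lower[OF \<rho>(1,2), of \<theta> "Suc n"] tail
      unfolding \<rho>_def t_def by linarith
    then show ?thesis by simp
  qed
  also have "\<dots> = exp 1 * exp (- (E / 2))" by (simp add: diff_divide_distrib flip: exp_add)
  also have "\<dots> \<le> exp 1 * ((2 * (216 * 64^3 * 8)) / (1 + y\<^sup>2))"
  proof (rule mult_left_mono)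
    show "exp (- (E / 2)) \<le> (2 * (216 * 64^3 * 8)) / (1 + y\<^sup>2)"
    proof (cases "\<bar>y\<bar> \<le> 1")
      case True
      then have "1 + y\<^sup>2 \<le> 2" by (simp add: abs_square_le_1)
      have "exp (- (E / 2)) \<le> 1" using E0 by simp
      also have "1 \<le> (2 * (216 * 64^3 * 8)) / (1 + y\<^sup>2)"
        using \<open>1 + y\<^sup>2 \<le> 2\<close> by (simp add: le_divide_eq add_pos_nonneg)
      finally show ?thesis .
    next
      case False
      define x where "x = t * y\<^sup>2 / 16"
      have "1 < \<bar>y\<bar>\<^sup>2" using False by (intro one_less_power) auto
      then have y1: "1 < y\<^sup>2" by simp
      have y2: "1 \<le> y^4" using y1 power_increasing[of 2 4 "\<bar>y\<bar>"] False by simp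
      have "0 < t * y\<^sup>2" using t0 y1 by (intro mult_pos_pos) linarith+
      then have x0: "x > 0" by (simp add: x_def)
      have Epos: "E > 0" unfolding E_def using \<open>0 < t * y\<^sup>2\<close> y1
        by (intro divide_pos_pos add_pos_pos) auto
      have y6: "(y\<^sup>2)^3 = y\<^sup>2 * y^4" "y^6 = y\<^sup>2 * y^4"
        by (simp_all only: power_mult[symmetric] power_add[symmetric]) simp_all
      have "x^3 = t^3 * (y\<^sup>2)^3 / 16^3" by (simp only: x_def power_divide power_mult_distrib)
      then have "x^3 = \<theta>\<^sup>2 * y^4 / 4096" by (simp add: \<theta>(2) y6(1))
      also have "\<dots> \<le> 4096 * y^4 / 4096"
      proof -
        have "\<theta>\<^sup>2 \<le> pi\<^sup>2" using \<theta>(1) by (metis abs_le_square_iff abs_of_nonneg pi_ge_zero)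
        also have "\<dots> \<le> 4\<^sup>2" using pi_less_4 by (intro power_mono) auto
        finally have "\<theta>\<^sup>2 \<le> 4096" by simp
        then show ?thesis by (intro divide_right_mono mult_right_mono) auto
      qed
      finally have x3: "x^3 \<le> y^4" by simp
      \<comment> \<open>power means, as \<open>4 (1 + x\<^sup>3) - (1 + x)\<^sup>3 = 3 (x - 1)\<^sup>2 (x + 1)\<close>\<close>
      have "(1 + x)^3 \<le> 4 * (1 + x^3)"
      proof -
        have "4 * (1 + x^3) - (1 + x)^3 = 3 * ((x - 1)\<^sup>2 * (x + 1))"
          by (simp add: power3_eq_cube power2_eq_square algebra_simps)
        also have "\<dots> \<ge> 0" using x0 by simp
        finally show ?thesis by simp
      qed
      also have "\<dots> \<le> 8 * y^4" using x3 y2 by simp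
      finally have x4: "(1 + x)^3 \<le> 8 * y^4" .
      have "(E / 6)^3 \<le> exp (E / 6) ^ 3"
        using exp_ge_add_one_self[of "E / 6"] E0 by (intro power_mono) linarith+
      also have "exp (E / 6) ^ 3 = exp (E / 2)" by (simp flip: exp_of_nat_mult)
      finally have "E^3 / 216 \<le> exp (E / 2)" by (simp add: power_divide)
      then have "exp (- (E / 2)) \<le> 216 / E^3"
        using Epos by (simp add: exp_minus field_simps)
      also have "E^3 = y^6 / 64^3 / (1 + x)^3"
        by (simp only: E_def x_def power_divide power_mult[symmetric]) simp
      also have "216 / (y^6 / 64^3 / (1 + x)^3) = 216 * 64^3 * (1 + x)^3 / y^6" by simp
      also have "\<dots> \<le> 216 * 64^3 * (8 * y^4) / y^6"
        using x4 by (intro divide_right_mono mult_left_mono) auto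
      also have "\<dots> = 216 * 64^3 * 8 / y\<^sup>2"
      proof -
        have y4: "y^4 \<noteq> 0" using y2 by linarith
        then show ?thesis unfolding y6(2)
          using mult_divide_mult_cancel_right[OF y4, of "216 * 64^3 * 8" "y\<^sup>2"] by (simp only: mult.assoc)
      qed
      also have "\<dots> = 2 * (216 * 64^3 * 8) / (2 * y\<^sup>2)" by simp
      also have "\<dots> \<le> 2 * (216 * 64^3 * 8) / (1 + y\<^sup>2)"
        using y1 by (intro divide_left_mono mult_pos_pos) (auto simp: add_pos_pos)
      finally show ?thesis .
    qed
  qed simp
  finally show ?thesis by simp
qed

lemma coeff_mult_prod_one_minus_X:
  fixes F :: "real fps"
  assumes "finite S" "\<And>m. m \<in> S \<Longrightarrow> n < m"
  shows "(F * (\<Prod>m\<in>S. 1 - fps_X ^ m)) $ n = F $ n"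
  using assms
proof (induction S arbitrary: F)
  case (insert m S)
  have "(F * (\<Prod>m\<in>insert m S. 1 - fps_X ^ m)) = (F - fps_X ^ m * F) * (\<Prod>m\<in>S. 1 - fps_X ^ m)"
  proof -
    have "F * (\<Prod>m\<in>insert m S. 1 - fps_X ^ m) = F * (1 - fps_X ^ m) * (\<Prod>m\<in>S. 1 - fps_X ^ m)"
      by (simp only: prod.insert[OF insert.hyps] mult.assoc)
    also have "F * (1 - fps_X ^ m) = F - fps_X ^ m * F" by (simp add: algebra_simps)
    finally show ?thesis .
  qed
  also have "\<dots> $ n = (F - fps_X ^ m * F) $ n" using insert by simp
  also have "\<dots> = F $ n" using insert by (simp add: fps_X_power_mult_nth)
  finally show ?case .
qed simp

text \<open>
  Euler's theorem on odd and distinct parts, truncated at \<open>n\<close>. From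
  \<open>\<Prod>\<^bsub>m \<le> 2n\<^esub> (1 - q\<^sup>m) = \<Prod>\<^bsub>i < n\<^esub> (1 - q\<^bsup>2i+1\<^esup>) \<Prod>\<^bsub>m \<le> n\<^esub> (1 + q\<^sup>m)(1 - q\<^sup>m)\<close> the odd product times the distinct one is
  \<open>\<Prod>\<^bsub>n < m \<le> 2n\<^esub> (1 - q\<^sup>m)\<close>, which does not affect coefficients up to \<open>q\<^sup>n\<close>.
\<close>
lemma pair_coeff_eq_distinct_gf: "pair_coeff n = distinct_gf n $ n"
proof -
  define Od :: "nat \<Rightarrow> real fps" where "Od = (\<lambda>N. \<Prod>i<N. 1 - fps_X ^ (2*i+1))"
  define D :: "nat \<Rightarrow> real fps" where "D = (\<lambda>N. \<Prod>m=1..N. 1 + fps_X ^ m)"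
  define E :: "nat \<Rightarrow> real fps" where "E = (\<lambda>N. \<Prod>m=1..N. 1 - fps_X ^ m)"
  define R :: "nat \<Rightarrow> real fps" where "R = (\<lambda>N. \<Prod>m=N+1..2*N. 1 - fps_X ^ m)"
  have G: "odd_pairs_gf N * (Od N)\<^sup>2 = 1" for N
  proof (induction N)
    case (Suc N)
    have "odd_pairs_gf (Suc N) * (Od (Suc N))\<^sup>2
        = ((1 - fps_X ^ (2*N+1))\<^sup>2 * odd_pairs_gf (Suc N)) * (Od N)\<^sup>2"
      by (simp only: Od_def prod.lessThan_Suc power_mult_distrib mult_ac)
    then show ?case unfolding odd_pairs_gf_Suc_mult using Suc by simp
  qed (simp add: Od_def)
  have split: "E (2 * N) = Od N * (D N * E N)" for N
  proof (induction N)
    case (Suc N)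
    have "E (2 * Suc N) = E (2 * N) * (1 - fps_X ^ (2*N+1)) * (1 - (fps_X ^ Suc N)\<^sup>2)"
      by (simp add: E_def mult_ac power2_eq_square flip: power_add)
    also have "1 - (fps_X ^ Suc N)\<^sup>2 = (1 + fps_X ^ Suc N) * (1 - fps_X ^ Suc N :: real fps)"
      by (simp only: algebra_simps power2_eq_square) simp
    finally show ?case unfolding Suc by (simp add: Od_def D_def E_def mult_ac)
  qed (simp add: E_def Od_def D_def)
  have E2: "E (2 * n) = E n * R n"
    unfolding E_def R_def using prod.ub_add_nat[of 1 n "\<lambda>m. 1 - fps_X ^ m :: real fps" n]
    by (simp add: mult_2)
  have "E n \<noteq> 0"
  proof -
    have "(1 - fps_X ^ m :: real fps) \<noteq> 0" if "m \<ge> 1" for m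
    proof -
      have "(1 - fps_X ^ m :: real fps) $ 0 = 1" using that by simp
      then show ?thesis by (metis fps_zero_nth zero_neq_one)
    qed
    then show ?thesis unfolding E_def by (subst prod_zero_iff) auto
  qed
  then have DO: "D n * Od n = R n" using split[of n] E2 by (simp add: mult_ac)
  have "distinct_gf n = (D n)\<^sup>2 * (odd_pairs_gf n * (Od n)\<^sup>2)"
    by (simp add: distinct_gf_def D_def G)
  also have "\<dots> = odd_pairs_gf n * R n * R n"
    by (simp only: DO[symmetric] power2_eq_square mult_ac)
  finally have "distinct_gf n $ n = (odd_pairs_gf n * R n * R n) $ n" by simp
  also have "(F * R n) $ n = F $ n" for F
    unfolding R_def by (rule coeff_mult_prod_one_minus_X) auto
  then have "(odd_pairs_gf n * R n * R n) $ n = odd_pairs_gf n $ n" by simp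
  finally show ?thesis by (simp add: pair_coeff_def)
qed

lemma gaussian_integral:
  "(\<integral>y. exp (- (pi\<^sup>2 / 6 * y\<^sup>2)) \<partial>lborel) = sqrt (6 / pi)"
proof -
  have "exp (- (pi\<^sup>2 / 6 * y\<^sup>2)) = sqrt (6 / pi) * normal_density 0 (sqrt 3 / pi) y" for y
  proof -
    have "2 * pi * (sqrt 3 / pi)\<^sup>2 = 6 / pi" by (simp add: power_divide power2_eq_square)
    moreover have "(y - 0)\<^sup>2 / (2 * (sqrt 3 / pi)\<^sup>2) = pi\<^sup>2 / 6 * y\<^sup>2" by (simp add: power_divide)
    ultimately show ?thesis unfolding normal_density_def by simp
  qed
  then show ?thesis by (simp add: integral_normal_density)
qed

text \<open>
  Dominated convergence for the integral of \<open>tilted_cf\<close> along the imaginary axis, whose pointwise limit is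
  \<open>exp (- A y\<^sup>2)\<close>.
\<close>
lemma tilted_coeff_limit:
  "(\<lambda>n. 2 * pi / saddle_width n * (pair_coeff n * exp (- (real n * saddle n)) / tilted_norm n))
     \<longlonglongrightarrow> sqrt (6 / pi)"
proof -
  define c where "c = (\<lambda>n. pi / saddle_width n)"
  define W where "W = (\<lambda>n. 2 * pi / saddle_width n * (pair_coeff n * exp (- (real n * saddle n)) / tilted_norm n))"
  define f where "f = (\<lambda>n (y::real). indicator {- c n..c n} y *\<^sub>R tilted_cf n (\<i> * of_real y))"
  define g where "g = (\<lambda>y::real. exp (of_real (pi\<^sup>2 / 6) * (\<i> * complex_of_real y)\<^sup>2))"
  define B where "B = (\<lambda>y::real. exp 1 * (2 * (216 * 64^3 * 8)) / (1 + y\<^sup>2))"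
  have cont: "continuous_on S (\<lambda>y. tilted_cf n (\<i> * of_real y))" for n S
    using tilted_norm_pos[of n] unfolding tilted_cf_def by (intro continuous_intros) auto
  have int: "integral\<^sup>L lborel (f n) = of_real (W n)" if "n > 0" for n
  proof -
    have si: "set_integrable lborel {- c n..c n} (\<lambda>y. tilted_cf n (\<i> * of_real y))"
      by (rule borel_integrable_atLeastAtMost'[OF cont])
    have "integral\<^sup>L lborel (f n) = integral {- c n..c n} (\<lambda>y. tilted_cf n (\<i> * of_real y))"
      using set_borel_integral_eq_integral(2)[OF si] by (simp add: f_def set_lebesgue_integral_def)
    also have "\<dots> = of_real (W n)"
      using tilted_cf_integral[OF that]
      by (intro integral_unique) (simp add: c_def W_def pair_coeff_eq_distinct_gf)
    finally show ?thesis .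
  qed
  have sw0: "saddle_width \<longlonglongrightarrow> 0"
  proof -
    have "(\<lambda>n. saddle n * sqrt (saddle n)) \<longlonglongrightarrow> 0 * sqrt 0"
      by (intro tendsto_mult tendsto_real_sqrt tendsto_saddle)
    then show ?thesis by (simp add: saddle_width_def[abs_def])
  qed
  have lim: "(\<lambda>n. f n y) \<longlonglongrightarrow> g y" for y
  proof -
    have "(\<lambda>n. \<bar>y\<bar> * saddle_width n) \<longlonglongrightarrow> \<bar>y\<bar> * 0" by (intro tendsto_intros sw0)
    then have "\<forall>\<^sub>F n in sequentially. \<bar>y\<bar> * saddle_width n < pi"
      by (rule order_tendstoD) simp
    then have "\<forall>\<^sub>F n in sequentially. tilted_cf n (\<i> * of_real y) = f n y"
      using eventually_gt_at_top[of 0]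
    proof eventually_elim
      case (elim n)
      have "\<bar>y\<bar> \<le> c n" using elim saddle_width_pos[of n] by (simp add: c_def field_simps)
      then have "y \<in> {- c n..c n}" by auto
      then show ?case by (simp add: f_def)
    qed
    with tilted_cf_limit[of "\<i> * of_real y"] show ?thesis
      unfolding g_def by (rule Lim_transform_eventually)
  qed
  have "\<forall>\<^sub>F n in sequentially. saddle n < 1 / 2"
    by (rule order_tendstoD[OF tendsto_saddle]) simp
  moreover have "\<forall>\<^sub>F n in sequentially. 2 * exp (- saddle n) ^ Suc n / (1 - exp (- saddle n)) < 2"
  proof -
    have "(\<lambda>n. 2 * exp (- ((real n + 1) * (pi / sqrt (6 * real n)))) / (1 - exp (- (pi / sqrt (6 * real n))))) \<longlonglongrightarrow> 0"
      by real_asymp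
    moreover have "exp (- saddle n) ^ Suc n = exp (- ((real n + 1) * (pi / sqrt (6 * real n))))" for n
      by (subst exp_of_nat_mult[symmetric]) (simp add: saddle_def add.commute)
    ultimately have "(\<lambda>n. 2 * exp (- saddle n) ^ Suc n / (1 - exp (- saddle n))) \<longlonglongrightarrow> 0"
      by (simp add: saddle_def)
    then show ?thesis by (rule order_tendstoD) simp
  qed
  ultimately have "\<forall>\<^sub>F n in sequentially. \<forall>y. norm (f n y) \<le> B y"
    using eventually_gt_at_top[of 0]
  proof eventually_elim
    case (elim n)
    show ?case
    proof
      fix y
      show "norm (f n y) \<le> B y"
      proof (cases "y \<in> {- c n..c n}")
        case True
        then have "\<bar>y\<bar> \<le> pi / saddle_width n" by (auto simp: c_def)
        then show ?thesis
          using tilted_cf_bound[of n y] elim True by (simp add: f_def B_def)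
      next
        case False
        then show ?thesis by (simp add: f_def B_def add_pos_nonneg less_imp_le)
      qed
    qed
  qed
  then obtain N where N: "\<And>n y. n \<ge> N \<Longrightarrow> norm (f n y) \<le> B y"
    by (auto simp: eventually_sequentially)
  have Bint: "integrable lborel B"
  proof -
    have "integrable lborel (\<lambda>y::real. inverse (1 + y\<^sup>2))"
      using integrable_inverse_1_plus_square by (simp add: set_integrable_def)
    then have "integrable lborel (\<lambda>y::real. exp 1 * (2 * (216 * 64^3 * 8)) * inverse (1 + y\<^sup>2))"
      by (rule integrable_mult_right)
    then show ?thesis by (simp add: B_def[abs_def] divide_inverse)
  qed
  have meas: "f n \<in> borel_measurable lborel" for n
    unfolding f_def using cont[of UNIV n]
    by (intro borel_measurable_scaleR borel_measurable_indicator) (auto intro: borel_measurable_continuous_onI)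
  have measg: "g \<in> borel_measurable lborel"
    unfolding g_def by (auto intro!: borel_measurable_continuous_onI continuous_intros)
  have "(\<lambda>n. integral\<^sup>L lborel (f (n + N))) \<longlonglongrightarrow> integral\<^sup>L lborel g"
  proof (rule integral_dominated_convergence[OF measg meas Bint])
    show "AE y in lborel. (\<lambda>n. f (n + N) y) \<longlonglongrightarrow> g y"
      using lim by (intro AE_I2 LIMSEQ_ignore_initial_segment)
    show "AE y in lborel. norm (f (n + N) y) \<le> B y" for n
      by (intro AE_I2 N) simp
  qed
  then have "(\<lambda>n. integral\<^sup>L lborel (f n)) \<longlonglongrightarrow> integral\<^sup>L lborel g" by (rule LIMSEQ_offset)
  moreover have "\<forall>\<^sub>F n in sequentially. integral\<^sup>L lborel (f n) = of_real (W n)"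
    using eventually_gt_at_top[of 0] by eventually_elim (rule int)
  ultimately have "(\<lambda>n. complex_of_real (W n)) \<longlonglongrightarrow> integral\<^sup>L lborel g"
    by (rule Lim_transform_eventually)
  also have "integral\<^sup>L lborel g = of_real (sqrt (6 / pi))"
  proof -
    have g_eq: "g = (\<lambda>y. of_real (exp (- (pi\<^sup>2 / 6 * y\<^sup>2))))"
      by (rule ext) (simp add: g_def power_mult_distrib flip: exp_of_real)
    have "integral\<^sup>L lborel g = of_real (\<integral>y. exp (- (pi\<^sup>2 / 6 * y\<^sup>2)) \<partial>lborel)"
      unfolding g_eq by (rule integral_complex_of_real)
    then show ?thesis by (simp only: gaussian_integral)
  qed
  finally show ?thesis by (simp only: tendsto_of_real_iff W_def)
qed

lemma pair_coeff_asymptotic: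
  "(\<lambda>n. pair_coeff n / (real n powr (- (3/4)) * exp (pi * sqrt (2 * real n / 3))))
     \<longlonglongrightarrow> 1 / (2 powr (9/4) * 3 powr (1/4))"
proof -
  define b where "b = pi / sqrt 6"
  define C where "C = sqrt (6 / pi) * (1 / 2) * (b * sqrt b / (2 * pi))"
  have b: "b > 0" "b\<^sup>2 = pi\<^sup>2 / 6" by (simp_all add: b_def power_divide)
  have "(\<lambda>n. 2 * pi / saddle_width n * (pair_coeff n * exp (- (real n * saddle n)) / tilted_norm n)
      * (tilted_norm n * exp (- (pi\<^sup>2 / (6 * saddle n)))) * (b * sqrt b / (2 * pi)))
    \<longlonglongrightarrow> sqrt (6 / pi) * (1 / 2) * (b * sqrt b / (2 * pi))"
    by (rule tendsto_mult[OF tendsto_mult[OF tilted_coeff_limit tilted_norm_limit] tendsto_const])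
  moreover have "\<forall>\<^sub>F n in sequentially.
      2 * pi / saddle_width n * (pair_coeff n * exp (- (real n * saddle n)) / tilted_norm n)
        * (tilted_norm n * exp (- (pi\<^sup>2 / (6 * saddle n)))) * (b * sqrt b / (2 * pi))
      = pair_coeff n / (real n powr (- (3/4)) * exp (pi * sqrt (2 * real n / 3)))"
    using eventually_gt_at_top[of 0]
  proof eventually_elim
    case (elim n)
    define x where "x = sqrt (real n)"
    have x: "x > 0" "real n = x\<^sup>2" using elim by (simp_all add: x_def)
    have s: "saddle n = b / x" by (simp add: saddle_def b_def x_def real_sqrt_mult)
    have sw: "saddle_width n = b * sqrt b / (x * sqrt x)"
      by (simp add: saddle_width_def s real_sqrt_divide)
    have p: "real n powr (- (3/4)) = 1 / (x * sqrt x)"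
    proof -
      have "x * sqrt x = x powr 1 * x powr (1/2)" using x by (simp add: powr_half_sqrt)
      also have "\<dots> = x powr (3/2)" by (simp only: powr_add[symmetric]) simp
      also have "\<dots> = real n powr (3/4)" 
      proof -
        have "x\<^sup>2 = x powr 2" using x by simp
        then show ?thesis unfolding x(2) by (simp only: powr_powr) simp
      qed
      finally have q: "x * sqrt x = real n powr (3/4)" .
      show ?thesis by (simp only: q powr_minus inverse_eq_divide)
    qed
    have e: "pi * sqrt (2 * real n / 3) = real n * saddle n + pi\<^sup>2 / (6 * saddle n)"
    proof -
      have "sqrt (2 * real n / 3) = sqrt (4 * (real n / 6))" by simp
      also have "\<dots> = 2 * (x / sqrt 6)" by (simp only: real_sqrt_mult real_sqrt_divide x_def) simp
      finally have "pi * sqrt (2 * real n / 3) = 2 * (b * x)" by (simp add: b_def)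
      moreover have "pi\<^sup>2 / (6 * saddle n) = b * x"
      proof -
        have "pi\<^sup>2 / (6 * saddle n) = (pi\<^sup>2 / 6) / saddle n" by simp
        also have "\<dots> = b * x" unfolding b(2)[symmetric] s using x(1) b(1) by (simp add: power2_eq_square)
        finally show ?thesis .
      qed
      moreover have "real n * saddle n = b * x"
        using x by (simp add: s x(2) power2_eq_square)
      ultimately show ?thesis by simp
    qed
    have "2 * pi / saddle_width n * (pair_coeff n * exp (- (real n * saddle n)) / tilted_norm n)
        * (tilted_norm n * exp (- (pi\<^sup>2 / (6 * saddle n)))) * (b * sqrt b / (2 * pi))
      = (2 * pi / saddle_width n * (b * sqrt b / (2 * pi))) * pair_coeff n
        * (exp (- (real n * saddle n)) * exp (- (pi\<^sup>2 / (6 * saddle n))))"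
      using tilted_norm_pos[of n] by simp
    also have "2 * pi / saddle_width n * (b * sqrt b / (2 * pi)) = x * sqrt x"
      using b x by (simp add: sw)
    also have "exp (- (real n * saddle n)) * exp (- (pi\<^sup>2 / (6 * saddle n))) = 1 / exp (pi * sqrt (2 * real n / 3))"
      unfolding e by (simp only: exp_add exp_minus inverse_eq_divide times_divide_times_eq mult_1)
    finally show ?case unfolding p by simp
  qed
  ultimately have "(\<lambda>n. pair_coeff n / (real n powr (- (3/4)) * exp (pi * sqrt (2 * real n / 3)))) \<longlonglongrightarrow> C"
    unfolding C_def by (rule Lim_transform_eventually)
  also have "C = 1 / (2 powr (9/4) * 3 powr (1/4))"
  proof (rule power_eq_imp_eq_base)
    have sq4: "sqrt y ^ 4 = y\<^sup>2" if "y \<ge> 0" for y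
      using that by (simp add: power4_eq_xxxx power2_eq_square)
    have "C ^ 4 = (6 / pi)\<^sup>2 * (1 / 2) ^ 4 * (b ^ 4 * b\<^sup>2 / (2 * pi) ^ 4)"
      unfolding C_def using b by (simp only: power_mult_distrib power_divide sq4) (simp add: sq4 power_divide)
    also have "b ^ 4 = (b\<^sup>2)\<^sup>2" by (simp flip: power_mult)
    also have "(6 / pi)\<^sup>2 * (1 / 2) ^ 4 * ((b\<^sup>2)\<^sup>2 * b\<^sup>2 / (2 * pi) ^ 4) = 1 / 1536"
      unfolding b by (simp add: power4_eq_xxxx power2_eq_square)
    finally have 1: "C ^ 4 = 1 / 1536" .
    have "(2 powr (9/4)) ^ 4 = (512 :: real)" "(3 powr (1/4)) ^ 4 = (3 :: real)"
      by (simp_all add: powr_power)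
    then show "C ^ 4 = (1 / (2 powr (9/4) * 3 powr (1/4))) ^ 4"
      unfolding 1 by (simp add: power_divide power_mult_distrib)
    show "0 \<le> C" using b by (simp add: C_def)
  qed simp_all
  finally show ?thesis .
qed

section \<open>Convolution with a sequence of known growth\<close>

text \<open>
  The order of growth of \<open>pair_coeff\<close>; odd unimodal sequences have half the constant.
\<close>
definition growth :: "nat \<Rightarrow> real" where
  "growth n = real n powr (- (3/4)) * exp (pi * sqrt (2 * real n / 3))"

definition growth_const :: real where
  "growth_const = 1 / (2 powr (13/4) * 3 powr (1/4))"

lemma growth_const_pos: "growth_const > 0"
  by (simp add: growth_const_def)

lemma growth_pos: "n > 0 \<Longrightarrow> growth n > 0"
  by (simp add: growth_def)

lemma pi_sqrt_eq: "pi * sqrt (2 * real n / 3) = 2 * (pi / sqrt 6) * sqrt (real n)"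
proof -
  have "sqrt (2 * real n / 3) = sqrt (4 * (real n / 6))" by simp
  also have "\<dots> = 2 * (sqrt (real n) / sqrt 6)" by (simp only: real_sqrt_mult real_sqrt_divide) simp
  finally show ?thesis by simp
qed

lemma peaked_coeff_0_asymptotic:
  assumes p: "(\<lambda>n. pair_coeff n / growth n) \<longlonglongrightarrow> 2 * growth_const"
  shows "(\<lambda>n. peaked_coeff 0 n / growth n) \<longlonglongrightarrow> growth_const"
proof (rule tendsto_sandwich)
  have shift: "(\<lambda>n. growth (n - 2) / growth n) \<longlonglongrightarrow> 1"
  proof -
    have "(\<lambda>n. real (n - 2) powr (- (3/4)) * exp (pi * sqrt (2 * real (n - 2) / 3)) /
        (real n powr (- (3/4)) * exp (pi * sqrt (2 * real n / 3)))) \<longlonglongrightarrow> 1"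
    proof (rule Lim_transform_eventually)
      show "(\<lambda>n. (real n - 2) powr (- (3/4)) * exp (pi * sqrt (2 * (real n - 2) / 3)) /
        (real n powr (- (3/4)) * exp (pi * sqrt (2 * real n / 3)))) \<longlonglongrightarrow> 1"
        by real_asymp
      show "\<forall>\<^sub>F n in sequentially. (real n - 2) powr (- (3/4)) * exp (pi * sqrt (2 * (real n - 2) / 3)) /
        (real n powr (- (3/4)) * exp (pi * sqrt (2 * real n / 3)))
        = real (n - 2) powr (- (3/4)) * exp (pi * sqrt (2 * real (n - 2) / 3)) /
        (real n powr (- (3/4)) * exp (pi * sqrt (2 * real n / 3)))"
        using eventually_ge_at_top[of 2] by eventually_elim (simp add: of_nat_diff)
    qed
    then show ?thesis by (simp add: growth_def)
  qed
  have p2: "(\<lambda>n. pair_coeff (n - 2) / growth (n - 2)) \<longlonglongrightarrow> 2 * growth_const"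
    using p by (rule filterlim_compose) (rule filterlim_minus_const_nat_at_top)
  show "(\<lambda>n. pair_coeff n / growth n / 2) \<longlonglongrightarrow> growth_const"
    using tendsto_divide[OF p tendsto_const[of 2]] by simp
  have "(\<lambda>n. pair_coeff n / growth n - pair_coeff (n - 2) / growth (n - 2) * (growth (n - 2) / growth n) / 2)
      \<longlonglongrightarrow> 2 * growth_const - 2 * growth_const * 1 / 2"
    by (intro tendsto_diff p tendsto_divide tendsto_mult p2 shift tendsto_const) simp
  then show "(\<lambda>n. pair_coeff n / growth n - pair_coeff (n - 2) / growth (n - 2) * (growth (n - 2) / growth n) / 2)
      \<longlonglongrightarrow> growth_const" by simp
  show "\<forall>\<^sub>F n in sequentially. pair_coeff n / growth n / 2 \<le> peaked_coeff 0 n / growth n"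
    using eventually_ge_at_top[of 2]
  proof eventually_elim
    case (elim n)
    have "pair_coeff n / 2 / growth n \<le> peaked_coeff 0 n / growth n"
      using peaked_coeff_0_bounds(1)[OF elim] growth_pos[of n] elim by (intro divide_right_mono) auto
    then show ?case by (simp add: mult.commute)
  qed
  show "\<forall>\<^sub>F n in sequentially. peaked_coeff 0 n / growth n
      \<le> pair_coeff n / growth n - pair_coeff (n - 2) / growth (n - 2) * (growth (n - 2) / growth n) / 2"
    using eventually_ge_at_top[of 4]
  proof eventually_elim
    case (elim n)
    have "pair_coeff (n - 2) \<le> 2 * peaked_coeff 0 (n - 2)"
      using peaked_coeff_0_bounds(1)[of "n - 2"] elim by simp
    then have "peaked_coeff 0 n \<le> pair_coeff n - pair_coeff (n - 2) / 2"
      using peaked_coeff_0_bounds(2)[of n] elim by simp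
    then have "peaked_coeff 0 n / growth n \<le> (pair_coeff n - pair_coeff (n - 2) / 2) / growth n"
      using growth_pos[of n] elim by (intro divide_right_mono) auto
    also have "\<dots> = pair_coeff n / growth n - pair_coeff (n - 2) / growth (n - 2) * (growth (n - 2) / growth n) / 2"
      using growth_pos[of "n - 2"] elim by (simp add: diff_divide_distrib)
    finally show ?case .
  qed
qed

lemma sqrt_diff_upper:
  fixes x y :: real
  assumes "0 \<le> y" "y \<le> x" "0 < x"
  shows "sqrt (x - y) \<le> sqrt x - y / (2 * sqrt x)"
proof (rule real_le_lsqrt)
  have "y / (2 * sqrt x) \<le> x / (2 * sqrt x)" using assms by (intro divide_right_mono) auto
  also have "\<dots> = sqrt x / 2" using assms by (simp add: real_div_sqrt)
  also have "\<dots> \<le> sqrt x" using assms by simp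
  finally show "0 \<le> sqrt x - y / (2 * sqrt x)" by simp
  have "(sqrt x - y / (2 * sqrt x))\<^sup>2 = x - y + (y / (2 * sqrt x))\<^sup>2"
    using assms by (simp add: power2_diff)
  then show "x - y \<le> (sqrt x - y / (2 * sqrt x))\<^sup>2" by simp
qed

lemma sqrt_diff_lower:
  fixes x y :: real
  assumes "0 \<le> y" "y \<le> x" "0 < x"
  shows "sqrt x - y / (2 * sqrt x) - y\<^sup>2 / (2 * (sqrt x)^3) \<le> sqrt (x - y)"
proof -
  define s where "s = sqrt x"
  define z where "z = y / x"
  have s: "s > 0" "s\<^sup>2 = x" using assms by (simp_all add: s_def)
  have z: "0 \<le> z" "z \<le> 1" using assms by (simp_all add: z_def)
  \<comment> \<open>\<open>(1 - z)(1 + z/2) = 1 - z/2 - z\<^sup>2/2\<close>, the claimed expansion of \<open>\<surd>(1 - z)\<close>\<close>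
  have "((1 - z) * (1 + z / 2))\<^sup>2 \<le> 1 - z"
  proof -
    have "(1 - z) * (1 + z / 2)\<^sup>2 \<le> 1"
    proof -
      have "1 - (1 - z) * (1 + z / 2)\<^sup>2 = z\<^sup>2 * (3 + z) / 4"
        by (simp add: power2_eq_square field_simps)
      also have "\<dots> \<ge> 0" using z by simp
      finally show ?thesis by simp
    qed
    from mult_left_mono[OF this, of "1 - z"] z show ?thesis
      by (simp add: power_mult_distrib power2_eq_square mult_ac)
  qed
  then have "(1 - z) * (1 + z / 2) \<le> sqrt (1 - z)" by (rule real_le_rsqrt)
  then have "s * ((1 - z) * (1 + z / 2)) \<le> s * sqrt (1 - z)" using s by (intro mult_left_mono) auto
  also have "s * sqrt (1 - z) = sqrt (x * (1 - z))" by (simp add: real_sqrt_mult s_def)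
  also have "x * (1 - z) = x - y" using assms by (simp add: z_def algebra_simps)
  also have "s * ((1 - z) * (1 + z / 2)) = s - y / (2 * s) - y\<^sup>2 / (2 * s^3)"
    using s(1) unfolding z_def s(2)[symmetric]
    by (simp add: field_simps power2_eq_square power3_eq_cube)
  finally show ?thesis by (simp add: s_def)
qed

lemma peaked_coeff_nonneg: "0 \<le> peaked_coeff r n"
proof -
  have "fps_nonneg (\<Sum>k<n. fps_X ^ (2*k+1) * (odd_pairs_gf (Suc k) * hom_gf (Suc k) r))"
    by (intro fps_nonneg_sum fps_nonneg_mult) auto
  then show ?thesis by (simp add: fps_nonneg_def peaked_coeff_def)
qed

context
  fixes u :: "nat \<Rightarrow> real" and \<kappa> :: real
  assumes \<kappa>: "\<kappa> > 0" and u0: "\<And>n. u n \<ge> 0"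
    and u: "(\<lambda>n. u n / growth n) \<longlonglongrightarrow> \<kappa>"
begin

lemma growth_sequence_upper:
  obtains M where "M > 0"
    "\<And>n k. n > 0 \<Longrightarrow> k \<le> n \<Longrightarrow> u (n - k) \<le> M * exp (pi * sqrt (2 * real n / 3)) * exp (- (real k * saddle n))"
proof -
  have "Bseq (\<lambda>n. u n / growth n)" using u by (intro convergent_imp_Bseq convergentI)
  then obtain D where D: "D > 0" "\<And>n. \<bar>u n / growth n\<bar> \<le> D" by (auto simp: Bseq_def)
  define M where "M = max D (u 0)"
  have M: "u m \<le> M * exp (pi * sqrt (2 * real m / 3))" for m
  proof (cases "m = 0")
    case False
    have "real m powr (- (3/4)) \<le> real m powr 0" using False by (intro powr_mono) auto
    then have g: "growth m \<le> exp (pi * sqrt (2 * real m / 3))"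
      using False by (simp add: growth_def)
    have "u m \<le> D * growth m"
      using D(2)[of m] growth_pos[of m] False by (simp add: abs_le_iff field_simps)
    also have "\<dots> \<le> M * exp (pi * sqrt (2 * real m / 3))"
      using D(1) g growth_pos[of m] False by (intro mult_mono) (auto simp: M_def less_imp_le)
    finally show ?thesis .
  qed (simp add: M_def)
  show ?thesis
  proof (rule that[of M])
    show Mpos: "M > 0" using D(1) by (simp add: M_def)
    fix n k :: nat assume nk: "n > 0" "k \<le> n"
    have "u (n - k) \<le> M * exp (2 * (pi / sqrt 6) * sqrt (real (n - k)))"
      using M[of "n - k"] unfolding pi_sqrt_eq .
    also have "\<dots> \<le> M * exp (2 * (pi / sqrt 6) * (sqrt (real n) - real k / (2 * sqrt (real n))))"
      using sqrt_diff_upper[of "real k" "real n"] nk Mpos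
      by (intro mult_left_mono iffD2[OF exp_le_cancel_iff]) (auto simp: of_nat_diff)
    also have "2 * (pi / sqrt 6) * (sqrt (real n) - real k / (2 * sqrt (real n)))
        = 2 * (pi / sqrt 6) * sqrt (real n) + - (real k * saddle n)"
      by (simp add: saddle_def real_sqrt_mult algebra_simps)
    finally show "u (n - k) \<le> M * exp (pi * sqrt (2 * real n / 3)) * exp (- (real k * saddle n))"
      by (simp only: exp_add pi_sqrt_eq mult.assoc)
  qed
qed

text \<open>
  With \<open>k \<le> n\<^bsup>3/5\<^esup>\<close> the second-order term \<open>k\<^sup>2/n\<^bsup>3/2\<^esup>\<close> of \<open>\<surd>(n - k)\<close> still tends to zero, while beyond this range \<open>kt\<close> is
  at least of order \<open>n\<^bsup>1/10\<^esup>\<close> and swamps every power of \<open>n\<close>. Any exponent between \<open>1/2\<close> and \<open>3/4\<close> would do.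
\<close>
lemma growth_sequence_local:
  assumes "\<epsilon> > 0"
  shows "\<forall>\<^sub>F n in sequentially. \<forall>k. real k \<le> real n powr (3/5) \<longrightarrow>
    \<bar>u (n - k) - \<kappa> * growth n * exp (- (real k * saddle n))\<bar> \<le> \<epsilon> * (\<kappa> * growth n * exp (- (real k * saddle n)))"
proof -
  define c where "c = 2 * (pi / sqrt 6)"
  have c: "c > 0" by (simp add: c_def)
  define lo where "lo = (\<lambda>n::nat. exp (- (c * (real n powr (3/5))\<^sup>2 / (2 * (sqrt (real n))^3))))"
  define hi where "hi = (\<lambda>n::nat. ((real n - real n powr (3/5)) / real n) powr (- (3/4)))"
  \<comment> \<open>small enough for \<open>1 - \<epsilon> \<le> (1 - \<delta>)\<^sup>2\<close> and \<open>(1 + \<delta>)\<^sup>2 \<le> 1 + \<epsilon>\<close>\<close>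
  define \<delta> where "\<delta> = min (\<epsilon> / 4) (1 / 4)"
  have \<delta>: "0 < \<delta>" "\<delta> \<le> 1/4" "\<delta> \<le> \<epsilon> / 4" using assms by (simp_all add: \<delta>_def)
  have "lo \<longlonglongrightarrow> 1" unfolding lo_def using c by real_asymp
  then have lo: "\<forall>\<^sub>F n in sequentially. 1 - \<delta> < lo n" by (rule order_tendstoD) (use \<delta> in simp)
  have "hi \<longlonglongrightarrow> 1" unfolding hi_def by real_asymp
  then have hi: "\<forall>\<^sub>F n in sequentially. hi n < 1 + \<delta>" by (rule order_tendstoD) (use \<delta> in simp)
  have "\<forall>\<^sub>F n in sequentially. dist (u n / growth n) \<kappa> < \<delta> * \<kappa>"
    using u \<delta> \<kappa> by (intro tendstoD) auto
  then obtain N where N: "\<And>m. m \<ge> N \<Longrightarrow> dist (u m / growth m) \<kappa> < \<delta> * \<kappa>"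
    by (auto simp: eventually_sequentially)
  have "filterlim (\<lambda>n. real n - real n powr (3/5)) at_top sequentially" by real_asymp
  then have "\<forall>\<^sub>F n in sequentially. real (Suc N) \<le> real n - real n powr (3/5)"
    by (rule filterlim_at_top[THEN iffD1, rule_format])
  then show ?thesis using lo hi eventually_gt_at_top[of 0]
  proof eventually_elim
    case (elim n)
    show ?case
    proof (intro allI impI)
      fix k assume k: "real k \<le> real n powr (3/5)"
      have kn: "k < n" "Suc N \<le> n - k" using elim k by linarith+
      define m where "m = n - k"
      have m: "real m = real n - real k" "m \<ge> N" "m > 0" using kn by (auto simp: m_def)
      define E where "E = exp (- (real k * saddle n))"
      define w where "w = u m / growth m"
      have w: "(1 - \<delta>) * \<kappa> \<le> w" "w \<le> (1 + \<delta>) * \<kappa>"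
        using N[OF m(2)] by (auto simp: w_def dist_real_def abs_less_iff algebra_simps)
      define P where "P = (real m / real n) powr (- (3/4))"
      have P: "1 \<le> P" "P \<le> 1 + \<delta>"
      proof -
        have "(real m / real n) powr 0 \<le> P" unfolding P_def
          using m kn by (intro powr_mono') auto
        then show "1 \<le> P" using m elim by simp
        have "P \<le> hi n" unfolding P_def hi_def
          using m k elim kn by (intro powr_mono2' divide_right_mono) (auto simp: divide_pos_pos)
        then show "P \<le> 1 + \<delta>" using elim by simp
      qed
      define Q where "Q = exp (c * (sqrt (real m) - sqrt (real n) + real k / (2 * sqrt (real n))))"
      have Q: "1 - \<delta> \<le> Q" "Q \<le> 1"
      proof -
        have "c * (sqrt (real m) - sqrt (real n) + real k / (2 * sqrt (real n))) \<le> 0"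
          using sqrt_diff_upper[of "real k" "real n"] kn m c by (intro mult_nonneg_nonpos) auto
        then show "Q \<le> 1" by (simp add: Q_def)
        have "- ((real k)\<^sup>2 / (2 * (sqrt (real n))^3)) \<le> sqrt (real m) - sqrt (real n) + real k / (2 * sqrt (real n))"
          using sqrt_diff_lower[of "real k" "real n"] kn m by simp
        moreover have "(real k)\<^sup>2 / (2 * (sqrt (real n))^3) \<le> (real n powr (3/5))\<^sup>2 / (2 * (sqrt (real n))^3)"
          using k by (intro divide_right_mono power_mono) auto
        ultimately have "- ((real n powr (3/5))\<^sup>2 / (2 * (sqrt (real n))^3)) \<le> sqrt (real m) - sqrt (real n) + real k / (2 * sqrt (real n))"
          by linarith
        from mult_left_mono[OF this, of c] c
        have "lo n \<le> Q" unfolding lo_def Q_def by simp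
        then show "1 - \<delta> \<le> Q" using elim by simp
      qed
      have gm: "growth m = growth n * E * (P * Q)"
      proof -
        have 1: "real m powr (- (3/4)) = real n powr (- (3/4)) * P"
          unfolding P_def using m elim by (simp add: powr_divide)
        have "c * sqrt (real m) = c * sqrt (real n) + (- (real k * saddle n)) + c * (sqrt (real m) - sqrt (real n) + real k / (2 * sqrt (real n)))"
          by (simp add: c_def saddle_def real_sqrt_mult algebra_simps)
        then have 2: "exp (c * sqrt (real m)) = exp (c * sqrt (real n)) * E * Q"
          unfolding E_def Q_def by (simp only: exp_add)
        show ?thesis unfolding growth_def pi_sqrt_eq c_def[symmetric] 1 2 by simp
      qed
      have "u m = w * growth m" using growth_pos[OF m(3)] by (simp add: w_def)
      then have um: "u m = growth n * E * (w * (P * Q))" unfolding gm by (simp only: mult_ac)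
      have lower: "(1 - \<epsilon>) * \<kappa> \<le> w * (P * Q)"
      proof -
        have "(1 - \<delta>) * 1 * (1 - \<delta>) \<le> 1 * (P * Q) * 1 * (1 - \<delta>)" 
          using mult_mono[of 1 P "1 - \<delta>" Q] P Q \<delta> by (intro mult_right_mono) auto
        then have "(1 - \<delta>) * (1 - \<delta>) * \<kappa> \<le> (P * Q) * ((1 - \<delta>) * \<kappa>)"
          using \<kappa> by (simp add: mult_right_mono mult.assoc[symmetric])
        also have "\<dots> \<le> (P * Q) * w" using w P Q \<delta> by (intro mult_left_mono) auto
        finally have "(1 - \<delta>) * (1 - \<delta>) * \<kappa> \<le> w * (P * Q)" by (simp add: mult_ac)
        moreover have "1 - \<epsilon> \<le> (1 - \<delta>) * (1 - \<delta>)" using \<delta> assms by (simp add: algebra_simps) (smt (verit) zero_le_square)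
        ultimately show ?thesis using \<kappa> mult_right_mono[of "1 - \<epsilon>" "(1 - \<delta>) * (1 - \<delta>)" \<kappa>] by linarith
      qed
      have upper: "w * (P * Q) \<le> (1 + \<epsilon>) * \<kappa>"
      proof -
        have w0: "0 \<le> w" using w(1) \<kappa> \<delta> mult_nonneg_nonneg[of "1 - \<delta>" \<kappa>] by linarith
        have "P * Q \<le> (1 + \<delta>) * 1" using P Q \<delta> by (intro mult_mono) auto
        then have "w * (P * Q) \<le> ((1 + \<delta>) * \<kappa>) * ((1 + \<delta>) * 1)"
          using w w0 P Q \<delta> \<kappa> by (intro mult_mono) auto
        also have "\<dots> = (1 + \<delta>) * (1 + \<delta>) * \<kappa>" by simp
        also have "\<dots> \<le> (1 + \<epsilon>) * \<kappa>"
        proof (rule mult_right_mono)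
          have "(1 + \<delta>) * (1 + \<delta>) = 1 + 2 * \<delta> + \<delta> * \<delta>" by (simp add: algebra_simps)
          moreover have "\<delta> * \<delta> \<le> 1 * \<delta>" using \<delta> by (intro mult_right_mono) auto
          ultimately show "(1 + \<delta>) * (1 + \<delta>) \<le> 1 + \<epsilon>" using \<delta> assms by linarith
        qed (use \<kappa> in simp)
        finally show ?thesis .
      qed
      have gE: "growth n * E > 0" using growth_pos[of n] elim by (simp add: E_def)
      have "\<bar>w * (P * Q) - \<kappa>\<bar> \<le> \<epsilon> * \<kappa>"
        using lower upper by (simp add: abs_le_iff algebra_simps)
      then have "growth n * E * \<bar>w * (P * Q) - \<kappa>\<bar> \<le> growth n * E * (\<epsilon> * \<kappa>)"
        using gE by (intro mult_left_mono) auto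
      moreover have "u m - \<kappa> * growth n * E = growth n * E * (w * (P * Q) - \<kappa>)"
        unfolding um by (simp add: algebra_simps)
      ultimately show "\<bar>u (n - k) - \<kappa> * growth n * exp (- (real k * saddle n))\<bar>
          \<le> \<epsilon> * (\<kappa> * growth n * exp (- (real k * saddle n)))"
        unfolding E_def[symmetric] m_def[symmetric]
        using abs_mult[of "growth n * E" "w * (P * Q) - \<kappa>", unfolded abs_of_pos[OF gE]]
        by (simp only: mult_ac)
    qed
  qed
qed

text \<open>
  The weights \<open>a\<close> may change with \<open>n\<close>: the bound on their exponential sums is uniform in \<open>n\<close>, which covers both the
  homogeneous sums in \<open>n\<close> variables as well as those in a fixed number of variables. In the tail \<open>k > n\<^bsup>3/5\<^esup>\<close> half of the decay \<open>e\<^bsup>-kt\<^esup>\<close>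
  is spent on beating the polynomial loss of \<open>growth_sequence_upper\<close>, the other half on summing the weights.
\<close>
lemma growth_sequence_convolution:
  fixes a :: "nat \<Rightarrow> nat \<Rightarrow> real" and r :: nat and C :: real
  assumes a0: "\<And>n k. 0 \<le> a n k"
    and aC: "\<And>n s. s > 0 \<Longrightarrow> s ^ (2*r) * (\<Sum>k\<le>n. a n k * exp (- (real k * s))) \<le> C"
  shows "(\<lambda>n. saddle n ^ (2*r) * (\<Sum>k\<le>n. a n k * u (n - k)) / (\<kappa> * growth n)
      - saddle n ^ (2*r) * (\<Sum>k\<le>n. a n k * exp (- (real k * saddle n)))) \<longlonglongrightarrow> 0"
proof -
  obtain M where M: "M > 0"
    "\<And>n k. n > 0 \<Longrightarrow> k \<le> n \<Longrightarrow> u (n - k) \<le> M * exp (pi * sqrt (2 * real n / 3)) * exp (- (real k * saddle n))"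
    by (rule growth_sequence_upper) blast
  have C0: "0 \<le> C" 
  proof -
    have "0 \<le> 1 ^ (2*r) * (\<Sum>k\<le>0. a 0 k * exp (- (real k * 1)))" using a0 by simp
    also have "\<dots> \<le> C" by (rule aC) simp
    finally show ?thesis .
  qed
  define F where "F = (\<lambda>n::nat. real n powr (3/5) * saddle n / 2)"
  define R where "R = (\<lambda>n::nat. (M / \<kappa> * real n powr (3/4) + 1) * exp (- F n) * (4 ^ r * C))"
  have R0: "R \<longlonglongrightarrow> 0"
  proof -
    have "(\<lambda>n. real n powr (3/4) * exp (- (real n powr (3/5) * (pi / sqrt (6 * real n)) / 2))) \<longlonglongrightarrow> 0"
      by real_asymp
    moreover have "(\<lambda>n. exp (- (real n powr (3/5) * (pi / sqrt (6 * real n)) / 2))) \<longlonglongrightarrow> 0"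
      by real_asymp
    ultimately have "(\<lambda>n. (M / \<kappa> * (real n powr (3/4) * exp (- F n)) + exp (- F n)) * (4 ^ r * C))
        \<longlonglongrightarrow> (M / \<kappa> * 0 + 0) * (4 ^ r * C)"
      unfolding F_def saddle_def by (intro tendsto_mult tendsto_add tendsto_const)
    then show ?thesis by (simp add: R_def algebra_simps)
  qed
  show ?thesis
  proof (rule LIMSEQ_I, goal_cases)
    case (1 e)
    define \<epsilon> where "\<epsilon> = e / (2 * (C + 1))"
    have \<epsilon>: "\<epsilon> > 0" "\<epsilon> * C < e / 2"
      using 1 C0 by (auto simp: \<epsilon>_def field_simps)
    have "\<forall>\<^sub>F n in sequentially. R n < e / 2"
      using R0 by (rule order_tendstoD) (use 1 in simp)
    with growth_sequence_local[OF \<epsilon>(1)] have "\<forall>\<^sub>F n in sequentially.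
        norm (saddle n ^ (2*r) * (\<Sum>k\<le>n. a n k * u (n - k)) / (\<kappa> * growth n)
          - saddle n ^ (2*r) * (\<Sum>k\<le>n. a n k * exp (- (real k * saddle n))) - 0) < e"
      using eventually_gt_at_top[of 0]
    proof eventually_elim
      case (elim n)
      define t where "t = saddle n"
      define G where "G = \<kappa> * growth n"
      have t: "t > 0" using elim saddle_pos by (simp add: t_def)
      have G: "G > 0" using elim growth_pos[of n] \<kappa> by (simp add: G_def)
      have expG: "exp (pi * sqrt (2 * real n / 3)) = real n powr (3/4) * growth n"
        using elim by (simp add: growth_def powr_minus)
      define T where "T = (M / \<kappa> * real n powr (3/4) + 1) * exp (- F n)"
      have T0: "T \<ge> 0" using M \<kappa> by (simp add: T_def)
      have termwise: "\<bar>u (n - k) / G - exp (- (real k * t))\<bar> \<le> \<epsilon> * exp (- (real k * t)) + T * exp (- (real k * (t / 2)))"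
        if "k \<le> n" for k
      proof (cases "real k \<le> real n powr (3/5)")
        case True
        then have "\<bar>u (n - k) - G * exp (- (real k * t))\<bar> \<le> \<epsilon> * (G * exp (- (real k * t)))"
          using elim(1) by (simp add: G_def t_def)
        then have "\<bar>u (n - k) - G * exp (- (real k * t))\<bar> / G \<le> \<epsilon> * (G * exp (- (real k * t))) / G"
          using G by (intro divide_right_mono) auto
        also have "\<bar>u (n - k) - G * exp (- (real k * t))\<bar> / G = \<bar>(u (n - k) - G * exp (- (real k * t))) / G\<bar>"
          using G by (simp only: abs_divide abs_of_pos)
        also have "(u (n - k) - G * exp (- (real k * t))) / G = u (n - k) / G - exp (- (real k * t))"
          using G by (simp add: diff_divide_distrib)
        finally show ?thesis using G T0 by (simp add: add_increasing2)
      next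
        case False
        have "F n \<le> real k * (t / 2)" using False t by (simp add: F_def t_def mult_right_mono)
        then have eF: "exp (- (real k * t)) \<le> exp (- F n) * exp (- (real k * (t / 2)))"
          by (simp flip: exp_add)
        have "u (n - k) / G \<le> M * exp (pi * sqrt (2 * real n / 3)) * exp (- (real k * t)) / G"
          using M(2)[of n k] elim that G by (intro divide_right_mono) (auto simp: t_def)
        also have "\<dots> = M / \<kappa> * real n powr (3/4) * exp (- (real k * t))"
          unfolding expG G_def using growth_pos[of n] elim \<kappa> by simp
        finally have "\<bar>u (n - k) / G - exp (- (real k * t))\<bar> \<le> M / \<kappa> * real n powr (3/4) * exp (- (real k * t)) + exp (- (real k * t))"
          using u0[of "n - k"] G by (simp add: abs_le_iff) (smt (verit) exp_gt_zero divide_nonneg_pos)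
        also have "\<dots> = (M / \<kappa> * real n powr (3/4) + 1) * exp (- (real k * t))" by (simp add: algebra_simps)
        also have "\<dots> \<le> (M / \<kappa> * real n powr (3/4) + 1) * (exp (- F n) * exp (- (real k * (t / 2))))"
          using eF M \<kappa> by (intro mult_left_mono) auto
        also have "\<dots> = T * exp (- (real k * (t / 2)))" by (simp add: T_def)
        finally show ?thesis using \<epsilon> by (simp add: add_increasing)
      qed
      have "\<bar>(\<Sum>k\<le>n. a n k * u (n - k)) / G - (\<Sum>k\<le>n. a n k * exp (- (real k * t)))\<bar>
          = \<bar>\<Sum>k\<le>n. a n k * (u (n - k) / G - exp (- (real k * t)))\<bar>"
        by (simp add: sum_divide_distrib sum_subtractf algebra_simps)
      also have "\<dots> \<le> (\<Sum>k\<le>n. a n k * (\<epsilon> * exp (- (real k * t)) + T * exp (- (real k * (t / 2)))))"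
      proof (rule order_trans[OF sum_abs sum_mono])
        fix k assume "k \<in> {..n}"
        then show "\<bar>a n k * (u (n - k) / G - exp (- (real k * t)))\<bar>
            \<le> a n k * (\<epsilon> * exp (- (real k * t)) + T * exp (- (real k * (t / 2))))"
          using termwise[of k] a0[of n k] by (simp add: abs_mult mult_left_mono)
      qed
      also have "\<dots> = \<epsilon> * (\<Sum>k\<le>n. a n k * exp (- (real k * t))) + T * (\<Sum>k\<le>n. a n k * exp (- (real k * (t / 2))))"
        by (simp add: sum_distrib_left sum.distrib algebra_simps)
      finally have main: "\<bar>(\<Sum>k\<le>n. a n k * u (n - k)) / G - (\<Sum>k\<le>n. a n k * exp (- (real k * t)))\<bar> \<le> \<dots>" .
      have "t ^ (2*r) * \<bar>(\<Sum>k\<le>n. a n k * u (n - k)) / G - (\<Sum>k\<le>n. a n k * exp (- (real k * t)))\<bar>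
          \<le> t ^ (2*r) * (\<epsilon> * (\<Sum>k\<le>n. a n k * exp (- (real k * t))) + T * (\<Sum>k\<le>n. a n k * exp (- (real k * (t / 2)))))"
        using main t by (intro mult_left_mono) auto
      also have "\<dots> = \<epsilon> * (t ^ (2*r) * (\<Sum>k\<le>n. a n k * exp (- (real k * t))))
          + T * (4 ^ r * ((t / 2) ^ (2*r) * (\<Sum>k\<le>n. a n k * exp (- (real k * (t / 2))))))"
      proof -
        have "(4 :: real) ^ r = 2 ^ (2 * r)" by (simp add: power_mult)
        then have "4 ^ r * (t / 2) ^ (2*r) = t ^ (2*r)" by (simp add: power_divide)
        then have "t ^ (2*r) * S = 4 ^ r * ((t / 2) ^ (2*r) * S)" for S by (simp only: mult.assoc[symmetric])
        then have "t ^ (2*r) * (\<epsilon> * S1 + T * S) = \<epsilon> * (t ^ (2*r) * S1) + T * (4 ^ r * ((t / 2) ^ (2*r) * S))" for S S1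
          by (metis distrib_left mult.left_commute)
        then show ?thesis .
      qed
      also have "\<dots> \<le> \<epsilon> * C + T * (4 ^ r * C)"
        using aC[of t n] aC[of "t / 2" n] t T0 \<epsilon> by (intro add_mono mult_left_mono) auto
      also have "T * (4 ^ r * C) = R n" by (simp add: T_def R_def)
      also have "\<epsilon> * C + R n < e" using \<epsilon> elim by linarith
      finally have fin: "t ^ (2*r) * \<bar>(\<Sum>k\<le>n. a n k * u (n - k)) / G - (\<Sum>k\<le>n. a n k * exp (- (real k * t)))\<bar> < e" .
      have "norm (x * A / B - x * D - 0) = x * \<bar>A / B - D\<bar>" if "x \<ge> 0" for x A B D :: real
        using that abs_mult[of x "A / B - D"] by (simp add: right_diff_distrib)
      then show ?case using fin t by (simp add: G_def t_def)
    qed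
    then show ?case by (simp add: eventually_sequentially)
  qed
qed

end

section \<open>Complete homogeneous sums near the singularity\<close>

lemma sums_mult_nonneg_fps:
  fixes q :: real
  assumes "fps_nonneg f" "fps_nonneg g" "0 \<le> q"
    and f: "(\<lambda>k. f $ k * q ^ k) sums v" and g: "(\<lambda>k. g $ k * q ^ k) sums w"
  shows "(\<lambda>k. (f * g) $ k * q ^ k) sums (v * w)"
proof -
  have nn: "norm (h $ k * q ^ k) = h $ k * q ^ k" if "fps_nonneg h" for h k
    using that assms(3) by (simp add: fps_nonneg_def abs_mult)
  have "(\<lambda>k. \<Sum>i\<le>k. (f $ i * q ^ i) * (g $ (k - i) * q ^ (k - i))) sums
      ((\<Sum>k. f $ k * q ^ k) * (\<Sum>k. g $ k * q ^ k))"
    by (rule Cauchy_product_sums)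
       (simp_all only: nn[OF assms(1)] nn[OF assms(2)] sums_summable[OF f] sums_summable[OF g])
  also have "(\<lambda>k. \<Sum>i\<le>k. (f $ i * q ^ i) * (g $ (k - i) * q ^ (k - i))) = (\<lambda>k. (f * g) $ k * q ^ k)"
  proof
    fix k
    have "(\<Sum>i\<le>k. (f $ i * q ^ i) * (g $ (k - i) * q ^ (k - i))) = (\<Sum>i\<le>k. f $ i * g $ (k - i) * q ^ k)"
    proof (rule sum.cong[OF refl])
      fix i assume "i \<in> {..k}"
      then have "q ^ k = q ^ i * q ^ (k - i)" by (simp flip: power_add)
      then show "(f $ i * q ^ i) * (g $ (k - i) * q ^ (k - i)) = f $ i * g $ (k - i) * q ^ k" by simp
    qed
    then show "(\<Sum>i\<le>k. (f $ i * q ^ i) * (g $ (k - i) * q ^ (k - i))) = (f * g) $ k * q ^ k"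
      by (simp add: fps_mult_nth sum_distrib_right atLeast0AtMost)
  qed
  finally show ?thesis using f g by (simp add: sums_iff)
qed

lemma geo_fps_sums:
  fixes q :: real
  assumes "c > 0" "0 \<le> q" "q < 1"
  shows "(\<lambda>k. geo_fps c $ k * q ^ k) sums (1 / (1 - q ^ c))"
proof -
  have qc: "norm (q ^ c) < 1" using assms by (simp add: power_less_one_iff)
  have "(\<lambda>j. (q ^ c) ^ j) sums (1 / (1 - q ^ c))" by (rule geometric_sums[OF qc])
  also have "(\<lambda>j. (q ^ c) ^ j) = (\<lambda>j. geo_fps c $ (c * j) * q ^ (c * j))"
    by (simp add: geo_fps_def power_mult)
  finally have "(\<lambda>j. geo_fps c $ (c * j) * q ^ (c * j)) sums (1 / (1 - q ^ c))" .
  then show ?thesis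
  proof (subst (asm) sums_mono_reindex)
    show "strict_mono (\<lambda>j. c * j)" using assms by (simp add: strict_mono_def)
    show "geo_fps c $ n * q ^ n = 0" if "n \<notin> range (\<lambda>j. c * j)" for n
      using that by (auto simp: geo_fps_def elim!: dvdE)
  qed
qed

lemma X_power_sums: "(\<lambda>k. (fps_X ^ c :: real fps) $ k * q ^ k) sums (q ^ c)"
proof -
  have "(\<lambda>k. (fps_X ^ c :: real fps) $ k * q ^ k) = (\<lambda>k. if k = c then q ^ k else 0)" by auto
  then show ?thesis using sums_single[of c "\<lambda>k. q ^ k"] by simp
qed

text \<open>
  Complete homogeneous symmetric polynomial of degree \<open>r\<close> in the real numbers \<open>f 0, \<dots>, f (K - 1)\<close>.
\<close>
fun hom_sum :: "(nat \<Rightarrow> real) \<Rightarrow> nat \<Rightarrow> nat \<Rightarrow> real" where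
  "hom_sum f K 0 = 1"
| "hom_sum f 0 (Suc r) = 0"
| "hom_sum f (Suc K) (Suc r) = hom_sum f K (Suc r) + f K * hom_sum f (Suc K) r"

lemma hom_gf_sums:
  fixes q :: real
  assumes "0 \<le> q" "q < 1"
  shows "(\<lambda>k. hom_gf K r $ k * q ^ k) sums hom_sum (\<lambda>i. q ^ (2*i+1) / (1 - q ^ (2*i+1))\<^sup>2) K r"
proof (induction K r rule: hom_gf.induct)
  case (1 K)
  show ?case using X_power_sums[of 0 q] by simp
next
  case (2 r)
  then show ?case by simp
next
  case (3 K r)
  let ?c = "2 * K + 1"
  have g: "(\<lambda>k. geo_fps ?c $ k * q ^ k) sums (1 / (1 - q ^ ?c))"
    by (rule geo_fps_sums) (use assms in auto)
  have g2: "(\<lambda>k. ((geo_fps ?c)\<^sup>2) $ k * q ^ k) sums (1 / (1 - q ^ ?c) * (1 / (1 - q ^ ?c)))"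
    unfolding power2_eq_square by (intro sums_mult_nonneg_fps g assms) auto
  have x: "(\<lambda>k. (fps_X ^ ?c * (geo_fps ?c)\<^sup>2) $ k * q ^ k) sums (q ^ ?c * (1 / (1 - q ^ ?c) * (1 / (1 - q ^ ?c))))"
    by (intro sums_mult_nonneg_fps g2 X_power_sums assms fps_nonneg_power2) auto
  have "(\<lambda>k. (fps_X ^ ?c * (geo_fps ?c)\<^sup>2 * hom_gf (Suc K) r) $ k * q ^ k)
     sums (q ^ ?c * (1 / (1 - q ^ ?c) * (1 / (1 - q ^ ?c))) * hom_sum (\<lambda>i. q ^ (2*i+1) / (1 - q ^ (2*i+1))\<^sup>2) (Suc K) r)"
    by (rule sums_mult_nonneg_fps[OF _ _ assms(1) x 3(2)]) (auto intro!: fps_nonneg_mult fps_nonneg_power2)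
  from sums_add[OF 3(1) this] show ?case
    by (simp only: hom_gf.simps hom_sum.simps fps_add_nth distrib_right)
       (simp add: power2_eq_square)
qed

lemma hom_sum_nonneg:
  assumes "\<And>i. 0 \<le> f i"
  shows "0 \<le> hom_sum f K r"
  by (induction K r rule: hom_gf.induct) (use assms in auto)

lemma hom_sum_mono:
  assumes "\<And>i. 0 \<le> f i" "\<And>i. f i \<le> g i"
  shows "hom_sum f K r \<le> hom_sum g K r"
proof (induction K r rule: hom_gf.induct)
  case (3 K r)
  have "f K * hom_sum f (Suc K) r \<le> g K * hom_sum g (Suc K) r"
    using 3(2) hom_sum_nonneg[of f, OF assms(1)] assms order_trans[OF assms]
    by (intro mult_mono) auto
  then show ?case using 3(1) by simp
qed auto

lemma hom_sum_scale: "hom_sum (\<lambda>i. x * f i) K r = x ^ r * hom_sum f K r"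
  by (induction K r rule: hom_gf.induct) (simp_all add: algebra_simps)

lemma hom_sum_incseq:
  assumes "\<And>i. 0 \<le> f i"
  shows "incseq (\<lambda>K. hom_sum f K r)"
proof (rule incseq_SucI)
  show "hom_sum f K r \<le> hom_sum f (Suc K) r" for K
    using assms hom_sum_nonneg[of f "Suc K"] by (cases r) auto
qed

lemma hom_sum_le_power:
  assumes "\<And>i. 0 \<le> f i" "\<And>K. (\<Sum>i<K. f i) \<le> B"
  shows "hom_sum f K r \<le> B ^ r"
proof (induction r arbitrary: K)
  case (Suc r)
  have B: "0 \<le> B" using assms(2)[of 0] by simp
  have "hom_sum f K (Suc r) \<le> (\<Sum>i<K. f i) * B ^ r" for K
  proof (induction K)
    case (Suc K)
    have "f K * hom_sum f (Suc K) r \<le> f K * B ^ r"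
      using Suc.IH \<open>\<And>K. hom_sum f K r \<le> B ^ r\<close> assms(1) by (intro mult_left_mono) auto
    then show ?case using Suc by (simp add: algebra_simps)
  qed simp
  also have "(\<Sum>i<K. f i) * B ^ r \<le> B * B ^ r" using assms(2) B by (intro mult_right_mono) auto
  finally show ?case by simp
qed simp

lemma hom_sum_tendsto:
  assumes "\<And>i. (\<lambda>n. f n i) \<longlonglongrightarrow> g i"
  shows "(\<lambda>n. hom_sum (f n) K r) \<longlonglongrightarrow> hom_sum g K r"
  by (induction K r rule: hom_gf.induct) (auto intro!: tendsto_intros assms)

definition recip_odd_sq :: "nat \<Rightarrow> real" where
  "recip_odd_sq i = 1 / (real (2 * i + 1))\<^sup>2"

lemma recip_odd_sq_pos: "recip_odd_sq i > 0" "0 \<le> recip_odd_sq i"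
  by (simp_all add: recip_odd_sq_def)

lemma sum_recip_odd_sq_le: "(\<Sum>i<K. recip_odd_sq i) \<le> 3"
proof -
  have s: "(\<lambda>k. 1 / (real k + 1)\<^sup>2) sums (pi\<^sup>2 / 6)"
    using inverse_squares_sums by (simp add: add.commute)
  have "(\<Sum>i<K. recip_odd_sq i) \<le> (\<Sum>i<K. 1 / (real i + 1)\<^sup>2)"
    unfolding recip_odd_sq_def by (intro sum_mono divide_left_mono power_mono) auto
  also have "\<dots> \<le> pi\<^sup>2 / 6"
    using sum_le_suminf[OF sums_summable[OF s], of "{..<K}"] s by (simp add: sums_iff)
  also have "\<dots> \<le> 4\<^sup>2 / 6" using pi_less_4 by (intro divide_right_mono power_mono) auto
  finally show ?thesis by simp
qed

definition hom_limit :: "nat \<Rightarrow> real" where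
  "hom_limit r = lim (\<lambda>K. hom_sum recip_odd_sq K r)"

lemma hom_sum_recip_le: "hom_sum recip_odd_sq K r \<le> 3 ^ r"
  by (rule hom_sum_le_power[OF recip_odd_sq_pos(2) sum_recip_odd_sq_le])

lemma hom_limit_tendsto: "(\<lambda>K. hom_sum recip_odd_sq K r) \<longlonglongrightarrow> hom_limit r"
proof -
  have "convergent (\<lambda>K. hom_sum recip_odd_sq K r)"
  proof (rule Bseq_monoseq_convergent)
    show "Bseq (\<lambda>K. hom_sum recip_odd_sq K r)"
      using hom_sum_recip_le hom_sum_nonneg[of recip_odd_sq] recip_odd_sq_pos
      by (intro BseqI'[of _ "3 ^ r"]) auto
    show "monoseq (\<lambda>K. hom_sum recip_odd_sq K r)"
      using hom_sum_incseq[of recip_odd_sq] recip_odd_sq_pos by (auto simp: monoseq_iff)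
  qed
  then show ?thesis by (simp add: convergent_LIMSEQ_iff hom_limit_def)
qed

lemma hom_sum_le_hom_limit: "hom_sum recip_odd_sq K r \<le> hom_limit r"
  by (rule incseq_le[OF hom_sum_incseq hom_limit_tendsto]) (rule recip_odd_sq_pos(2))

lemma hom_limit_pos: "hom_limit r > 0"
proof -
  have "recip_odd_sq 0 = 1" by (simp add: recip_odd_sq_def)
  then have "hom_sum recip_odd_sq 1 r = 1" by (induction r) simp_all
  then show ?thesis using hom_sum_le_hom_limit[of 1 r] by simp
qed

text \<open>
  For \<open>x = c s\<close> this is \<open>x \<le> 2 sinh (x/2)\<close>. It makes the limiting values upper bounds as well, uniformly in the
  number of parts.
\<close>
lemma exp_over_square_le:
  fixes s :: real and c :: nat
  assumes "s > 0" "c > 0"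
  shows "s\<^sup>2 * (exp (- s) ^ c / (1 - exp (- s) ^ c)\<^sup>2) \<le> 1 / (real c)\<^sup>2"
proof -
  define x where "x = real c * s"
  have x: "x > 0" using assms by (simp add: x_def)
  have e: "exp (- s) ^ c = exp (- x)" by (simp add: x_def flip: exp_of_nat_mult)
  have lt: "exp (- x) < 1" using x by simp
  have "x \<le> exp (x / 2) - exp (- (x / 2))"
  proof -
    have "\<exists>l z. 0 < z \<and> z < x / 2 \<and> True \<and> (exp (x/2) - exp (- (x/2))) - (exp 0 - exp (- 0)) = (x / 2 - 0) * (exp z + exp (- z))"
      using MVT2[of 0 "x / 2" "\<lambda>y. exp y - exp (- y)" "\<lambda>y. exp y + exp (- y)"] x
      by (fastforce intro!: derivative_eq_intros)
    then obtain z where z: "exp (x/2) - exp (- (x/2)) = x / 2 * (exp z + exp (- z))" by auto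
    have "2 \<le> exp z + exp (- z)" using cosh_real_ge_1[of z] by (simp add: cosh_def)
    then have "x / 2 * 2 \<le> x / 2 * (exp z + exp (- z))" using x by (intro mult_left_mono) auto
    then show ?thesis using z by simp
  qed
  then have "x * exp (- (x / 2)) \<le> (exp (x / 2) - exp (- (x / 2))) * exp (- (x / 2))"
    by (intro mult_right_mono) auto
  also have "\<dots> = 1 - exp (- x)" by (simp add: left_diff_distrib flip: exp_add)
  finally have "(x * exp (- (x / 2)))\<^sup>2 \<le> (1 - exp (- x))\<^sup>2" using x by (intro power_mono) auto
  also have "(x * exp (- (x / 2)))\<^sup>2 = x\<^sup>2 * exp (- x)" by (simp add: power_mult_distrib flip: exp_double)
  finally have "x\<^sup>2 * exp (- x) \<le> (1 - exp (- x))\<^sup>2" .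
  then have "x\<^sup>2 * exp (- x) / ((real c)\<^sup>2 * (1 - exp (- x))\<^sup>2) \<le> (1 - exp (- x))\<^sup>2 / ((real c)\<^sup>2 * (1 - exp (- x))\<^sup>2)"
    by (intro divide_right_mono) auto
  then show ?thesis using assms lt unfolding e
    by (simp add: x_def power_mult_distrib)
qed

lemma exp_over_square_tendsto:
  assumes "c > 0"
  shows "(\<lambda>n. (saddle n)\<^sup>2 * (exp (- saddle n) ^ c / (1 - exp (- saddle n) ^ c)\<^sup>2)) \<longlonglongrightarrow> 1 / (real c)\<^sup>2"
proof -
  have "((\<lambda>s::real. s\<^sup>2 * (exp (- (real c * s)) / (1 - exp (- (real c * s)))\<^sup>2)) \<longlongrightarrow> inverse ((real c)\<^sup>2)) (at_right 0)"
    using assms by real_asymp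
  moreover have "filterlim saddle (at_right 0) sequentially"
    by (rule tendsto_imp_filterlim_at_right[OF tendsto_saddle eventually_saddle_pos])
  ultimately have "(\<lambda>n. (saddle n)\<^sup>2 * (exp (- (real c * saddle n)) / (1 - exp (- (real c * saddle n)))\<^sup>2)) \<longlonglongrightarrow> inverse ((real c)\<^sup>2)"
    by (rule filterlim_compose)
  moreover have "exp (- (real c * saddle n)) = exp (- saddle n) ^ c" for n
    by (simp flip: exp_of_nat_mult)
  ultimately show ?thesis by (simp only: inverse_eq_divide)
qed

abbreviation exp_weights :: "real \<Rightarrow> nat \<Rightarrow> real" where
  "exp_weights s \<equiv> \<lambda>i. exp (- s) ^ (2*i+1) / (1 - exp (- s) ^ (2*i+1))\<^sup>2"

lemma scaled_hom_sum_le: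
  assumes "s > 0"
  shows "s ^ (2*r) * hom_sum (exp_weights s) K r \<le> hom_sum recip_odd_sq K r"
proof -
  have "s ^ (2*r) * hom_sum (exp_weights s) K r = hom_sum (\<lambda>i. s\<^sup>2 * exp_weights s i) K r"
    by (simp only: hom_sum_scale power_mult)
  also have "\<dots> \<le> hom_sum recip_odd_sq K r"
  proof (rule hom_sum_mono)
    fix i
    show "s\<^sup>2 * exp_weights s i \<le> recip_odd_sq i"
      unfolding recip_odd_sq_def by (rule exp_over_square_le[OF assms]) simp
  qed simp
  finally show ?thesis .
qed

lemma scaled_hom_sum_tendsto:
  "(\<lambda>n. saddle n ^ (2*r) * hom_sum (exp_weights (saddle n)) K r) \<longlonglongrightarrow> hom_sum recip_odd_sq K r"
proof -
  have "(\<lambda>n. hom_sum (\<lambda>i. (saddle n)\<^sup>2 * exp_weights (saddle n) i) K r) \<longlonglongrightarrow> hom_sum recip_odd_sq K r"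
    unfolding recip_odd_sq_def
    by (intro hom_sum_tendsto exp_over_square_tendsto) simp
  then show ?thesis by (simp only: hom_sum_scale power_mult)
qed

lemma partial_hom_sum_le:
  assumes "s > 0"
  shows "(\<Sum>k\<le>n. hom_gf K r $ k * exp (- (real k * s))) \<le> hom_sum (exp_weights s) K r"
proof -
  have e: "exp (- (real k * s)) = exp (- s) ^ k" for k by (simp flip: exp_of_nat_mult)
  have S: "(\<lambda>k. hom_gf K r $ k * exp (- s) ^ k) sums hom_sum (exp_weights s) K r"
    using hom_gf_sums[of "exp (- s)" K r] assms by simp
  have "(\<Sum>k\<le>n. hom_gf K r $ k * exp (- s) ^ k) \<le> (\<Sum>k. hom_gf K r $ k * exp (- s) ^ k)"
    using fps_nonneg_hom_gf[of K r] by (intro sum_le_suminf sums_summable[OF S]) (auto simp: fps_nonneg_def)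
  then show ?thesis using S by (simp add: e sums_iff)
qed

text \<open>
  Cutting the series at \<open>k = n\<close> costs at most \<open>e\<^bsup>-nt/2\<^esup>\<close> times its value at \<open>t/2\<close>, since the terms beyond
  \<open>n\<close> can spare half of their exponential decay.
\<close>
lemma partial_hom_sum_tendsto:
  "(\<lambda>n. saddle n ^ (2*r) * (\<Sum>k\<le>n. hom_gf K r $ k * exp (- (real k * saddle n)))) \<longlonglongrightarrow> hom_sum recip_odd_sq K r"
proof (rule tendsto_sandwich[OF _ _ _ scaled_hom_sum_tendsto])
  let ?tail = "\<lambda>n. exp (- (real n * saddle n / 2)) * (4 ^ r * hom_sum recip_odd_sq K r)"
  show "(\<lambda>n. saddle n ^ (2*r) * hom_sum (exp_weights (saddle n)) K r - ?tail n) \<longlonglongrightarrow> hom_sum recip_odd_sq K r"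
  proof -
    have "(\<lambda>n. exp (- (real n * (pi / sqrt (6 * real n)) / 2))) \<longlonglongrightarrow> 0" by real_asymp
    from tendsto_diff[OF scaled_hom_sum_tendsto[of r K] tendsto_mult_left_zero[OF this[folded saddle_def], of "4 ^ r * hom_sum recip_odd_sq K r"]]
    show ?thesis by simp
  qed
  show "\<forall>\<^sub>F n in sequentially. saddle n ^ (2*r) * (\<Sum>k\<le>n. hom_gf K r $ k * exp (- (real k * saddle n)))
      \<le> saddle n ^ (2*r) * hom_sum (exp_weights (saddle n)) K r"
    using eventually_saddle_pos by eventually_elim (intro mult_left_mono partial_hom_sum_le; simp)
  show "\<forall>\<^sub>F n in sequentially. saddle n ^ (2*r) * hom_sum (exp_weights (saddle n)) K r - ?tail n
     \<le> saddle n ^ (2*r) * (\<Sum>k\<le>n. hom_gf K r $ k * exp (- (real k * saddle n)))"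
    using eventually_saddle_pos
  proof eventually_elim
    case (elim n)
    define s where "s = saddle n"
    have s: "s > 0" using elim by (simp add: s_def)
    let ?h = "\<lambda>k. hom_gf K r $ k"
    have e: "exp (- (real k * x)) = exp (- x) ^ k" for k x by (simp flip: exp_of_nat_mult)
    have S: "(\<lambda>k. ?h k * exp (- x) ^ k) sums hom_sum (exp_weights x) K r" if "x > 0" for x
      using hom_gf_sums[of "exp (- x)" K r] that by simp
    have h0: "0 \<le> ?h k" for k using fps_nonneg_hom_gf[of K r] by (simp add: fps_nonneg_def)
    have S1: "(\<lambda>k. ?h (k + Suc n) * exp (- s) ^ (k + Suc n)) sums
        (hom_sum (exp_weights s) K r - (\<Sum>k<Suc n. ?h k * exp (- s) ^ k))"
      by (rule sums_split_initial_segment[OF S[OF s]])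
    have S2: "(\<lambda>k. exp (- (real n * s / 2)) * (?h (k + Suc n) * exp (- (s/2)) ^ (k + Suc n))) sums
        (exp (- (real n * s / 2)) * (hom_sum (exp_weights (s/2)) K r - (\<Sum>k<Suc n. ?h k * exp (- (s/2)) ^ k)))"
      by (intro sums_mult sums_split_initial_segment S) (use s in simp)
    have le: "?h (k + Suc n) * exp (- s) ^ (k + Suc n)
        \<le> exp (- (real n * s / 2)) * (?h (k + Suc n) * exp (- (s/2)) ^ (k + Suc n))" for k
    proof -
      have "exp (- s) ^ (k + Suc n) \<le> exp (- (real n * s / 2)) * exp (- (s/2)) ^ (k + Suc n)"
        unfolding e[symmetric] exp_add[symmetric] using s by (simp add: algebra_simps)
      from mult_left_mono[OF this h0[of "k + Suc n"]] show ?thesis by (simp only: mult.left_commute)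
    qed
    have "hom_sum (exp_weights s) K r - (\<Sum>k<Suc n. ?h k * exp (- s) ^ k)
        \<le> exp (- (real n * s / 2)) * (hom_sum (exp_weights (s/2)) K r - (\<Sum>k<Suc n. ?h k * exp (- (s/2)) ^ k))"
      by (rule sums_le[OF le S1 S2])
    also have "\<dots> \<le> exp (- (real n * s / 2)) * hom_sum (exp_weights (s/2)) K r"
    proof (rule mult_left_mono)
      have "0 \<le> (\<Sum>k<Suc n. ?h k * exp (- (s/2)) ^ k)"
        using h0 by (intro sum_nonneg mult_nonneg_nonneg) auto
      then show "hom_sum (exp_weights (s/2)) K r - (\<Sum>k<Suc n. ?h k * exp (- (s/2)) ^ k) \<le> hom_sum (exp_weights (s/2)) K r"
        by linarith
    qed simp
    finally have 1: "hom_sum (exp_weights s) K r - (\<Sum>k\<le>n. ?h k * exp (- (real k * s))) \<le> \<dots>"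
      by (simp only: e lessThan_Suc_atMost)
    have "(4 :: real) ^ r = 2 ^ (2 * r)" by (simp add: power_mult)
    then have 4: "s ^ (2*r) = 4 ^ r * (s / 2) ^ (2*r)" by (simp add: power_divide)
    have "s ^ (2*r) * (hom_sum (exp_weights s) K r - (\<Sum>k\<le>n. ?h k * exp (- (real k * s))))
        \<le> s ^ (2*r) * (exp (- (real n * s / 2)) * hom_sum (exp_weights (s/2)) K r)"
      using 1 s by (intro mult_left_mono) auto
    also have "\<dots> = exp (- (real n * s / 2)) * (4 ^ r * ((s/2) ^ (2*r) * hom_sum (exp_weights (s/2)) K r))"
      unfolding 4 by (simp only: mult_ac)
    also have "\<dots> \<le> exp (- (real n * s / 2)) * (4 ^ r * hom_sum recip_odd_sq K r)"
      using scaled_hom_sum_le[of "s/2" r K] s by (intro mult_left_mono) auto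
    finally show ?case unfolding s_def[symmetric] by (simp only: right_diff_distrib)
  qed
qed

section \<open>The Euler polynomial at one half\<close>

text \<open>
  The odd factors of the product for \<open>sin (\<pi>w)\<close> remain after division by the product for \<open>sin (\<pi>w/2)\<close>, and
  \<open>sin (\<pi>w) = 2 sin (\<pi>w/2) cos (\<pi>w/2)\<close>.
\<close>
lemma cos_odd_product:
  fixes w :: real
  assumes "0 < w" "w < 1"
  shows "(\<lambda>K. \<Prod>i<K. 1 - w\<^sup>2 * recip_odd_sq i) \<longlonglongrightarrow> cos (pi / 2 * w)"
proof -
  define P where "P = (\<lambda>x n. \<Prod>k=1..n. 1 - x\<^sup>2 / (real k)\<^sup>2)"
  define O' where "O' = (\<lambda>K. \<Prod>i<K. 1 - w\<^sup>2 * recip_odd_sq i)"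
  have lim: "P x \<longlonglongrightarrow> sin (pi * x) / (pi * x)" if "x \<noteq> 0" for x
    unfolding P_def using sin_product_formula_real'[OF that] by simp
  have split: "P w (2 * K) = P (w / 2) K * O' K" for K
  proof (induction K)
    case (Suc K)
    have "P w (2 * Suc K) = P w (2 * K) * (1 - w\<^sup>2 / (real (2 * K + 1))\<^sup>2) * (1 - w\<^sup>2 / (real (2 * K + 2))\<^sup>2)"
      by (simp add: P_def)
    moreover have "w\<^sup>2 / (real (2 * K + 2))\<^sup>2 = (w / 2)\<^sup>2 / (real (Suc K))\<^sup>2"
      by (simp add: power2_eq_square field_simps)
    ultimately show ?case using Suc by (simp add: P_def O'_def recip_odd_sq_def mult_ac)
  qed (simp add: P_def O'_def)
  have sq1: "x\<^sup>2 < 1" if "0 < x" "x < 1" for x :: real using that by (simp add: power_less_one_iff)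
  have Ppos: "P (w / 2) K > 0" for K
    unfolding P_def
  proof (rule prod_pos)
    fix k assume "k \<in> {1..K}"
    then have "1 \<le> (real k)\<^sup>2" by (simp add: one_le_power)
    moreover have "(w / 2)\<^sup>2 < 1" using assms by (intro sq1) auto
    ultimately show "0 < 1 - (w / 2)\<^sup>2 / (real k)\<^sup>2" by (simp add: divide_less_eq)
  qed
  have s: "sin (pi * (w / 2)) > 0" using assms by (intro sin_gt_zero) auto
  have "(\<lambda>K. P w (2 * K) / P (w / 2) K) \<longlonglongrightarrow> (sin (pi * w) / (pi * w)) / (sin (pi * (w / 2)) / (pi * (w / 2)))"
  proof (rule tendsto_divide)
    show "(\<lambda>K. P w (2 * K)) \<longlonglongrightarrow> sin (pi * w) / (pi * w)"
      using LIMSEQ_subseq_LIMSEQ[OF lim[of w], of "\<lambda>K. 2 * K"] assms by (simp add: strict_mono_def o_def)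
    show "P (w / 2) \<longlonglongrightarrow> sin (pi * (w / 2)) / (pi * (w / 2))" using assms by (intro lim) simp
  qed (use assms s in auto)
  also have "(\<lambda>K. P w (2 * K) / P (w / 2) K) = O'"
    using Ppos by (auto simp: split less_imp_neq[THEN not_sym])
  also have "(sin (pi * w) / (pi * w)) / (sin (pi * (w / 2)) / (pi * (w / 2))) = cos (pi / 2 * w)"
    using sin_double[of "pi * (w / 2)"] s assms by (simp add: field_simps)
  finally show ?thesis unfolding O'_def .
qed

lemma hom_sum_power_sums:
  fixes x :: real
  assumes x: "0 \<le> x" "x < 1 / 3"
  shows "(\<lambda>r. hom_sum recip_odd_sq K r * x ^ r) sums inverse (\<Prod>i<K. 1 - x * recip_odd_sq i)"
proof (induction K)
  case 0
  have "(\<lambda>r. hom_sum recip_odd_sq 0 r * x ^ r) = (\<lambda>r. if r = 0 then x ^ r else 0)"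
  proof
    show "hom_sum recip_odd_sq 0 r * x ^ r = (if r = 0 then x ^ r else 0)" for r by (cases r) auto
  qed
  then show ?case using sums_single[of 0 "\<lambda>r. x ^ r"] by simp
next
  case (Suc K)
  let ?h = "\<lambda>K r. hom_sum recip_odd_sq K r * x ^ r"
  have "summable (?h (Suc K))"
  proof (rule summable_comparison_test')
    show "summable (\<lambda>r. (3 * x) ^ r)" using x by (intro summable_geometric) simp
    show "norm (?h (Suc K) r) \<le> (3 * x) ^ r" for r
      using hom_sum_recip_le[of "Suc K" r] hom_sum_nonneg[of recip_odd_sq "Suc K" r, OF recip_odd_sq_pos(2)] x
      by (simp add: abs_mult power_mult_distrib mult_right_mono del: hom_sum.simps)
  qed
  then obtain S where S: "?h (Suc K) sums S" by (auto simp: summable_def)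
  have "(\<lambda>r. ?h K (Suc r) + x * recip_odd_sq K * ?h (Suc K) r) sums
      (inverse (\<Prod>i<K. 1 - x * recip_odd_sq i) - ?h K 0 + x * recip_odd_sq K * S)"
    using Suc S by (intro sums_add sums_mult) (subst sums_Suc_iff, simp_all)
  also have "(\<lambda>r. ?h K (Suc r) + x * recip_odd_sq K * ?h (Suc K) r) = (\<lambda>r. ?h (Suc K) (Suc r))"
    by (simp add: algebra_simps)
  finally have S1: "(\<lambda>r. ?h (Suc K) (Suc r)) sums
      (inverse (\<Prod>i<K. 1 - x * recip_odd_sq i) - ?h K 0 + x * recip_odd_sq K * S)" .
  have S2: "(\<lambda>r. ?h (Suc K) (Suc r)) sums (S - ?h (Suc K) 0)"
    using S by (subst sums_Suc_iff) (simp del: hom_sum.simps)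
  have "S - ?h (Suc K) 0 = inverse (\<Prod>i<K. 1 - x * recip_odd_sq i) - ?h K 0 + x * recip_odd_sq K * S"
    by (rule sums_unique2[OF S2 S1])
  then have eq: "S * (1 - x * recip_odd_sq K) = inverse (\<Prod>i<K. 1 - x * recip_odd_sq i)"
    by (simp add: algebra_simps)
  have "recip_odd_sq K \<le> 1" by (simp add: recip_odd_sq_def)
  then have "x * recip_odd_sq K \<le> x * 1" using x by (intro mult_left_mono) auto
  then have "1 - x * recip_odd_sq K \<noteq> 0" using x by linarith
  then have "S = S * (1 - x * recip_odd_sq K) * inverse (1 - x * recip_odd_sq K)" by simp
  then have "S = inverse (\<Prod>i<Suc K. 1 - x * recip_odd_sq i)"
    by (simp only: eq prod.lessThan_Suc inverse_mult_distrib)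
  with S show ?case by simp
qed

lemma hom_limit_le: "hom_limit r \<le> 3 ^ r"
  by (rule LIMSEQ_le_const2[OF hom_limit_tendsto]) (use hom_sum_recip_le in auto)

text \<open>
  Tannery's theorem interchanges the limit in the number of variables with the sum over the degree; the bound
  \<open>3\<^sup>r\<close> on the homogeneous sums provides a geometric majorant for small \<open>w\<close>.
\<close>
lemma hom_limit_sums:
  fixes w :: real
  assumes w: "0 < w" "w < 1 / 2"
  shows "(\<lambda>r. hom_limit r * (w\<^sup>2) ^ r) sums inverse (cos (pi / 2 * w))"
proof -
  have "w\<^sup>2 < (1/2)\<^sup>2" using w by (intro power_strict_mono) auto
  then have x: "0 \<le> w\<^sup>2" "w\<^sup>2 < 1 / 3" "w\<^sup>2 < 1" by (simp_all add: power2_eq_square)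
  have tannery: "(\<lambda>K. \<Sum>r. hom_sum recip_odd_sq K r * (w\<^sup>2) ^ r) \<longlonglongrightarrow> (\<Sum>r. hom_limit r * (w\<^sup>2) ^ r)"
  proof (rule tannerys_theorem[where M = "\<lambda>r. (3 * w\<^sup>2) ^ r", THEN conjunct2, THEN conjunct2])
    show "(\<lambda>K. hom_sum recip_odd_sq K r * (w\<^sup>2) ^ r) \<longlonglongrightarrow> hom_limit r * (w\<^sup>2) ^ r" for r
      by (intro tendsto_mult hom_limit_tendsto tendsto_const)
    show "\<forall>\<^sub>F (r, K) in at_top \<times>\<^sub>F sequentially. norm (hom_sum recip_odd_sq K r * (w\<^sup>2) ^ r) \<le> (3 * w\<^sup>2) ^ r"
    proof (rule always_eventually, safe)
      show "norm (hom_sum recip_odd_sq K r * (w\<^sup>2) ^ r) \<le> (3 * w\<^sup>2) ^ r" for r K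
        using hom_sum_recip_le[of K r] hom_sum_nonneg[of recip_odd_sq K r, OF recip_odd_sq_pos(2)]
        by (simp add: abs_mult power_mult_distrib mult_right_mono)
    qed
    show "summable (\<lambda>r. (3 * w\<^sup>2) ^ r)" using x by (intro summable_geometric) simp
  qed simp
  moreover have "(\<Sum>r. hom_sum recip_odd_sq K r * (w\<^sup>2) ^ r) = inverse (\<Prod>i<K. 1 - w\<^sup>2 * recip_odd_sq i)" for K
    using hom_sum_power_sums[OF x(1,2)] by (simp add: sums_iff)
  ultimately have "(\<lambda>K. inverse (\<Prod>i<K. 1 - w\<^sup>2 * recip_odd_sq i)) \<longlonglongrightarrow> (\<Sum>r. hom_limit r * (w\<^sup>2) ^ r)"
    by simp
  moreover have "(\<lambda>K. inverse (\<Prod>i<K. 1 - w\<^sup>2 * recip_odd_sq i)) \<longlonglongrightarrow> inverse (cos (pi / 2 * w))"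
  proof (rule tendsto_inverse[OF cos_odd_product])
    have "pi / 2 * w < pi / 2" using w by simp
    then have "0 < cos (pi / 2 * w)" using w by (intro cos_gt_zero) auto
    then show "cos (pi / 2 * w) \<noteq> 0" by simp
  qed (use w in auto)
  ultimately have "(\<Sum>r. hom_limit r * (w\<^sup>2) ^ r) = inverse (cos (pi / 2 * w))"
    by (rule LIMSEQ_unique)
  moreover have "summable (\<lambda>r. hom_limit r * (w\<^sup>2) ^ r)"
  proof (rule summable_comparison_test')
    show "summable (\<lambda>r. (3 * w\<^sup>2) ^ r)" using x by (intro summable_geometric) simp
    show "norm (hom_limit r * (w\<^sup>2) ^ r) \<le> (3 * w\<^sup>2) ^ r" for r
      using hom_limit_le[of r] hom_limit_pos[of r]
      by (simp add: abs_mult power_mult_distrib mult_right_mono)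
  qed
  ultimately show ?thesis by (simp add: sums_iff)
qed

text \<open>
  The expansion of \<open>sec (\<pi>w/2)\<close>, by \<open>sec_fps_sums\<close>.
\<close>
definition sec_fps :: "real fps" where
  "sec_fps = Abs_fps (\<lambda>k. if even k then hom_limit (k div 2) else 0)"

lemma sec_fps_sums:
  fixes w :: real
  assumes w: "\<bar>w\<bar> < 1 / 2"
  shows "(\<lambda>k. sec_fps $ k * w ^ k) sums inverse (cos (pi / 2 * w))"
proof (cases "w = 0")
  case True
  have "hom_limit 0 = 1"
    using hom_limit_tendsto[of 0] by (simp add: LIMSEQ_const_iff)
  then have "(\<lambda>k. sec_fps $ k * w ^ k) = (\<lambda>k. if k = 0 then 1 else 0)"
    by (auto simp: True sec_fps_def)
  then show ?thesis using sums_single[of 0 "\<lambda>_. 1 :: real"] by (simp add: True)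
next
  case False
  have "(\<lambda>r. hom_limit r * (\<bar>w\<bar>\<^sup>2) ^ r) sums inverse (cos (pi / 2 * \<bar>w\<bar>))"
    using w False by (intro hom_limit_sums) auto
  also have "(\<lambda>r. hom_limit r * (\<bar>w\<bar>\<^sup>2) ^ r) = (\<lambda>r. sec_fps $ (2 * r) * w ^ (2 * r))"
    by (simp add: sec_fps_def power_mult)
  also have "cos (pi / 2 * \<bar>w\<bar>) = cos (pi / 2 * w)" by (simp add: abs_if)
  finally have *: "(\<lambda>r. sec_fps $ (2 * r) * w ^ (2 * r)) sums inverse (cos (pi / 2 * w))" .
  show ?thesis
  proof (rule sums_mono_reindex[where g = "\<lambda>r. 2 * r" and f = "\<lambda>k. sec_fps $ k * w ^ k", THEN iffD1, OF _ _ *])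
    show "strict_mono (\<lambda>r :: nat. 2 * r)" by (simp add: strict_mono_def)
    show "sec_fps $ k * w ^ k = 0" if "k \<notin> range (\<lambda>r. 2 * r)" for k
      using that by (auto simp: sec_fps_def elim!: evenE)
  qed
qed

text \<open>
  If the difference were nonzero, dividing out its lowest power would leave a continuous function
  that is nonzero at the origin but vanishes on a punctured neighbourhood.
\<close>
lemma real_fps_eqI:
  fixes F G :: "real fps"
  assumes "0 < fps_conv_radius F" "0 < fps_conv_radius G"
    and "\<forall>\<^sub>F w in nhds 0. eval_fps F w = eval_fps G w"
  shows "F = G"
proof (rule ccontr)
  define H where "H = F - G"
  define d where "d = subdegree H"
  define H' where "H' = fps_shift d H"
  assume "F \<noteq> G"
  then have H: "H \<noteq> 0" by (simp add: H_def)
  have rad: "0 < fps_conv_radius H"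
    using assms(1,2) fps_conv_radius_diff[of F G] unfolding H_def
    by (metis less_le_trans min_less_iff_conj)
  have small: "\<forall>\<^sub>F w in nhds (0 :: real). ereal (norm w) < R" if "0 < R" for R
  proof -
    have "\<forall>\<^sub>F w in nhds (0 :: real). w \<in> eball 0 R"
      using that by (intro eventually_nhds_in_open) (auto simp: in_eball_iff zero_ereal_def)
    then show ?thesis by eventually_elim (simp add: in_eball_iff)
  qed
  have "\<forall>\<^sub>F w in nhds 0. eval_fps H w = 0"
    using assms(3) small[OF assms(1)] small[OF assms(2)]
    by eventually_elim (simp add: H_def eval_fps_diff)
  then have "\<forall>\<^sub>F w in nhds 0. w \<noteq> 0 \<longrightarrow> eval_fps H' w = 0"
    using small[OF rad] by eventually_elim (simp add: H'_def d_def eval_fps_shift)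
  then have "\<forall>\<^sub>F w in at 0. eval_fps H' w = 0"
    by (simp add: eventually_at_filter)
  then have "((\<lambda>w. eval_fps H' w) \<longlongrightarrow> 0) (at 0)"
    by (rule tendsto_eventually)
  moreover have "((\<lambda>w. eval_fps H' w) \<longlongrightarrow> eval_fps H' 0) (at 0)"
  proof -
    have "eval_fps H' has_fps_expansion H'"
      using rad by (intro eval_fps_has_fps_expansion) (simp add: H'_def)
    from has_fps_expansion_imp_continuous[OF this] show ?thesis
      by (simp add: continuous_within)
  qed
  ultimately have "eval_fps H' 0 = 0" using LIM_unique by blast
  moreover have "eval_fps H' 0 = H $ d" by (simp add: eval_fps_at_0 H'_def)
  ultimately show False using H nth_subdegree_nonzero by (simp add: d_def)
qed

lemma sec_fps_mult_cos: "sec_fps * fps_cos (pi / 2) = 1"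
proof (rule real_fps_eqI)
  have "ereal (norm (1/4 :: real)) \<le> fps_conv_radius sec_fps"
    unfolding fps_conv_radius_def using sec_fps_sums[of "1/4"]
    by (intro conv_radius_geI) (simp add: sums_iff)
  then have rad: "ereal (1/4) \<le> fps_conv_radius sec_fps" by simp
  have "0 < min (fps_conv_radius sec_fps) (fps_conv_radius (fps_cos (pi/2)))"
    using rad by (auto intro: less_le_trans[of _ "ereal (1/4)"])
  then show "0 < fps_conv_radius (sec_fps * fps_cos (pi / 2))"
    using fps_conv_radius_mult less_le_trans by blast
  show "0 < fps_conv_radius (1 :: real fps)" by simp
  have "\<forall>\<^sub>F w in nhds (0 :: real). w \<in> ball 0 (1/4)" by (rule eventually_nhds_in_open) auto
  then show "\<forall>\<^sub>F w in nhds 0. eval_fps (sec_fps * fps_cos (pi / 2)) w = eval_fps 1 w"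
  proof eventually_elim
    case (elim w)
    then have w: "\<bar>w\<bar> < 1 / 4" by simp
    then have "ereal (norm w) < fps_conv_radius sec_fps"
      using rad by (auto intro: less_le_trans[of _ "ereal (1/4)"])
    then have "eval_fps (sec_fps * fps_cos (pi / 2)) w = eval_fps sec_fps w * cos (pi / 2 * w)"
      by (subst eval_fps_mult) auto
    also have "eval_fps sec_fps w = inverse (cos (pi / 2 * w))"
      using sec_fps_sums[of w] w by (simp add: eval_fps_def sums_iff)
    also have "inverse (cos (pi / 2 * w)) * cos (pi / 2 * w) = 1"
    proof -
      have "\<bar>pi / 2 * w\<bar> < pi / 2" using w by (simp add: abs_mult)
      then have "0 < cos (pi / 2 * w)" by (intro cos_gt_zero_pi) (auto simp: abs_less_iff)
      then show ?thesis by simp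
    qed
    finally show ?case by simp
  qed
qed

text \<open>
  At \<open>1/2\<close> the generating function of the Euler polynomials is \<open>1 / cosh (x/2)\<close>. Substituting \<open>w = i x/\<pi>\<close> in
  \<open>sec (\<pi>w/2)\<close> gives the same function; on real coefficients the substitution is multiplication of the
  \<open>k\<close>-th coefficient by \<open>(- 1)\<^bsup>k/2\<^esup> \<pi>\<^bsup>-k\<^esup>\<close> for even \<open>k\<close>.
\<close>
lemma euler_poly_eq_hom_limit:
  "euler_poly (2 * l) (1 / 2) = fact (2 * l) * ((- 1) ^ l * hom_limit l / pi ^ (2 * l))"
proof -
  define A :: "real fps" where "A = Abs_fps (\<lambda>k. if even k then (- 1) ^ (k div 2) * hom_limit (k div 2) / pi ^ k else 0)"
  define Ch :: "real fps" where "Ch = Abs_fps (\<lambda>k. if even k then (1 / 2) ^ k / fact k else 0)"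
  have ACh: "A * Ch = 1"
  proof (rule fps_ext)
    fix n
    show "(A * Ch) $ n = (1 :: real fps) $ n"
    proof (cases "even n")
      case True
      have "(A * Ch) $ n = (\<Sum>i=0..n. ((- 1) ^ (n div 2) / pi ^ n) * (sec_fps $ i * fps_cos (pi / 2) $ (n - i)))"
        unfolding fps_mult_nth
      proof (rule sum.cong[OF refl])
        fix i assume i: "i \<in> {0..n}"
        show "A $ i * Ch $ (n - i) = ((- 1) ^ (n div 2) / pi ^ n) * (sec_fps $ i * fps_cos (pi / 2) $ (n - i))"
        proof (cases "even i")
          case ie: True
          then obtain a where a: "i = 2 * a" by (elim evenE)
          from True obtain b where b: "n = 2 * b" by (elim evenE)
          have ab: "a \<le> b" using i a b by simp
          have nb: "n - i = 2 * (b - a)" using a b by simp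
          have sg: "(- 1 :: real) ^ b * (- 1) ^ (b - a) = (- 1) ^ a"
          proof -
            have "(- 1 :: real) ^ b = (- 1) ^ a * (- 1) ^ (b - a)" using ab by (simp flip: power_add)
            then show ?thesis by (simp add: mult.assoc flip: power_mult_distrib)
          qed
          have pp: "pi ^ n = pi ^ i * pi ^ (n - i)" using i by (simp flip: power_add)
          have "fps_cos (pi / 2) $ (n - i) = (- 1) ^ (b - a) * (pi / 2) ^ (n - i) / fact (n - i)"
            using nb by (simp add: fps_cos_def)
          then have "((- 1) ^ (n div 2) / pi ^ n) * (sec_fps $ i * fps_cos (pi / 2) $ (n - i))
            = ((- 1) ^ b * (- 1) ^ (b - a)) * hom_limit a * (pi / 2) ^ (n - i) / fact (n - i) / pi ^ n"
            using a b by (simp add: sec_fps_def mult_ac)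
          also have "\<dots> = (- 1) ^ a * hom_limit a / pi ^ i * ((1 / 2) ^ (n - i) / fact (n - i))"
            unfolding sg pp by (simp add: power_divide)
          also have "\<dots> = A $ i * Ch $ (n - i)"
            using a nb by (simp add: A_def Ch_def)
          finally show ?thesis by simp
        next
          case False
          then show ?thesis by (simp add: A_def sec_fps_def)
        qed
      qed
      also have "\<dots> = ((- 1) ^ (n div 2) / pi ^ n) * (sec_fps * fps_cos (pi / 2)) $ n"
        by (simp only: fps_mult_nth sum_distrib_left)
      also have "\<dots> = (1 :: real fps) $ n" unfolding sec_fps_mult_cos by simp
      finally show ?thesis .
    next
      case False
      have "A $ i * Ch $ (n - i) = 0" if "i \<le> n" for i
        using False that by (auto simp: A_def Ch_def)
      then have "(A * Ch) $ n = 0" unfolding fps_mult_nth by (intro sum.neutral) auto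
      moreover have "n \<noteq> 0" using False by (metis even_zero)
      ultimately show ?thesis by simp
    qed
  qed
  define E where "E = 2 * fps_exp (1 / 2 :: real) / (fps_exp 1 + 1)"
  have "E * Ch = 1"
  proof -
    have two: "fps_exp (1/2) + fps_exp (- (1/2)) = fps_const 2 * Ch"
      by (rule fps_ext) (auto simp: Ch_def fps_exp_def power_divide)
    have half: "fps_exp (1/2 :: real) * fps_exp (1/2) = fps_exp 1" "fps_exp (1/2 :: real) * fps_exp (- (1/2)) = 1"
      by (simp_all flip: fps_exp_add_mult)
    have ne: "(fps_exp 1 + 1 :: real fps) $ 0 \<noteq> 0" by simp
    have "E * (fps_exp 1 + 1) = 2 * fps_exp (1/2)"
      unfolding E_def fps_divide_unit[OF ne]
      using inverse_mult_eq_1[OF ne] by (simp add: mult.assoc)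
    moreover have "fps_exp 1 + 1 = fps_exp (1/2) * (fps_const 2 * Ch)"
      unfolding two[symmetric] distrib_left half by simp
    ultimately have "(2 * fps_exp (1/2)) * (E * Ch) = (2 * fps_exp (1/2)) * 1"
      by (simp add: mult_ac numeral_fps_const)
    moreover have "2 * fps_exp (1/2 :: real) \<noteq> 0"
    proof
      assume "2 * fps_exp (1/2 :: real) = 0"
      then have "(2 * fps_exp (1/2 :: real)) $ 0 = 0" by simp
      then show False by (simp add: numeral_fps_const)
    qed
    ultimately show ?thesis by (simp only: mult_cancel_left simp_thms)
  qed
  then have "E * (A * Ch) = A" by (metis mult.commute mult.left_commute mult.right_neutral)
  then have "E = A" using ACh by simp
  then show ?thesis by (simp add: euler_poly_def E_def[symmetric] A_def)
qed

section \<open>The moments\<close>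

definition poly_bounded :: "real fps \<Rightarrow> bool" where
  "poly_bounded f \<longleftrightarrow> (\<exists>D d. \<forall>n. \<bar>f $ n\<bar> \<le> D * (real n + 1) ^ d)"

lemma poly_boundedE:
  assumes "poly_bounded f"
  obtains D d where "D \<ge> 0" "\<And>n. \<bar>f $ n\<bar> \<le> D * (real n + 1) ^ d"
proof -
  obtain D d where D: "\<And>n. \<bar>f $ n\<bar> \<le> D * (real n + 1) ^ d" using assms by (auto simp: poly_bounded_def)
  then have "0 \<le> D" using D[of 0] by simp
  with D that show ?thesis by blast
qed

lemma poly_bounded_base [intro]: "poly_bounded 0" "poly_bounded 1" "poly_bounded (fps_X ^ k)" "poly_bounded (geo_fps c)"
proof -
  have *: "poly_bounded f" if "\<And>n. \<bar>f $ n\<bar> \<le> 1" for f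
    unfolding poly_bounded_def by (intro exI[of _ 1] exI[of _ 0]) (use that in simp)
  show "poly_bounded 0" "poly_bounded 1" "poly_bounded (fps_X ^ k)" "poly_bounded (geo_fps c)"
    by (rule *; simp add: geo_fps_def)+
qed

lemma poly_bounded_add [intro]:
  assumes "poly_bounded f" "poly_bounded g"
  shows "poly_bounded (f + g)"
proof -
  obtain D d where D: "D \<ge> 0" "\<And>n. \<bar>f $ n\<bar> \<le> D * (real n + 1) ^ d" using assms(1) by (rule poly_boundedE) blast
  obtain C c where C: "C \<ge> 0" "\<And>n. \<bar>g $ n\<bar> \<le> C * (real n + 1) ^ c" using assms(2) by (rule poly_boundedE) blast
  have "\<bar>(f + g) $ n\<bar> \<le> (D + C) * (real n + 1) ^ (d + c)" for n
  proof -
    have "D * (real n + 1) ^ d \<le> D * (real n + 1) ^ (d + c)" "C * (real n + 1) ^ c \<le> C * (real n + 1) ^ (d + c)"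
      using D(1) C(1) by (auto intro!: mult_left_mono power_increasing)
    then show ?thesis using D(2)[of n] C(2)[of n] by (simp add: distrib_right)
  qed
  then show ?thesis by (auto simp: poly_bounded_def)
qed

lemma poly_bounded_mult [intro]:
  assumes "poly_bounded f" "poly_bounded g"
  shows "poly_bounded (f * g)"
proof -
  obtain D d where D: "D \<ge> 0" "\<And>n. \<bar>f $ n\<bar> \<le> D * (real n + 1) ^ d" using assms(1) by (rule poly_boundedE) blast
  obtain C c where C: "C \<ge> 0" "\<And>n. \<bar>g $ n\<bar> \<le> C * (real n + 1) ^ c" using assms(2) by (rule poly_boundedE) blast
  have "\<bar>(f * g) $ n\<bar> \<le> (D * C) * (real n + 1) ^ (d + c + 1)" for n
  proof -
    have "\<bar>(f * g) $ n\<bar> \<le> (\<Sum>i=0..n. \<bar>f $ i * g $ (n - i)\<bar>)" unfolding fps_mult_nth by (rule sum_abs)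
    also have "\<dots> \<le> (\<Sum>i=0..n. (D * (real n + 1) ^ d) * (C * (real n + 1) ^ c))"
    proof (rule sum_mono)
      fix i assume i: "i \<in> {0..n}"
      have "\<bar>f $ i\<bar> \<le> D * (real n + 1) ^ d"
        by (rule order_trans[OF D(2)]) (use D(1) i in \<open>auto intro!: mult_left_mono power_mono\<close>)
      moreover have "\<bar>g $ (n - i)\<bar> \<le> C * (real n + 1) ^ c"
        by (rule order_trans[OF C(2)]) (use C(1) i in \<open>auto intro!: mult_left_mono power_mono\<close>)
      ultimately show "\<bar>f $ i * g $ (n - i)\<bar> \<le> (D * (real n + 1) ^ d) * (C * (real n + 1) ^ c)"
        unfolding abs_mult by (rule mult_mono) (use D(1) in auto)
    qed
    also have "\<dots> = (D * C) * (real n + 1) ^ (d + c + 1)"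
      by (simp add: power_add add.commute)
    finally show ?thesis .
  qed
  then show ?thesis unfolding poly_bounded_def by blast
qed

lemma poly_bounded_sum [intro]: "(\<And>i. i \<in> S \<Longrightarrow> poly_bounded (f i)) \<Longrightarrow> poly_bounded (sum f S)"
  by (induction S rule: infinite_finite_induct) auto

lemma poly_bounded_odd_pairs_gf [intro]: "poly_bounded (odd_pairs_gf K)"
  by (induction K) (auto simp: power2_eq_square)

lemma poly_bounded_hom_gf [intro]: "poly_bounded (hom_gf K r)"
proof (induction K r rule: hom_gf.induct)
  case (3 K r)
  then show ?case unfolding hom_gf.simps power2_eq_square
    by (intro poly_bounded_add poly_bounded_mult poly_bounded_base)
qed auto

lemma poly_bounded_over_growth:
  assumes "poly_bounded f"
  shows "(\<lambda>n. saddle n ^ k * f $ n / (\<kappa> * growth n)) \<longlonglongrightarrow> 0"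
proof -
  obtain D d where D: "D \<ge> 0" "\<And>n. \<bar>f $ n\<bar> \<le> D * (real n + 1) ^ d" using assms by (rule poly_boundedE) blast
  have "(\<lambda>n. (real n + 1) powr real d / (real n powr (- (3/4)) * exp (pi * sqrt (2 * real n / 3)))) \<longlonglongrightarrow> 0"
    by real_asymp
  then have lim: "(\<lambda>n. D / \<bar>\<kappa>\<bar> * ((real n + 1) ^ d / growth n)) \<longlonglongrightarrow> D / \<bar>\<kappa>\<bar> * 0"
    unfolding growth_def by (intro tendsto_mult tendsto_const) (simp add: powr_realpow add_nonneg_pos)
  have "\<forall>\<^sub>F n in sequentially. saddle n < 1" by (rule order_tendstoD[OF tendsto_saddle]) simp
  then have "\<forall>\<^sub>F n in sequentially. norm (saddle n ^ k * f $ n / (\<kappa> * growth n)) \<le> D / \<bar>\<kappa>\<bar> * ((real n + 1) ^ d / growth n)"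
    using eventually_gt_at_top[of 0]
  proof eventually_elim
    case (elim n)
    have g: "growth n > 0" using elim by (intro growth_pos)
    have s: "0 \<le> saddle n ^ k" "saddle n ^ k \<le> 1"
      using elim saddle_pos[of n] by (auto intro: power_le_one less_imp_le)
    have "norm (saddle n ^ k * f $ n / (\<kappa> * growth n)) = saddle n ^ k * \<bar>f $ n\<bar> / (\<bar>\<kappa>\<bar> * growth n)"
      using g s by (simp add: abs_mult)
    also have "\<dots> \<le> 1 * (D * (real n + 1) ^ d) / (\<bar>\<kappa>\<bar> * growth n)"
      using s D g by (intro divide_right_mono mult_mono) auto
    finally show ?case by simp
  qed
  then show ?thesis by (intro Lim_null_comparison[OF _ lim[simplified mult_zero_right]])
qed

lemma hom_gf_mono: "K \<le> L \<Longrightarrow> fps_nonneg (hom_gf L r - hom_gf K r)"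
proof (induction L rule: dec_induct)
  case (step L)
  have "fps_nonneg (hom_gf (Suc L) r - hom_gf L r)"
    by (cases r) (auto intro!: fps_nonneg_mult fps_nonneg_power2)
  from fps_nonneg_add[OF step.IH this] show ?case by simp
qed simp

text \<open>
  Every peak \<open>2k+1\<close> that occurs has \<open>k < n\<close>, so admitting all parts below \<open>2n\<close> in the homogeneous factor only enlarges it.
\<close>
lemma peaked_coeff_upper:
  "peaked_coeff r n \<le> (\<Sum>k\<le>n. hom_gf n r $ k * peaked_coeff 0 (n - k))"
proof -
  define F where "F = (\<Sum>k<n. fps_X ^ (2*k+1) * odd_pairs_gf (Suc k))"
  have F: "F $ (n - i) = peaked_coeff 0 (n - i)" for i
    using coeff_sum_X_power_cutoff[of "n - i" n 1 "\<lambda>k. odd_pairs_gf (Suc k)"]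
    by (simp add: F_def peaked_coeff_def del: odd_pairs_gf.simps power_Suc)
  have "hom_gf n r * F - (\<Sum>k<n. fps_X ^ (2*k+1) * (odd_pairs_gf (Suc k) * hom_gf (Suc k) r))
      = (\<Sum>k<n. fps_X ^ (2*k+1) * (odd_pairs_gf (Suc k) * (hom_gf n r - hom_gf (Suc k) r)))"
    by (simp only: F_def sum_distrib_left sum_subtractf[symmetric] right_diff_distrib mult_ac)
  also have "fps_nonneg \<dots>"
    by (intro fps_nonneg_sum fps_nonneg_mult hom_gf_mono fps_nonneg_simps fps_nonneg_odd_pairs_gf) auto
  finally have "peaked_coeff r n \<le> (hom_gf n r * F) $ n"
    by (simp add: fps_nonneg_def peaked_coeff_def del: odd_pairs_gf.simps hom_gf.simps power_Suc)
  then show ?thesis by (simp add: fps_mult_nth F atLeast0AtMost)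
qed

text \<open>
  Peaks with \<open>k \<ge> J\<close> admit the first \<open>J\<close> odd parts. The peaks below contribute a fixed power series, whose
  coefficients grow only polynomially.
\<close>
lemma peaked_coeff_lower:
  assumes "J \<le> n"
  shows "(\<Sum>k\<le>n. hom_gf J r $ k * peaked_coeff 0 (n - k))
     - (\<Sum>k<J. fps_X ^ (2*k+1) * (odd_pairs_gf (Suc k) * hom_gf J r)) $ n \<le> peaked_coeff r n"
proof -
  define F where "F = (\<Sum>k<n. fps_X ^ (2*k+1) * odd_pairs_gf (Suc k))"
  define Q where "Q = (\<Sum>k<J. fps_X ^ (2*k+1) * (odd_pairs_gf (Suc k) * hom_gf J r))"
  have F: "F $ (n - i) = peaked_coeff 0 (n - i)" for i
    using coeff_sum_X_power_cutoff[of "n - i" n 1 "\<lambda>k. odd_pairs_gf (Suc k)"]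
    by (simp add: F_def peaked_coeff_def del: odd_pairs_gf.simps power_Suc)
  define P where "P = (\<lambda>k L. fps_X ^ (2*k+1) * (odd_pairs_gf (Suc k) * hom_gf L r))"
  have split: "(\<Sum>k<n. g k) = (\<Sum>k<J. g k) + (\<Sum>k=J..<n. g k)" for g :: "nat \<Rightarrow> real fps"
    using assms by (simp add: lessThan_atLeast0 sum.atLeastLessThan_concat)
  have HF: "hom_gf J r * F = (\<Sum>k<n. P k J)"
    by (simp only: F_def P_def sum_distrib_left mult_ac)
  have "(\<Sum>k<n. P k (Suc k)) - (hom_gf J r * F - Q)
      = (\<Sum>k<J. P k (Suc k)) + (\<Sum>k=J..<n. P k (Suc k) - P k J)"
    unfolding HF split[of "\<lambda>k. P k (Suc k)"] split[of "\<lambda>k. P k J"]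
    by (simp add: Q_def P_def sum_subtractf del: odd_pairs_gf.simps hom_gf.simps power_Suc)
  also have "(\<Sum>k=J..<n. P k (Suc k) - P k J)
      = (\<Sum>k=J..<n. fps_X ^ (2*k+1) * (odd_pairs_gf (Suc k) * (hom_gf (Suc k) r - hom_gf J r)))"
    by (simp only: P_def right_diff_distrib)
  finally have "fps_nonneg ((\<Sum>k<n. P k (Suc k)) - (hom_gf J r * F - Q))"
    unfolding P_def
    by (simp only:)
       (intro fps_nonneg_add fps_nonneg_sum fps_nonneg_mult hom_gf_mono fps_nonneg_simps
          fps_nonneg_odd_pairs_gf fps_nonneg_hom_gf; simp)
  then have "(hom_gf J r * F) $ n - Q $ n \<le> peaked_coeff r n"
    by (simp add: fps_nonneg_def peaked_coeff_def P_def del: odd_pairs_gf.simps hom_gf.simps power_Suc)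
  then show ?thesis by (simp add: fps_mult_nth F atLeast0AtMost Q_def)
qed

text \<open>
  The upper bound uses all parts and the fact that \<open>hom_limit\<close> already bounds the scaled sums; the lower bound uses the
  first \<open>J\<close> odd parts, and its limit increases to \<open>hom_limit\<close> with \<open>J\<close>.
\<close>
lemma peaked_coeff_asymptotic:
  "(\<lambda>n. saddle n ^ (2*r) * peaked_coeff r n / (growth_const * growth n)) \<longlonglongrightarrow> hom_limit r"
proof -
  have "1 / (2 powr (9/4) * 3 powr (1/4)) = 2 * growth_const"
  proof -
    have "(2 :: real) powr (13/4) = 2 powr (9/4) * 2 powr 1" by (simp only: powr_add[symmetric]) simp
    then show ?thesis by (simp add: growth_const_def)
  qed
  then have "(\<lambda>n. pair_coeff n / growth n) \<longlonglongrightarrow> 2 * growth_const"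
    using pair_coeff_asymptotic unfolding growth_def by simp
  then have u: "(\<lambda>n. peaked_coeff 0 n / growth n) \<longlonglongrightarrow> growth_const"
    by (rule peaked_coeff_0_asymptotic)
  note conv = growth_sequence_convolution[OF growth_const_pos peaked_coeff_nonneg u]
  have h0: "0 \<le> hom_gf K r $ k" for K k using fps_nonneg_hom_gf[of K r] by (simp add: fps_nonneg_def)
  have bound: "s ^ (2*r) * (\<Sum>k\<le>n. hom_gf K r $ k * exp (- (real k * s))) \<le> hom_limit r" if "s > 0" for s n K
  proof -
    have "s ^ (2*r) * (\<Sum>k\<le>n. hom_gf K r $ k * exp (- (real k * s))) \<le> s ^ (2*r) * hom_sum (exp_weights s) K r"
      using partial_hom_sum_le[OF that] that by (intro mult_left_mono) auto
    also have "\<dots> \<le> hom_sum recip_odd_sq K r" by (rule scaled_hom_sum_le[OF that])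
    also have "\<dots> \<le> hom_limit r" by (rule hom_sum_le_hom_limit)
    finally show ?thesis .
  qed
  define c where "c = (\<lambda>n. saddle n ^ (2*r) / (growth_const * growth n))"
  have c: "\<forall>\<^sub>F n in sequentially. c n \<ge> 0 \<and> saddle n > 0"
    using eventually_saddle_pos eventually_gt_at_top[of 0]
  proof eventually_elim
    case (elim n)
    then show ?case using growth_pos[of n] growth_const_pos by (simp add: c_def)
  qed
  show ?thesis
  proof (rule order_tendstoI)
    fix a assume a: "a < hom_limit r"
    have "\<forall>\<^sub>F J in sequentially. a < hom_sum recip_odd_sq J r"
      using hom_limit_tendsto a by (rule order_tendstoD)
    then obtain J where J: "a < hom_sum recip_odd_sq J r" by (auto simp: eventually_sequentially)
    define S where "S = (\<lambda>n. \<Sum>k\<le>n. hom_gf J r $ k * peaked_coeff 0 (n - k))"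
    define Q where "Q = (\<Sum>k<J. fps_X ^ (2*k+1) * (odd_pairs_gf (Suc k) * hom_gf J r))"
    have "poly_bounded Q"
      unfolding Q_def by (intro poly_bounded_sum poly_bounded_mult poly_bounded_base poly_bounded_odd_pairs_gf poly_bounded_hom_gf)
    then have Q0: "(\<lambda>n. saddle n ^ (2*r) * Q $ n / (growth_const * growth n)) \<longlonglongrightarrow> 0"
      by (rule poly_bounded_over_growth)
    have "(\<lambda>n. saddle n ^ (2*r) * S n / (growth_const * growth n)
        - saddle n ^ (2*r) * (\<Sum>k\<le>n. hom_gf J r $ k * exp (- (real k * saddle n)))) \<longlonglongrightarrow> 0"
      unfolding S_def by (rule conv[where a = "\<lambda>_ k. hom_gf J r $ k", OF h0 bound])
    from tendsto_diff[OF tendsto_add[OF this partial_hom_sum_tendsto[of r J]] Q0]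
    have "(\<lambda>n. saddle n ^ (2*r) * S n / (growth_const * growth n) - saddle n ^ (2*r) * Q $ n / (growth_const * growth n))
        \<longlonglongrightarrow> hom_sum recip_odd_sq J r" by simp
    then have "\<forall>\<^sub>F n in sequentially. a < saddle n ^ (2*r) * S n / (growth_const * growth n) - saddle n ^ (2*r) * Q $ n / (growth_const * growth n)"
      using J by (rule order_tendstoD)
    then show "\<forall>\<^sub>F n in sequentially. a < saddle n ^ (2*r) * peaked_coeff r n / (growth_const * growth n)"
      using c eventually_ge_at_top[of J]
    proof eventually_elim
      case (elim n)
      have "c n * (S n - Q $ n) \<le> c n * peaked_coeff r n"
        using peaked_coeff_lower[of J n r] elim unfolding S_def Q_def by (intro mult_left_mono) auto
      then show ?case using elim by (simp add: c_def right_diff_distrib)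
    qed
  next
    fix a assume a: "hom_limit r < a"
    define S where "S = (\<lambda>n. \<Sum>k\<le>n. hom_gf n r $ k * peaked_coeff 0 (n - k))"
    have "(\<lambda>n. saddle n ^ (2*r) * S n / (growth_const * growth n)
        - saddle n ^ (2*r) * (\<Sum>k\<le>n. hom_gf n r $ k * exp (- (real k * saddle n)))) \<longlonglongrightarrow> 0"
      unfolding S_def by (rule conv[where a = "\<lambda>n k. hom_gf n r $ k", OF h0 bound])
    then have "\<forall>\<^sub>F n in sequentially. saddle n ^ (2*r) * S n / (growth_const * growth n)
        - saddle n ^ (2*r) * (\<Sum>k\<le>n. hom_gf n r $ k * exp (- (real k * saddle n))) < a - hom_limit r"
      by (rule order_tendstoD) (use a in simp)
    then show "\<forall>\<^sub>F n in sequentially. saddle n ^ (2*r) * peaked_coeff r n / (growth_const * growth n) < a"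
      using c
    proof eventually_elim
      case (elim n)
      have "c n * peaked_coeff r n \<le> c n * S n"
        using peaked_coeff_upper[of r n] elim unfolding S_def by (intro mult_left_mono) auto
      moreover have "saddle n ^ (2*r) * (\<Sum>k\<le>n. hom_gf n r $ k * exp (- (real k * saddle n))) \<le> hom_limit r"
        by (rule bound) (use elim in simp)
      ultimately show ?case using elim by (simp add: c_def)
    qed
  qed
qed

theorem corollary1p1:
  fixes l :: nat
  shows "(\<lambda>n. ou_moment (2 * l) n) \<sim>[sequentially]
    (\<lambda>n. 1 / (2 powr (13/4) * 3 powr (1/4) * real n powr (3/4)) * (- 6 * real n) ^ l
           * euler_poly (2 * l) (1/2) * exp (pi * sqrt (2 * real n / 3)))"
proof -
  obtain T where T: "T l = fact (2 * l)" "\<And>n. ou_moment (2 * l) n = (\<Sum>r\<le>l. T r * peaked_coeff r n)"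
    using ou_moment_eq_peaked_coeff[of l] by blast
  define C where "C = fact (2 * l) * hom_limit l"
  have C: "C > 0" using hom_limit_pos by (simp add: C_def)
  have "(\<lambda>n. \<Sum>r\<le>l. T r * (saddle n ^ (2 * (l - r)) * (saddle n ^ (2*r) * peaked_coeff r n / (growth_const * growth n))))
      \<longlonglongrightarrow> (\<Sum>r\<le>l. T r * (0 ^ (2 * (l - r)) * hom_limit r))"
    by (intro tendsto_sum tendsto_mult tendsto_const tendsto_power tendsto_saddle peaked_coeff_asymptotic)
  \<comment> \<open>every step down from \<open>r = l\<close> costs a factor \<open>(saddle n)\<^sup>2\<close>, so only the top central factorial survives\<close>
  also have "(\<Sum>r\<le>l. T r * (0 ^ (2 * (l - r)) * hom_limit r)) = (\<Sum>r\<in>{l}. T r * (0 ^ (2 * (l - r)) * hom_limit r))"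
    by (rule sum.mono_neutral_right) auto
  also have "\<dots> = C" by (simp add: C_def T(1))
  finally have "(\<lambda>n. (\<Sum>r\<le>l. T r * (saddle n ^ (2 * (l - r)) * (saddle n ^ (2*r) * peaked_coeff r n / (growth_const * growth n)))) / C)
      \<longlonglongrightarrow> C / C" by (intro tendsto_divide tendsto_const) (use C in simp_all)
  then have lim: "(\<lambda>n. (\<Sum>r\<le>l. T r * (saddle n ^ (2 * (l - r)) * (saddle n ^ (2*r) * peaked_coeff r n / (growth_const * growth n)))) / C)
      \<longlonglongrightarrow> 1" using C by simp
  show ?thesis
  proof (rule asymp_equivI'[OF Lim_transform_eventually[OF lim]])
    show "\<forall>\<^sub>F n in sequentially.
      (\<Sum>r\<le>l. T r * (saddle n ^ (2 * (l - r)) * (saddle n ^ (2*r) * peaked_coeff r n / (growth_const * growth n)))) / C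
      = ou_moment (2 * l) n / (1 / (2 powr (13/4) * 3 powr (1/4) * real n powr (3/4)) * (- 6 * real n) ^ l
           * euler_poly (2 * l) (1/2) * exp (pi * sqrt (2 * real n / 3)))"
      using eventually_gt_at_top[of 0]
    proof eventually_elim
      case (elim n)
      have "(\<Sum>r\<le>l. T r * (saddle n ^ (2 * (l - r)) * (saddle n ^ (2*r) * peaked_coeff r n / (growth_const * growth n))))
          = (\<Sum>r\<le>l. saddle n ^ (2*l) / (growth_const * growth n) * (T r * peaked_coeff r n))"
      proof (rule sum.cong[OF refl])
        fix r assume "r \<in> {..l}"
        then have "saddle n ^ (2*l) = saddle n ^ (2 * (l - r)) * saddle n ^ (2*r)"
          by (simp flip: power_add add: diff_mult_distrib2)
        then show "T r * (saddle n ^ (2 * (l - r)) * (saddle n ^ (2*r) * peaked_coeff r n / (growth_const * growth n)))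
            = saddle n ^ (2*l) / (growth_const * growth n) * (T r * peaked_coeff r n)" by simp
      qed
      also have "\<dots> = saddle n ^ (2*l) / (growth_const * growth n) * ou_moment (2 * l) n"
        by (simp only: T(2) sum_distrib_left)
      finally have 1: "(\<Sum>r\<le>l. T r * (saddle n ^ (2 * (l - r)) * (saddle n ^ (2*r) * peaked_coeff r n / (growth_const * growth n)))) / C
          = ou_moment (2 * l) n / (growth_const * growth n * (C / saddle n ^ (2*l)))"
        using saddle_pos[of n] elim by simp
      have "C / saddle n ^ (2*l) = (- 6 * real n) ^ l * euler_poly (2 * l) (1/2)"
      proof -
        have sd: "saddle n ^ (2*l) = pi ^ (2*l) / (6 * real n) ^ l"
          by (simp add: power_mult saddle_def power_divide)
        have "- 6 * real n = - 1 * (6 * real n)" by simp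
        then have neg: "(- 6 * real n) ^ l = (- 1) ^ l * (6 * real n) ^ l"
          by (simp only: power_mult_distrib)
        have sg: "(- 1 :: real) ^ l * (- 1) ^ l = 1"
          by (simp only: power_mult_distrib[symmetric]) simp
        have "c * h / (p / X) = (sg * X) * (c * (sg * h / p))" if "sg * sg = 1" for c h p X sg :: real
        proof -
          have "(sg * X) * (c * (sg * h / p)) = (sg * sg) * (X * c * h / p)"
            by (simp only: divide_inverse mult_ac)
          also have "\<dots> = c * h / (p / X)" unfolding that by (simp add: mult_ac)
          finally show ?thesis ..
        qed
        from this[OF sg] show ?thesis
          unfolding euler_poly_eq_hom_limit C_def sd neg .
      qed
      moreover have "real n powr (- (3/4)) = 1 / real n powr (3/4)" by (rule powr_minus_divide)
      moreover have "1 / (a * b) * (1 / p * e) * (P * Q) = 1 / (a * b * p) * P * Q * e" for a b p e P Q :: real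
        by simp
      ultimately have 2: "growth_const * growth n * (C / saddle n ^ (2*l))
          = 1 / (2 powr (13/4) * 3 powr (1/4) * real n powr (3/4)) * (- 6 * real n) ^ l
             * euler_poly (2 * l) (1/2) * exp (pi * sqrt (2 * real n / 3))"
        unfolding growth_const_def growth_def by simp
      show ?case unfolding 1 2 ..
    qed
  qed
qed

end
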